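(* For every $\epsilon>0$ there exists a computable positive integer $\ell$ (depending only on $\epsilon$) such that for every irrational real number $\alpha>1$ and every real $\beta\geq 0$, the least prime $p$ in the Beatty sequence $\mathcal{B}(\alpha,\beta)$ satisfies $$ p \leq \mathcal{L}^{35-16\epsilon}\,\alpha^{2(1-\epsilon)}\, B\, p_{m+\ell}^{1+\epsilon}, $$ where $B=\max\{1,\beta\}$, $\mathcal{L}=\log(2\alpha B)$, $p_n$ denotes the numerator of the $n$-th convergent of the regular continued fraction expansion of $\alpha$, and $m$ is the unique integer such that $$ p_m \leq \mathcal{L}^{16}\alpha^2 < p_{m+1}. $$
   Context: For a positive real $\alpha$ and a non-negative real $\beta$, the (generalized) Beatty sequence is $\mathcal{B}(\alpha,\beta)=\{\lfloor n\alpha+\beta\rfloor : n\in\mathbb{N}\}$, where $\lfloor x\rfloor$ is the largest integer $\leq x$ and $\mathbb{N}=\{1,2,3,\dots\}$. If $\alpha=[a_0;a_1,a_2,\ldots]$ is the regular continued fraction expansion of $\alpha$, the numerators of its convergents are defined recursively by $p_{-1}=1$, $p_0=a_0=\lfloor\alpha\rfloor$, and $p_{n+1}=a_{n+1}p_n+p_{n-1}$ for $n\geq 0$; they form a strictly increasing sequence of integers. *)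

theory Defs
  imports Complex_Main "HOL-Computational_Algebra.Primes"
begin

definition beatty :: "real \<Rightarrow> real \<Rightarrow> int set" where
  "beatty \<alpha> \<beta> = {\<lfloor>real n * \<alpha> + \<beta>\<rfloor> | n :: nat. n \<ge> 1}"

definition is_least_prime_in :: "int \<Rightarrow> int set \<Rightarrow> bool" where
  "is_least_prime_in p S \<longleftrightarrow> p \<in> S \<and> prime p \<and> (\<forall>q\<in>S. prime q \<longrightarrow> p \<le> q)"

primrec complete_quotient :: "real \<Rightarrow> nat \<Rightarrow> real" where
  "complete_quotient \<alpha> 0 = \<alpha>"
| "complete_quotient \<alpha> (Suc n) = 1 / frac (complete_quotient \<alpha> n)"

definition partial_quotient :: "real \<Rightarrow> nat \<Rightarrow> int" where
  "partial_quotient \<alpha> n = \<lfloor>complete_quotient \<alpha> n\<rfloor>"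

(* Index k stands for p_(k-2): the recursion is started from p_(-2) = 0 and p_(-1) = 1,
   so that it yields p_0 = a_0. *)
fun shifted_numerator :: "real \<Rightarrow> nat \<Rightarrow> int" where
  "shifted_numerator \<alpha> 0 = 0"
| "shifted_numerator \<alpha> (Suc 0) = 1"
| "shifted_numerator \<alpha> (Suc (Suc k)) =
     partial_quotient \<alpha> k * shifted_numerator \<alpha> (Suc k) + shifted_numerator \<alpha> k"

(* The numerator p_n of the n-th convergent; meaningful for n \<ge> -2 only. *)
definition conv_numerator :: "real \<Rightarrow> int \<Rightarrow> int" where
  "conv_numerator \<alpha> n = shifted_numerator \<alpha> (nat (n + 2))"

(* m is the index with p_m \<le> X < p_(m+1).  The value p_(-2) = 0 (the usual backward
   continuation of the recursion) is admitted so that m exists for every X \<ge> 0: for 0 \<le> X < 1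
   it is m = -2, whereas no index m \<ge> -1 satisfies p_m \<le> X.  For X \<ge> 1 it changes nothing.
   Values X < 1 do occur for X = (ln (2 * \<alpha> * B)) ^ 16 * \<alpha>^2, e.g. for \<beta> = 0 and
   \<alpha> close to 1. *)
definition numerator_bracket :: "real \<Rightarrow> real \<Rightarrow> int \<Rightarrow> bool" where
  "numerator_bracket \<alpha> X m \<longleftrightarrow>
     m \<ge> -2 \<and> real_of_int (conv_numerator \<alpha> m) \<le> X \<and> X < real_of_int (conv_numerator \<alpha> (m + 1))"

(* recursive_fun n f: on argument lists of length n (its values elsewhere are irrelevant), f is a
   total recursive function of n arguments.  Minimisation is restricted to regular functions; by
   Kleene's normal form theorem this still gives every total computable function. *)
inductive recursive_fun :: "nat \<Rightarrow> (nat list \<Rightarrow> nat) \<Rightarrow> bool" where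
  zero: "recursive_fun n (\<lambda>_. 0)"
| succ: "recursive_fun 1 (\<lambda>xs. Suc (xs ! 0))"
| proj: "i < n \<Longrightarrow> recursive_fun n (\<lambda>xs. xs ! i)"
| comp: "recursive_fun (length gs) f \<Longrightarrow> (\<forall>g\<in>set gs. recursive_fun n g) \<Longrightarrow>
           recursive_fun n (\<lambda>xs. f (map (\<lambda>g. g xs) gs))"
| prim_rec: "recursive_fun n f \<Longrightarrow> recursive_fun (n + 2) g \<Longrightarrow>
           recursive_fun (Suc n)
             (\<lambda>xs. rec_nat (f (tl xs)) (\<lambda>k r. g (k # r # tl xs)) (hd xs))"
| minim: "recursive_fun (Suc n) f \<Longrightarrow> (\<forall>xs. length xs = n \<longrightarrow> (\<exists>y. f (y # xs) = 0)) \<Longrightarrow>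
           recursive_fun n (\<lambda>xs. LEAST y. f (y # xs) = 0)"

(* A function of a positive real into the naturals that is computable at rational arguments,
   uniformly in numerator and denominator.  Computability from approximations to an arbitrary real
   is not asked for: it would force a function on the positive reals to be constant. *)
definition computable_at_pos_rationals :: "(real \<Rightarrow> nat) \<Rightarrow> bool" where
  "computable_at_pos_rationals h \<longleftrightarrow>
     (\<exists>F. recursive_fun 2 F \<and> (\<forall>a>0. \<forall>b>0. h (real a / real b) = F [a, b]))"

end

theory Submission
  imports
    Defs
    "HOL-Analysis.Analysis"
    "HOL-Number_Theory.Number_Theory"
    "HOL-Computational_Algebra.Squarefree"
begin

text \<open>
  A prime \<open>p > \<beta>\<close> lies in the Beatty sequence iff \<open>(p - \<beta>) / \<alpha>\<close> falls modulo 1 into a fixed interval of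
  length \<open>1 / \<alpha>\<close>.  This is detected by a trigonometric polynomial of degree \<open>J < 2 \<alpha>\<close> that is nonpositive
  off the interval, namely \<open>(cos 2\<pi>x - cos (\<pi>/\<alpha>)) |A(x)|\<^sup>2\<close> with Fejer's extremal polynomial \<open>A\<close>.
  So it suffices that the sum over \<open>h \<le> J\<close> of the exponential sums
  \<open>\<Sum>n \<le> N. \<Lambda>(n) e(h n / \<alpha>)\<close>, with arbitrary coefficients of modulus at most 1, is a small multiple of \<open>N\<close>.
  Bounding the sums one by one would only give this for \<open>N\<close> of order \<open>\<alpha>\<^sup>5\<close>.  Averaging over \<open>h\<close> does better:
  in Vaughan's identity, \<open>h\<close> is merged with the inner variable of the bilinear sums (\<open>r = h k\<close>) before
  Cauchy's inequality is applied.  If \<open>q\<close> is the numerator of a convergent of \<open>\<alpha>\<close>, so that the multiples of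
  \<open>1 / \<alpha>\<close> are well spaced at scale \<open>1 / q\<close>, then up to powers of \<open>log N\<close> it is enough to have
  \<open>q \<ge> \<alpha>\<^sup>2\<close>, \<open>N \<ge> \<alpha> q\<close> and \<open>N \<ge> \<alpha>\<^sup>4\<close>.

  Write \<open>X = L\<^sup>1\<^sup>6 \<alpha>\<^sup>2\<close> and \<open>Q = q / X\<close> with \<open>q = p\<^bsub>m + l\<^esub>\<close>.  Then \<open>Q\<close> is exponentially large in
  \<open>l\<close>, the claimed bound equals \<open>L\<^sup>3\<^sup>5 \<alpha>\<^sup>2 B q Q\<^sup>\<epsilon>\<close>, and \<open>log N\<close> is at most a multiple of \<open>L (1 + log Q)\<close>; the
  factor \<open>Q\<^sup>\<epsilon>\<close> absorbs all powers of \<open>1 + log Q\<close> once \<open>l\<close> exceeds a constant times \<open>1 / \<epsilon>\<^sup>2\<close>.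
\<close>

section \<open>Geometric sums at well-spaced points\<close>

text \<open>The exponents follow from one count. With G of order log N, the bilinear bound has G^9
  under the root and G^2 in front of it, so a saving of G^13 is needed. This puts the 13th power
  into the cut-offs of Vaughan's identity, U about \<alpha>^2 G^13 and V about \<alpha> G^13, and
  into q >= \<alpha>^2 G^13 and N >= \<alpha> q G^13, while U V^2 <= N becomes N >= \<alpha>^4 G^39.
  Since q = L^16 \<alpha>^2 Q, the powers of L on offer are 16, 35 and 35 + 16 = 51, where 13, 13
  and 39 are used. They cannot simply be raised, because L may lie below 1. It is at least log 2 >
  1/2, so each surplus power of L costs at most a factor 2, charged to
  \<open>prime_bound_constant\<close>. Numerators rather than denominators occur because the
  inverted convergents d / p approximate 1 / \<alpha>, and the error 1 / p^2 gives the spacing. In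
  the condition on q there is no factor Q^\<epsilon> to absorb powers of 1 + log Q, only Q itself;
  this is why \<epsilon> is first cut down to at most 1.\<close>

definition ue :: "real \<Rightarrow> complex" where
  "ue x = cis (2 * pi * x)"

definition dist_int :: "real \<Rightarrow> real" where
  "dist_int x = \<bar>x - of_int (round x)\<bar>"

text \<open>The minimum of \<open>M\<close> and \<open>1 / (2 dist_int x)\<close>, where the latter counts as infinite for integral \<open>x\<close>
  (Isabelle's quotient would be \<open>0\<close>).\<close>

definition geom_bound :: "real \<Rightarrow> real \<Rightarrow> real" where
  "geom_bound M x = (if 2 * M * dist_int x \<le> 1 then M else 1 / (2 * dist_int x))"

text \<open>This is what an approximation of \<theta> by a reduced fraction d / q with error at most
  1 / q^2 provides: j d / q is at least 1 / q away from the integers, and for |j| <= q / 2 the error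
  uses up at most half of that.\<close>

definition spaced :: "real \<Rightarrow> nat \<Rightarrow> bool" where
  "spaced \<theta> q \<longleftrightarrow> (\<forall>j::int. j \<noteq> 0 \<longrightarrow> 2 * \<bar>j\<bar> \<le> int q \<longrightarrow> 1 / (2 * real q) \<le> dist_int (of_int j * \<theta>))"

lemma norm_ue [simp]: "norm (ue x) = 1"
  by (simp add: ue_def)

lemma ue_add: "ue (x + y) = ue x * ue y"
  by (simp add: ue_def cis_mult algebra_simps)

lemma cnj_ue: "cnj (ue x) = ue (- x)"
  by (simp add: ue_def cis_cnj)

lemma Re_ue: "Re (ue x) = cos (2 * pi * x)"
  by (simp add: ue_def)

lemma dist_int_nonneg: "0 \<le> dist_int x"
  by (simp add: dist_int_def)

lemma dist_int_le_half: "dist_int x \<le> 1/2"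
  unfolding dist_int_def by (metis abs_minus_commute of_int_round_abs_le)

lemma dist_int_le: "dist_int x \<le> \<bar>x - of_int n\<bar>"
  unfolding dist_int_def by (rule round_diff_minimal)

lemma dist_int_diff_le: "dist_int (x - y) \<le> \<bar>(x - of_int (round x)) - (y - of_int (round y))\<bar>"
  using dist_int_le[of "x - y" "round x - round y"] by (simp add: algebra_simps)

lemma dist_int_minus: "dist_int (- x) = dist_int x"
proof -
  have "dist_int (- y) \<le> dist_int y" for y
    using dist_int_le[of "- y" "- round y"] by (simp add: dist_int_def abs_minus_commute)
  from this[of x] this[of "-x"] show ?thesis by simp
qed

text \<open>Jordan's inequality: sine is concave on [0, pi] and so lies above its chord.\<close>

lemma sin_ge_linear:
  assumes "0 \<le> x" "x \<le> pi / 2"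
  shows "2 * x / pi \<le> sin x"
proof -
  define t where "t = 2 * x / pi"
  have t: "0 \<le> t" "t \<le> 1" using assms by (auto simp: t_def field_simps)
  have "convex_on {0..pi} (\<lambda>x. - sin x)"
    by (rule f''_ge0_imp_convex[where f' = "\<lambda>x. - cos x" and f'' = sin])
       (auto intro!: derivative_eq_intros sin_ge_zero)
  then have "- sin ((1 - t) *\<^sub>R 0 + t *\<^sub>R (pi/2)) \<le> (1 - t) * (- sin 0) + t * (- sin (pi/2))"
    using t by (intro convex_onD) auto
  moreover have "(1 - t) *\<^sub>R 0 + t *\<^sub>R (pi/2) = x" by (simp add: t_def)
  ultimately show ?thesis by (simp add: t_def)
qed

lemma abs_sin_ge_dist_int: "2 * dist_int x \<le> \<bar>sin (pi * x)\<bar>"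
proof -
  define y where "y = x - of_int (round x)"
  have "sin (pi * x) = sin (pi * y + pi * of_int (round x))"
    by (simp add: y_def algebra_simps)
  also have "\<dots> = sin (pi * y) * cos (pi * of_int (round x))"
    by (simp add: sin_add sin_zero_iff_int2)
  finally have "\<bar>sin (pi * x)\<bar> = \<bar>sin (pi * y)\<bar> * \<bar>cos (pi * of_int (round x))\<bar>"
    by (simp add: abs_mult)
  also have "\<bar>cos (pi * of_int (round x))\<bar> = 1"
    using cos_int_times_real[of "round x" pi] by (simp add: mult.commute cos_integer_2pi)
  also have "\<bar>sin (pi * y)\<bar> = \<bar>sin (pi * \<bar>y\<bar>)\<bar>" by (auto simp: abs_if)
  finally have eq: "\<bar>sin (pi * x)\<bar> = \<bar>sin (pi * \<bar>y\<bar>)\<bar>" by simp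
  have "\<bar>y\<bar> \<le> 1/2" using dist_int_le_half[of x] by (simp add: dist_int_def y_def)
  then have "2 * (pi * \<bar>y\<bar>) / pi \<le> sin (pi * \<bar>y\<bar>)"
    by (intro sin_ge_linear) auto
  then show ?thesis unfolding eq by (simp add: dist_int_def y_def)
qed

lemma norm_one_minus_ue: "norm (1 - ue x) = 2 * \<bar>sin (pi * x)\<bar>"
proof -
  have "(norm (1 - ue x))\<^sup>2 = (1 - cos (2 * (pi * x)))\<^sup>2 + (sin (2 * (pi * x)))\<^sup>2"
    by (simp add: cmod_power2 ue_def mult.assoc)
  also have "\<dots> = 2 - 2 * cos (2 * (pi * x))"
    using sin_cos_squared_add[of "2 * (pi * x)"] by (simp add: power2_eq_square algebra_simps)
  also have "\<dots> = (2 * \<bar>sin (pi * x)\<bar>)\<^sup>2"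
    by (simp add: cos_double_sin power_mult_distrib)
  finally show ?thesis by (rule power2_eq_imp_eq) auto
qed

lemma geom_bound_nonneg: "0 \<le> M \<Longrightarrow> 0 \<le> geom_bound M x"
  by (simp add: geom_bound_def dist_int_nonneg)

lemma geom_bound_minus: "geom_bound M (- x) = geom_bound M x"
  by (simp add: geom_bound_def dist_int_minus)

lemma geom_bound_le: "geom_bound M x \<le> M"
proof (cases "2 * M * dist_int x \<le> 1")
  case False
  then have "dist_int x > 0" using dist_int_nonneg[of x] by (cases "dist_int x = 0") auto
  with False show ?thesis by (simp add: geom_bound_def field_simps)
qed (simp add: geom_bound_def)

lemma geom_bound_le_inverse:
  assumes "0 < d" "d \<le> dist_int x"
  shows "geom_bound M x \<le> 1 / (2 * d)"
proof (cases "2 * M * dist_int x \<le> 1")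
  case True
  with assms have "M \<le> 1 / (2 * dist_int x)" by (simp add: field_simps)
  also have "\<dots> \<le> 1 / (2 * d)" using assms by (simp add: frac_le)
  finally show ?thesis using True by (simp add: geom_bound_def)
next
  case False
  then show ?thesis using assms by (simp add: geom_bound_def frac_le)
qed

text \<open>The second hypothesis is free of division and hence valid for integral x too. Its
  constants are those of the geometric sum: |1 - e(x)| >= 4 \<open>dist_int x\<close>, and the
  telescoped sum has modulus at most 2.\<close>

lemma le_geom_bound:
  assumes "a \<le> M" "4 * dist_int x * a \<le> 2"
  shows "a \<le> geom_bound M x"
proof (cases "2 * M * dist_int x \<le> 1")
  case False
  then have "dist_int x > 0" using dist_int_nonneg[of x] by (cases "dist_int x = 0") auto
  with False assms show ?thesis by (simp add: geom_bound_def field_simps)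
qed (use assms in \<open>simp add: geom_bound_def\<close>)

lemma geom_bound_mono:
  assumes "M \<le> M'" shows "geom_bound M x \<le> geom_bound M' x"
proof (rule le_geom_bound)
  show "geom_bound M x \<le> M'" using geom_bound_le[of M x] assms by simp
  show "4 * dist_int x * geom_bound M x \<le> 2"
    by (auto simp: geom_bound_def algebra_simps)
qed

lemma norm_sum_ue_le: "norm (\<Sum>m\<in>{a<..b}. ue (real m * x)) \<le> geom_bound (real (b - a)) x"
proof (rule le_geom_bound)
  have "norm (\<Sum>m\<in>{a<..b}. ue (real m * x)) \<le> (\<Sum>m\<in>{a<..b}. 1)"
    by (rule sum_norm_le) simp
  then show "norm (\<Sum>m\<in>{a<..b}. ue (real m * x)) \<le> real (b - a)" by simp
  let ?S = "\<Sum>m\<in>{a<..b}. ue (real m * x)"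
  have tele: "(1 - ue x) * (\<Sum>m\<in>{a<..a+k}. ue (real m * x)) = ue (real (Suc a) * x) - ue (real (Suc (a + k)) * x)" for k
  proof (induction k)
    case (Suc k)
    have "{a<..a + Suc k} = insert (a + Suc k) {a<..a + k}" by auto
    moreover have "ue x * ue (real (a + Suc k) * x) = ue (real (Suc (a + Suc k)) * x)"
      by (simp add: ue_add[symmetric] algebra_simps)
    ultimately have "(1 - ue x) * (\<Sum>m\<in>{a<..a + Suc k}. ue (real m * x)) =
        (ue (real (a + Suc k) * x) - ue (real (Suc (a + Suc k)) * x)) + (1 - ue x) * (\<Sum>m\<in>{a<..a+k}. ue (real m * x))"
      by (simp add: left_diff_distrib ring_distribs)
    then show ?case unfolding Suc by simp
  qed simp
  have "norm ((1 - ue x) * ?S) \<le> 2"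
  proof (cases "a \<le> b")
    case True
    then have "(1 - ue x) * ?S = ue (real (Suc a) * x) - ue (real (Suc b) * x)"
      using tele[of "b - a"] by simp
    then show ?thesis using norm_triangle_ineq4[of "ue (real (Suc a) * x)" "ue (real (Suc b) * x)"] by simp
  qed simp
  then have "2 * \<bar>sin (pi * x)\<bar> * norm ?S \<le> 2"
    by (simp add: norm_mult norm_one_minus_ue)
  moreover have "4 * dist_int x * norm ?S \<le> 2 * \<bar>sin (pi * x)\<bar> * norm ?S"
    using abs_sin_ge_dist_int[of x] by (intro mult_right_mono) auto
  ultimately show "4 * dist_int x * norm ?S \<le> 2" by simp
qed

section \<open>Sums of geometric bounds over the multiples of a well-spaced number\<close>

lemma sum_inverse_le_ln:
  assumes "n \<ge> 1" shows "(\<Sum>i=1..n. 1 / real i) \<le> 1 + ln (real n)"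
proof -
  have "harm (Suc (n - 1)) - ln (real (Suc (n - 1))) \<le> harm (Suc 0) - ln (real (Suc 0))"
    using decseqD[OF decseq_harm_diff_ln, of 0 "n - 1"] by simp
  then have "harm n \<le> 1 + ln (real n)" using assms by (simp add: harm_def)
  then show ?thesis by (simp add: harm_def divide_inverse)
qed

text \<open>Used for spaced points: \<open>f\<close> sends a point to the number of its cell, and
  since no cell is shared, each point can be charged to its cell.\<close>

lemma sum_image_nat_le:
  fixes f :: "'a \<Rightarrow> nat"
  assumes "finite S" "inj_on f S" "\<And>x. x \<in> S \<Longrightarrow> f x \<le> n" "\<And>x. x \<in> S \<Longrightarrow> u x \<le> v (f x)" "\<And>i. 0 \<le> v i"
  shows "(\<Sum>x\<in>S. u x) \<le> (\<Sum>i\<le>n. v i :: real)"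
proof -
  have "(\<Sum>x\<in>S. u x) \<le> (\<Sum>x\<in>S. v (f x))" by (rule sum_mono) (rule assms)
  also have "\<dots> = (\<Sum>i\<in>f ` S. v i)" by (simp add: sum.reindex[OF assms(2)])
  also have "\<dots> \<le> (\<Sum>i\<le>n. v i)" using assms by (intro sum_mono2) auto
  finally show ?thesis .
qed

text \<open>Two indices in the block differ by at most q / 2, so modulo 1 their points are at least
  1 / (2q) apart and no two share a cell [n / (2q), (n + 1) / (2q)). A point whose cell is n cells
  away from 0 contributes at most q / n; only the two cells next to 0 need the trivial bound
  \<open>M\<close>.\<close>

lemma sum_geom_bound_block:
  assumes sp: "spaced \<theta> q" and q: "q \<ge> 1" and M: "0 \<le> M" and k: "2 * k \<le> q + 2"
  shows "(\<Sum>r\<in>{a..<a + int k}. geom_bound M (of_int r * \<theta> + s)) \<le> 2 * M + 2 * real q * (1 + ln (real q))"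
proof -
  define S where "S = {a..<a + int k}"
  define y where "y r = of_int r * \<theta> + s - of_int (round (of_int r * \<theta> + s))" for r :: int
  define f where "f r = \<lfloor>2 * real q * y r\<rfloor>" for r
  define v where "v n = (if n = 0 then M else real q / real n)" for n :: nat
  have dy: "dist_int (of_int r * \<theta> + s) = \<bar>y r\<bar>" for r by (simp add: dist_int_def y_def)
  have yb: "\<bar>y r\<bar> \<le> 1/2" for r using dist_int_le_half dy by metis
  have inj: "inj_on f S"
  proof (rule inj_onI, rule ccontr)
    fix r r' assume r: "r \<in> S" "r' \<in> S" "f r = f r'" "r \<noteq> r'"
    have "dist_int (of_int (r - r') * \<theta>) \<le> \<bar>y r - y r'\<bar>"
      using dist_int_diff_le[of "of_int r * \<theta> + s" "of_int r' * \<theta> + s"]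
      by (simp add: y_def algebra_simps)
    moreover have "\<bar>2 * real q * y r - 2 * real q * y r'\<bar> < 1"
      using r(3) unfolding f_def by linarith
    then have "2 * real q * \<bar>y r - y r'\<bar> < 1"
      by (simp add: right_diff_distrib[symmetric] abs_mult mult.assoc)
    then have "\<bar>y r - y r'\<bar> < 1 / (2 * real q)" using q by (simp add: field_simps)
    moreover have "1 / (2 * real q) \<le> dist_int (of_int (r - r') * \<theta>)"
    proof -
      have "2 * int k \<le> int q + 2" using k by linarith
      moreover have "a \<le> r" "r < a + int k" "a \<le> r'" "r' < a + int k" using r(1,2) by (auto simp: S_def)
      ultimately have "2 * (r - r') \<le> int q" "2 * (r' - r) \<le> int q" by presburger+
      then have "2 * \<bar>r - r'\<bar> \<le> int q" by (simp add: abs_if)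
      then show ?thesis using sp[unfolded spaced_def, rule_format, of "r - r'"] r(4) by simp
    qed
    ultimately show False by linarith
  qed
  have fb: "- int q \<le> f r" "f r \<le> int q" for r
  proof -
    have "\<bar>2 * real q * y r\<bar> \<le> real q" using yb[of r] q by (simp add: abs_mult)
    then have "- real q \<le> 2 * real q * y r" "2 * real q * y r \<le> real q" by linarith+
    then show "- int q \<le> f r" "f r \<le> int q" unfolding f_def by linarith+
  qed
  have vn: "0 \<le> v i" for i using M by (simp add: v_def)
  have p1: "geom_bound M (of_int r * \<theta> + s) \<le> v (nat (f r))" if "f r \<ge> 0" for r
  proof (cases "f r = 0")
    case True then show ?thesis using geom_bound_le by (simp add: v_def)
  next
    case False
    with that have f1: "f r \<ge> 1" by linarith
    have "of_int (f r) \<le> 2 * real q * y r" unfolding f_def by simp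
    also have "\<dots> \<le> 2 * real q * \<bar>y r\<bar>" by (intro mult_left_mono) auto
    finally have "of_int (f r) / (2 * real q) \<le> dist_int (of_int r * \<theta> + s)"
      using q unfolding dy by (simp add: field_simps)
    then have "geom_bound M (of_int r * \<theta> + s) \<le> 1 / (2 * (of_int (f r) / (2 * real q)))"
      using f1 q by (intro geom_bound_le_inverse) auto
    then show ?thesis using f1 q by (simp add: v_def)
  qed
  \<comment> \<open>The cell adjacent to 0 on the left has floor -1, hence the shift by one.\<close>
  have p2: "geom_bound M (of_int r * \<theta> + s) \<le> v (nat (- f r - 1))" if "f r < 0" for r
  proof (cases "f r = -1")
    case True then show ?thesis using geom_bound_le by (simp add: v_def)
  next
    case False
    define n where "n = nat (- f r - 1)"
    have f1: "n \<ge> 1" and n: "f r = - int n - 1" using that False by (auto simp: n_def)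
    have "2 * real q * y r < of_int (f r) + 1" unfolding f_def by linarith
    moreover have "2 * real q * (- y r) \<le> 2 * real q * \<bar>y r\<bar>" by (intro mult_left_mono) auto
    ultimately have "real n \<le> 2 * real q * \<bar>y r\<bar>" by (simp add: n)
    then have "real n / (2 * real q) \<le> dist_int (of_int r * \<theta> + s)"
      using q unfolding dy by (simp add: field_simps)
    then have "geom_bound M (of_int r * \<theta> + s) \<le> 1 / (2 * (real n / (2 * real q)))"
      using f1 q by (intro geom_bound_le_inverse) auto
    then show ?thesis using f1 q by (simp add: v_def n_def[symmetric])
  qed
  have fin: "finite S" by (simp add: S_def)
  let ?g = "\<lambda>r. geom_bound M (of_int r * \<theta> + s)"
  have "(\<Sum>r\<in>S. ?g r) = (\<Sum>r\<in>{r\<in>S. f r \<ge> 0}. ?g r) + (\<Sum>r\<in>{r\<in>S. f r < 0}. ?g r)"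
    using fin by (subst sum.union_disjoint[symmetric]) (auto intro!: sum.cong)
  also have "(\<Sum>r\<in>{r\<in>S. f r \<ge> 0}. ?g r) \<le> (\<Sum>i\<le>q. v i)"
    using fin p1 vn fb inj by (intro sum_image_nat_le[where f = "\<lambda>r. nat (f r)"])
      (auto simp: inj_on_def nat_le_iff)
  also have "(\<Sum>r\<in>{r\<in>S. f r < 0}. ?g r) \<le> (\<Sum>i\<le>q. v i)"
  proof (rule sum_image_nat_le[where f = "\<lambda>r. nat (- f r - 1)"])
    show "inj_on (\<lambda>r. nat (- f r - 1)) {r \<in> S. f r < 0}"
      using inj by (auto simp: inj_on_def)
    show "nat (- f r - 1) \<le> q" for r using fb(1)[of r] by linarith
  qed (use fin p2 vn in auto)
  also have "(\<Sum>i\<le>q. v i) = M + real q * (\<Sum>i=1..q. 1 / real i)"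
  proof -
    have "{..q} = insert 0 {1..q}" by auto
    then have "(\<Sum>i\<le>q. v i) = v 0 + (\<Sum>i=1..q. v i)" by simp
    also have "(\<Sum>i=1..q. v i) = (\<Sum>i=1..q. real q * (1 / real i))"
      by (intro sum.cong) (auto simp: v_def)
    finally show ?thesis by (simp add: v_def sum_distrib_left)
  qed
  also have "M + real q * (\<Sum>i=1..q. 1 / real i) \<le> M + real q * (1 + ln (real q))"
    using sum_inverse_le_ln[OF q] by (intro add_left_mono mult_left_mono) auto
  finally show ?thesis by (simp add: S_def)
qed

text \<open>The range is cut into blocks of the greatest length that
  \<open>sum_geom_bound_block\<close> admits, q div 2 + 1; at most 2 R / q + 1 of them are
  needed.\<close>

lemma sum_geom_bound_interval:
  assumes sp: "spaced \<theta> q" and q: "q \<ge> 1" and M: "0 \<le> M"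
  shows "(\<Sum>r=1..R. geom_bound M (real r * \<theta> + s)) \<le> (2 * real R / real q + 1) * (2 * M + 2 * real q * (1 + ln (real q)))"
proof -
  define b where "b = q div 2 + 1"
  define X where "X = 2 * M + 2 * real q * (1 + ln (real q))"
  have X0: "X \<ge> 0" using M q by (simp add: X_def)
  have b: "b \<ge> 1" "2 * b \<le> q + 2" "real q \<le> 2 * real b" by (auto simp: b_def)
  let ?g = "\<lambda>r. geom_bound M (real r * \<theta> + s)"
  have blk: "(\<Sum>r\<in>{a..<a+b}. ?g r) \<le> X" for a
  proof -
    have "(\<Sum>r\<in>{a..<a+b}. ?g r) = (\<Sum>r\<in>int ` {a..<a+b}. geom_bound M (of_int r * \<theta> + s))"
      by (subst sum.reindex) auto
    also have "int ` {a..<a+b} = {int a..<int a + int b}"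
      by (simp add: image_int_atLeastLessThan)
    finally show ?thesis using sum_geom_bound_block[OF sp q M b(2)] by (simp add: X_def)
  qed
  have it: "(\<Sum>r\<in>{1..<1+n*b}. ?g r) \<le> real n * X" for n
  proof (induction n)
    case (Suc n)
    have "(\<Sum>r\<in>{1..<1+Suc n*b}. ?g r) = (\<Sum>r\<in>{1..<1+n*b}. ?g r) + (\<Sum>r\<in>{1+n*b..<(1+n*b)+b}. ?g r)"
      by (subst sum.atLeastLessThan_concat) (auto simp: algebra_simps)
    also have "\<dots> \<le> real n * X + X" by (intro add_mono Suc.IH blk)
    finally show ?case by (simp add: algebra_simps)
  qed simp
  define n where "n = R div b + 1"
  have "R = b * (R div b) + R mod b" by simp
  moreover have "R mod b < b" using b by simp
  ultimately have "R < b * (R div b) + b" by linarith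
  moreover have "n * b = b * (R div b) + b" by (simp add: n_def algebra_simps)
  ultimately have "R < 1 + n * b" by linarith
  then have "(\<Sum>r=1..R. ?g r) \<le> (\<Sum>r\<in>{1..<1+n*b}. ?g r)"
    using M by (intro sum_mono2) (auto simp: geom_bound_nonneg)
  also have "\<dots> \<le> real n * X" by (rule it)
  also have "real n \<le> 2 * real R / real q + 1"
  proof -
    have "real b * real (R div b) \<le> real R"
      unfolding of_nat_mult[symmetric] of_nat_le_iff by simp
    then have "real (R div b) \<le> real R / real b" using b by (simp add: field_simps)
    also have "\<dots> \<le> real R / (real q / 2)" using b q by (intro divide_left_mono) auto
    finally show ?thesis by (simp add: n_def mult.commute)
  qed
  finally show ?thesis using X0 by (simp add: X_def mult_right_mono)
qed

text \<open>The trivial bound Y / r now varies with r, and a first block with M = Y would be too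
  expensive. There the spacing from the index 0 itself helps: r \<theta> is at least 1 / (2q) away
  from the integers, so each term is at most q and \<open>Y\<close> does not enter. In the j-th
  later block the trivial bound is at most 3 Y / (j q), and the sum over j costs one
  logarithm.\<close>

lemma sum_inverse_geom_bound:
  assumes sp: "spaced \<theta> q" and q: "q \<ge> 2" and Y: "0 \<le> Y"
    and G: "1 + ln (real q) \<le> G" "1 + ln (real R) \<le> G" "R \<ge> 1"
  shows "(\<Sum>r=1..R. geom_bound (Y / real r) (real r * \<theta>)) \<le> 12 * G * (Y / real q + real R + real q)"
proof -
  define b where "b = q div 2"
  have b: "b \<ge> 1" "2 * b \<le> q" using q by (auto simp: b_def)
  have "q \<le> 3 * b" using q unfolding b_def by presburger
  then have b3: "real q \<le> 3 * real b" using of_nat_mono[of q "3 * b", where 'a = real] by simp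
  let ?g = "\<lambda>r. geom_bound (Y / real r) (real r * \<theta>)"
  have lnq: "ln (real q) \<ge> 0" using q by simp
  then have G1: "G \<ge> 1" using G by linarith
  have blk: "(\<Sum>r\<in>{j*b..<j*b+b}. geom_bound M (real r * \<theta>)) \<le> 2 * M + 2 * real q * G" if "M \<ge> 0" for j M
  proof -
    have "(\<Sum>r\<in>{j*b..<j*b+b}. geom_bound M (real r * \<theta>)) = (\<Sum>r\<in>int ` {j*b..<j*b+b}. geom_bound M (of_int r * \<theta> + 0))"
      by (subst sum.reindex) auto
    also have "int ` {j*b..<j*b+b} = {int (j*b)..<int (j*b) + int b}"
      by (simp add: image_int_atLeastLessThan)
    also have "(\<Sum>r\<in>\<dots>. geom_bound M (of_int r * \<theta> + 0)) \<le> 2 * M + 2 * real q * (1 + ln (real q))"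
      using b q that by (intro sum_geom_bound_block[OF sp]) auto
    also have "\<dots> \<le> 2 * M + 2 * real q * G" using G by (intro add_left_mono mult_left_mono) auto
    finally show ?thesis .
  qed
  have first: "(\<Sum>r\<in>{1..<b}. ?g r) \<le> 4 * real q * G"
  proof -
    have "(\<Sum>r\<in>{1..<b}. ?g r) \<le> (\<Sum>r\<in>{1..<b}. geom_bound (real q) (real r * \<theta>))"
    proof (intro sum_mono)
      fix r assume r: "r \<in> {1..<b}"
      have "2 * \<bar>int r\<bar> \<le> int q" using r b by auto
      then have d: "1 / (2 * real q) \<le> dist_int (real r * \<theta>)"
        using sp[unfolded spaced_def, rule_format, of "int r"] r by auto
      show "?g r \<le> geom_bound (real q) (real r * \<theta>)"
      proof (rule le_geom_bound)
        show "?g r \<le> real q" using geom_bound_le_inverse[OF _ d] q by simp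
        show "4 * dist_int (real r * \<theta>) * ?g r \<le> 2" by (auto simp: geom_bound_def algebra_simps)
      qed
    qed
    also have "\<dots> \<le> (\<Sum>r\<in>{0*b..<0*b+b}. geom_bound (real q) (real r * \<theta>))"
      by (intro sum_mono2) (auto simp: geom_bound_nonneg)
    also have "\<dots> \<le> 2 * real q + 2 * real q * G" by (rule blk) simp
    also have "\<dots> \<le> 2 * real q * G + 2 * real q * G" using G1 q by (intro add_right_mono) simp
    finally show ?thesis by (simp add: mult_ac)
  qed
  have later: "(\<Sum>r\<in>{j*b..<j*b+b}. ?g r) \<le> 6 * (Y / real q) * (1 / real j) + 2 * real q * G" if j: "j \<ge> 1" for j
  proof -
    have "(\<Sum>r\<in>{j*b..<j*b+b}. ?g r) \<le> (\<Sum>r\<in>{j*b..<j*b+b}. geom_bound (Y / real (j*b)) (real r * \<theta>))"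
    proof (intro sum_mono geom_bound_mono)
      fix r assume "r \<in> {j*b..<j*b+b}"
      moreover have "0 < j * b" using j b by simp
      ultimately have jr: "j * b \<le> r" "0 < j * b" by auto
      then have "0 < r" by linarith
      note jr this
      then have "real (j * b) \<le> real r" "0 < real (j * b)" "0 < real r" by (simp_all only: of_nat_le_iff of_nat_0_less_iff)
      then show "Y / real r \<le> Y / real (j * b)" using Y by (intro divide_left_mono mult_pos_pos)
    qed
    also have "\<dots> \<le> 2 * (Y / real (j*b)) + 2 * real q * G" using Y by (intro blk) simp
    also have "Y / real (j*b) \<le> 3 * (Y / real q) * (1 / real j)"
    proof -
      have "Y / real (j*b) \<le> Y / (real j * (real q / 3))"
        using Y j b b3 q by (intro divide_left_mono) auto
      then show ?thesis by (simp add: field_simps)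
    qed
    finally show ?thesis by simp
  qed
  have it: "(\<Sum>r\<in>{1..<b + n*b}. ?g r) \<le> 4 * real q * G + 6 * (Y / real q) * (\<Sum>j=1..n. 1 / real j) + real n * (2 * real q * G)" for n
  proof (induction n)
    case 0 then show ?case using first by simp
  next
    case (Suc n)
    have "(\<Sum>r\<in>{1..<b + Suc n*b}. ?g r) = (\<Sum>r\<in>{1..<b + n*b}. ?g r) + (\<Sum>r\<in>{Suc n*b..<Suc n*b+b}. ?g r)"
      using b by (subst sum.atLeastLessThan_concat[symmetric, of 1 "b + n*b"]) (auto simp: algebra_simps)
    also have "\<dots> \<le> (4 * real q * G + 6 * (Y / real q) * (\<Sum>j=1..n. 1 / real j) + real n * (2 * real q * G)) +
       (6 * (Y / real q) * (1 / real (Suc n)) + 2 * real q * G)"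
      by (intro add_mono Suc.IH later) simp
    finally show ?case by (simp add: algebra_simps)
  qed
  define n where "n = R div b"
  have "R = b * (R div b) + R mod b" by simp
  moreover have "R mod b < b" using b by simp
  ultimately have "R < b * (R div b) + b" by linarith
  then have Rn: "R < b + n * b" by (simp add: n_def algebra_simps)
  have nR: "n \<le> R" by (simp add: n_def)
  have H: "(\<Sum>j=1..n. 1 / real j) \<le> G"
  proof -
    have "(\<Sum>j=1..n. 1 / real j) \<le> (\<Sum>j=1..R. 1 / real j)" using nR by (intro sum_mono2) auto
    also have "\<dots> \<le> 1 + ln (real R)" using G by (intro sum_inverse_le_ln)
    finally show ?thesis using G by simp
  qed
  have nq: "real n * real q \<le> 3 * real R"
  proof -
    have "real n * real q \<le> real n * (3 * real b)" using b3 by (intro mult_left_mono) auto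
    also have "\<dots> = 3 * real (n * b)" by simp
    also have "n * b \<le> R" by (simp add: n_def)
    finally show ?thesis by simp
  qed
  have "(\<Sum>r=1..R. ?g r) \<le> (\<Sum>r\<in>{1..<b + n*b}. ?g r)"
    using Y Rn by (intro sum_mono2) (auto simp: geom_bound_nonneg)
  also have "\<dots> \<le> 4 * real q * G + 6 * (Y / real q) * (\<Sum>j=1..n. 1 / real j) + real n * (2 * real q * G)"
    by (rule it)
  also have "\<dots> \<le> 4 * real q * G + 6 * (Y / real q) * G + 6 * real R * G"
  proof -
    have "6 * (Y / real q) * (\<Sum>j=1..n. 1 / real j) \<le> 6 * (Y / real q) * G"
      using H Y by (intro mult_left_mono) auto
    moreover have "(real n * real q) * (2 * G) \<le> (3 * real R) * (2 * G)"
      using nq G1 by (intro mult_right_mono) auto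
    ultimately show ?thesis by (simp add: algebra_simps)
  qed
  also have "\<dots> \<le> 12 * G * (Y / real q + real R + real q)"
  proof -
    have arith: "4 * w + 6 * u + 6 * v \<le> 12 * u + 12 * v + 12 * w"
      if "0 \<le> u" "0 \<le> v" "0 \<le> w" for u v w :: real
      using that by linarith
    have "0 \<le> G * (Y / real q)" "0 \<le> G * real R" "0 \<le> G * real q" using G1 Y by auto
    from arith[OF this] show ?thesis by (simp only: distrib_left mult_ac)
  qed
  finally show ?thesis .
qed

section \<open>Sums over divisors\<close>

lemma sum_divisors_swap:
  fixes F :: "nat \<Rightarrow> nat \<Rightarrow> 'a::comm_monoid_add"
  shows "(\<Sum>n=1..N. \<Sum>d | d dvd n. F d (n div d)) = (\<Sum>d=1..N. \<Sum>m=1..N div d. F d m)"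
proof -
  have "(\<Sum>n=1..N. \<Sum>d | d dvd n. F d (n div d)) = (\<Sum>(n,d)\<in>(SIGMA n:{1..N}. {d. d dvd n}). F d (n div d))"
    by (subst sum.Sigma) auto
  also have "\<dots> = (\<Sum>(d,m)\<in>(SIGMA d:{1..N}. {1..N div d}). F d m)"
  proof (rule sum.reindex_bij_witness[where i = "\<lambda>(d,m). (d*m,d)" and j = "\<lambda>(n,d). (d, n div d)"], goal_cases)
    case (1 x) then show ?case by auto
  next
    case (2 x)
    then obtain n d where x: "x = (n,d)" "1 \<le> n" "n \<le> N" "d dvd n" by auto
    then obtain m where m: "n = d * m" by blast
    with x have "d \<ge> 1" "m \<ge> 1" by (auto intro!: Suc_leI intro: ccontr)
    moreover have "d \<le> N" using x m \<open>m \<ge> 1\<close> by (metis dvd_imp_le le_trans less_eq_Suc_le One_nat_def)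
    moreover have "m \<le> N div d" using x m \<open>d \<ge> 1\<close> by (simp add: less_eq_div_iff_mult_less_eq mult.commute)
    ultimately show ?case using x m by auto
  next
    case (3 x) then show ?case by auto
  next
    case (4 x)
    then obtain d m where x: "x = (d,m)" "1 \<le> d" "d \<le> N" "1 \<le> m" "m \<le> N div d" by auto
    then have "d * m \<le> N" by (simp add: less_eq_div_iff_mult_less_eq mult.commute)
    then show ?case using x by auto
  qed auto
  also have "\<dots> = (\<Sum>d=1..N. \<Sum>m=1..N div d. F d m)"
    by (subst sum.Sigma) auto
  finally show ?thesis .
qed

text \<open>Junk value: \<open>num_divisors 0 = 0\<close>, the cardinality of an infinite set.\<close>

definition num_divisors :: "nat \<Rightarrow> nat" where
  "num_divisors n = card {d. d dvd n}"

text \<open>A pair \<open>(a, b)\<close> of divisors of \<open>r\<close> is encoded by \<open>g = gcd a b\<close>, \<open>x = a / g\<close>, \<open>y = b / g\<close> and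
  \<open>t = r / (g x y)\<close>, so that the square of the divisor function is at most the fourfold divisor function.\<close>

lemma sum_num_divisors_square_div_le:
  assumes R: "R \<ge> 1" and G: "1 + ln (real R) \<le> G"
  shows "(\<Sum>r=1..R. (real (num_divisors r))\<^sup>2 / real r) \<le> G ^ 4"
proof -
  define I where "I = {1..R} \<times> {1..R} \<times> {1..R} \<times> {1..R}"
  define w where "w = (\<lambda>(g,x,y,t). 1 / (real g * real x * real y * real t))"
  define A where "A = (SIGMA r:{1..R}. {d. d dvd r} \<times> {d. d dvd r})"
  define f where "f = (\<lambda>(r,a,b). (gcd a b, a div gcd a b, b div gcd a b, r div (gcd a b * (a div gcd a b) * (b div gcd a b)) :: nat))"
  have key: "\<exists>g x y t. a = g * x \<and> b = g * y \<and> r = g * x * y * t \<and> f (r,a,b) = (g,x,y,t)"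
    if h: "r \<ge> 1" "a dvd r" "b dvd r" for r a b :: nat
  proof -
    define g where "g = gcd a b"
    have ab: "a > 0" "b > 0" using h by (auto intro!: Nat.gr0I)
    then have g: "g > 0" by (simp add: g_def)
    have "g dvd a" "g dvd b" by (simp_all add: g_def)
    then obtain x y where xy: "a = g * x" "b = g * y" by (elim dvdE)
    have cop: "coprime x y"
    proof -
      have "gcd a b = g * gcd x y" unfolding xy by (rule gcd_mult_distrib_nat[symmetric])
      then have "g * gcd x y = g" by (simp only: g_def)
      then have "gcd x y = 1" using g by simp
      then show ?thesis by (rule gcd_eq_1_imp_coprime)
    qed
    have "g dvd r" using \<open>g dvd a\<close> h(2) by (rule dvd_trans)
    then obtain s where s: "r = g * s" by (elim dvdE)
    have "x dvd s" "y dvd s" using h xy s g by auto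
    then have "x * y dvd s" using cop by (simp add: divides_mult)
    then obtain t where t: "s = x * y * t" by blast
    have pos: "x > 0" "y > 0" using ab xy by auto
    have "f (r,a,b) = (g,x,y,t)"
    proof -
      have "f (r,a,b) = (g, a div g, b div g, r div (g * (a div g) * (b div g)))"
        by (simp add: f_def g_def)
      moreover have "a div g = x" "b div g = y" using xy g by simp_all
      moreover have "r = g * x * y * t" using s t by (simp add: mult.assoc)
      ultimately show ?thesis using g pos by simp
    qed
    then show ?thesis using xy s t by (auto simp: mult.assoc)
  qed
  have inj: "inj_on f A"
  proof (rule inj_onI)
    fix u v assume uv: "u \<in> A" "v \<in> A" "f u = f v"
    obtain r a b where u: "u = (r,a,b)" "r \<ge> 1" "a dvd r" "b dvd r" using uv(1) by (auto simp: A_def)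
    obtain r' a' b' where v: "v = (r',a',b')" "r' \<ge> 1" "a' dvd r'" "b' dvd r'" using uv(2) by (auto simp: A_def)
    obtain g x y t where 1: "a = g * x" "b = g * y" "r = g * x * y * t" "f u = (g,x,y,t)"
      using key[OF u(2-4)] u(1) by blast
    obtain g' x' y' t' where 2: "a' = g' * x'" "b' = g' * y'" "r' = g' * x' * y' * t'" "f v = (g',x',y',t')"
      using key[OF v(2-4)] v(1) by blast
    have "(g,x,y,t) = (g',x',y',t')" using 1(4) 2(4) uv(3) by simp
    then show "u = v" unfolding u(1) v(1) 1(1-3) 2(1-3) by simp
  qed
  have le: "g \<le> n" if "n > 0" "n = g * k" for n g k :: nat using that by (cases k) auto
  have fI: "f u \<in> I" and fw: "1 / real (fst u) = w (f u)" if uA: "u \<in> A" for u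
  proof -
    obtain r a b where u: "u = (r,a,b)" "r \<ge> 1" "r \<le> R" "a dvd r" "b dvd r" using uA by (auto simp: A_def)
    from key[OF u(2,4,5)] obtain g x y t where k: "r = g * x * y * t" "f u = (g,x,y,t)" using u(1) by auto
    have pos: "g > 0" "x > 0" "y > 0" "t > 0" using k u by (auto intro!: Nat.gr0I)
    have "g \<le> r" by (rule le[of _ _ "x*y*t"]) (use k u in auto)
    moreover have "x \<le> r" by (rule le[of _ _ "g*y*t"]) (use k u in auto)
    moreover have "y \<le> r" by (rule le[of _ _ "g*x*t"]) (use k u in auto)
    moreover have "t \<le> r" by (rule le[of _ _ "g*x*y"]) (use k u in auto)
    ultimately have "g \<le> R" "x \<le> R" "y \<le> R" "t \<le> R" using u(3) by linarith+
    then show "f u \<in> I" using pos unfolding k(2) I_def by auto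
    show "1 / real (fst u) = w (f u)" using k u by (simp add: w_def)
  qed
  have w0: "w u \<ge> 0" for u by (auto simp: w_def split: prod.splits)
  have "(\<Sum>r=1..R. (real (num_divisors r))\<^sup>2 / real r) = (\<Sum>r=1..R. \<Sum>p\<in>{d. d dvd r} \<times> {d. d dvd r}. 1 / real r)"
    by (intro sum.cong refl) (simp add: num_divisors_def card_cartesian_product power2_eq_square)
  also have "\<dots> = (\<Sum>u\<in>A. 1 / real (fst u))"
    unfolding A_def by (subst sum.Sigma) (auto simp: case_prod_beta)
  also have "\<dots> = (\<Sum>u\<in>A. w (f u))" using fw by (intro sum.cong) auto
  also have "\<dots> = (\<Sum>v\<in>f ` A. w v)" by (simp add: sum.reindex[OF inj])
  also have "\<dots> \<le> (\<Sum>v\<in>I. w v)"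
  proof (rule sum_mono2)
    show "f ` A \<subseteq> I" using fI by blast
  qed (use w0 in \<open>auto simp: I_def\<close>)
  also have "\<dots> = (\<Sum>g=1..R. \<Sum>x=1..R. \<Sum>y=1..R. \<Sum>t=1..R. 1 / (real g * real x * real y * real t))"
    unfolding I_def w_def by (simp add: sum.cartesian_product)
  also have "\<dots> = (\<Sum>g=1..R. \<Sum>x=1..R. \<Sum>y=1..R. \<Sum>t=1..R. (1 / real g) * ((1 / real x) * ((1 / real y) * (1 / real t))))"
    by (intro sum.cong refl) simp
  also have "\<dots> = (\<Sum>i=1..R. 1 / real i) ^ 4"
  proof -
    have fac: "(\<Sum>t=1..R. u t * c) = (\<Sum>t=1..R. u t) * c" for u :: "nat \<Rightarrow> real" and c
      by (simp add: sum_distrib_right)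
    show ?thesis by (simp only: sum_distrib_left[symmetric] fac power4_eq_xxxx mult.assoc)
  qed
  also have "\<dots> \<le> G ^ 4"
    using sum_inverse_le_ln[OF R] G by (intro power_mono order.trans[OF _ G] sum_nonneg) auto
  finally show ?thesis .
qed

text \<open>Rankin's trick: R / r >= 1 throughout the range.\<close>

lemma sum_num_divisors_square_le:
  assumes R: "R \<ge> 1" and G: "1 + ln (real R) \<le> G"
  shows "(\<Sum>r=1..R. (real (num_divisors r))\<^sup>2) \<le> real R * G ^ 4"
proof -
  have "(\<Sum>r=1..R. (real (num_divisors r))\<^sup>2) \<le> (\<Sum>r=1..R. real R * ((real (num_divisors r))\<^sup>2 / real r))"
    by (intro sum_mono) (auto simp: field_simps intro!: mult_right_mono)
  also have "\<dots> = real R * (\<Sum>r=1..R. (real (num_divisors r))\<^sup>2 / real r)" by (simp add: sum_distrib_left)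
  also have "\<dots> \<le> real R * G ^ 4" using sum_num_divisors_square_div_le[OF R G] by (intro mult_left_mono) auto
  finally show ?thesis .
qed

section \<open>Bilinear sums\<close>

lemma norm_sum_mult_square_le:
  fixes b z :: "'a \<Rightarrow> complex"
  shows "(norm (\<Sum>m\<in>I. b m * z m))\<^sup>2 \<le> (\<Sum>m\<in>I. (norm (b m))\<^sup>2) * (\<Sum>m\<in>I. (norm (z m))\<^sup>2)"
proof -
  have "norm (\<Sum>m\<in>I. b m * z m) \<le> (\<Sum>m\<in>I. norm (b m) * norm (z m))"
    by (rule sum_norm_le) (simp add: norm_mult)
  then have "(norm (\<Sum>m\<in>I. b m * z m))\<^sup>2 \<le> (\<Sum>m\<in>I. norm (b m) * norm (z m))\<^sup>2"
    by (intro power_mono) auto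
  also have "\<dots> \<le> (\<Sum>m\<in>I. (norm (b m))\<^sup>2) * (\<Sum>m\<in>I. (norm (z m))\<^sup>2)"
    by (rule Cauchy_Schwarz_ineq_sum)
  finally show ?thesis .
qed

text \<open>Schur's test for a symmetric nonnegative kernel: the product of two weights is at most
  the mean of their squares, and then only row sums are left.\<close>

lemma sum_pair_weights_le:
  fixes w :: "nat \<Rightarrow> real" and g :: "nat \<Rightarrow> nat \<Rightarrow> real"
  assumes "\<And>r s. r \<in> S \<Longrightarrow> s \<in> S \<Longrightarrow> g r s = g s r" "\<And>r s. 0 \<le> g r s"
    and "\<And>r. r \<in> S \<Longrightarrow> (\<Sum>s\<in>S. g r s) \<le> C"
  shows "(\<Sum>r\<in>S. \<Sum>s\<in>S. w r * w s * g r s) \<le> C * (\<Sum>r\<in>S. (w r)\<^sup>2)"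
proof -
  have "(\<Sum>r\<in>S. \<Sum>s\<in>S. w r * w s * g r s) \<le> (\<Sum>r\<in>S. \<Sum>s\<in>S. ((w r)\<^sup>2 * g r s + (w s)\<^sup>2 * g r s) / 2)"
  proof (intro sum_mono)
    fix r s
    have "2 * (w r * w s) \<le> (w r)\<^sup>2 + (w s)\<^sup>2" using sum_squares_bound[of "w r" "w s"] by simp
    then have "2 * (w r * w s) * g r s \<le> ((w r)\<^sup>2 + (w s)\<^sup>2) * g r s" by (intro mult_right_mono assms)
    then show "w r * w s * g r s \<le> ((w r)\<^sup>2 * g r s + (w s)\<^sup>2 * g r s) / 2" by (simp add: algebra_simps)
  qed
  also have "\<dots> = ((\<Sum>r\<in>S. \<Sum>s\<in>S. (w r)\<^sup>2 * g r s) + (\<Sum>r\<in>S. \<Sum>s\<in>S. (w s)\<^sup>2 * g r s)) / 2"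
    by (simp add: sum.distrib sum_divide_distrib add_divide_distrib)
  also have "(\<Sum>r\<in>S. \<Sum>s\<in>S. (w s)\<^sup>2 * g r s) = (\<Sum>r\<in>S. \<Sum>s\<in>S. (w r)\<^sup>2 * g r s)"
    by (subst sum.swap) (intro sum.cong refl, use assms(1) in auto)
  also have "((\<Sum>r\<in>S. \<Sum>s\<in>S. (w r)\<^sup>2 * g r s) + (\<Sum>r\<in>S. \<Sum>s\<in>S. (w r)\<^sup>2 * g r s)) / 2 = (\<Sum>r\<in>S. (w r)\<^sup>2 * (\<Sum>s\<in>S. g r s))"
    by (simp flip: sum_distrib_left)
  also have "\<dots> \<le> (\<Sum>r\<in>S. (w r)\<^sup>2 * C)" using assms by (intro sum_mono mult_left_mono) auto
  finally show ?thesis by (simp add: sum_distrib_left mult.commute)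
qed

lemma card_products_le_num_divisors:
  assumes "P \<subseteq> {1..} \<times> {1..}" "r \<ge> 1"
  shows "card {(h, k) \<in> P. h * k = (r::nat)} \<le> num_divisors r"
  unfolding num_divisors_def
proof (rule card_inj_on_le[where f = fst])
  show "inj_on fst {(h, k) \<in> P. h * k = r}" using assms by (auto simp: inj_on_def)
  show "fst ` {(h, k) \<in> P. h * k = r} \<subseteq> {d. d dvd r}" by auto
  show "finite {d. d dvd r}" using assms by simp
qed

text \<open>Cauchy's inequality is applied in m alone. Opening the square leaves pairs of pairs (h,
  k), (h', k') whose m-sums are geometric with ratio e((h k - h' k') \<theta>). Grouped by the
  product r = h k <= R, the pairs have multiplicity at most the divisor function, and Schur's test
  reduces their sum to one row of spaced points, bounded by \<open>X\<close>. The outcome is 2 M G^4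
  from the coefficients \<open>b\<close> times X R G^4, simplified by R M <= H N; the assumption H
  <= M keeps R below N.\<close>

lemma bilinear_block:
  fixes b c lam :: "nat \<Rightarrow> complex" and M0 M1 M N H q :: nat
  assumes sp: "spaced \<theta> q" and q: "q \<ge> 1" and M: "M \<ge> 1" "M \<le> M0" "M0 \<le> M1" "M1 - M0 \<le> M" "M1 \<le> 2 * M"
    and H: "H \<ge> 1" "H \<le> M" "M \<le> N" and G: "1 + ln (real N) \<le> G" "1 + ln (real q) \<le> G"
    and b: "\<And>m. norm (b m) \<le> real (num_divisors m)" and c: "\<And>h. norm (c h) \<le> 1" and lam: "\<And>k. norm (lam k) \<le> 1"
    and M2: "2 * M \<le> N"
  shows "(norm (\<Sum>m\<in>{M0<..M1}. b m * (\<Sum>h=1..H. \<Sum>k=1..N div m. c h * lam k * ue (real (h * m * k) * \<theta>))))\<^sup>2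
     \<le> 8 * G ^ 9 * (real H * real N) * (real H * real N / real q + real H * real N / real M + real M + real q)"
proof -
  define K where "K = N div M"
  define P where "P = {1..H} \<times> {1..K}"
  define I where "I = {M0<..M1}"
  define pr where "pr p = fst p * snd p" for p :: "nat \<times> nat"
  define R where "R = H * N div M"
  define W where "W m p = (if m * snd p \<le> N then c (fst p) * lam (snd p) else 0)" for m p
  define z where "z m = (\<Sum>p\<in>P. W m p * ue (real m * (real (pr p) * \<theta>)))" for m
  define X where "X = (2 * real R / real q + 1) * (2 * real M + 2 * real q * G)"
  have N1: "N \<ge> 1" using M H by linarith
  have G1: "G \<ge> 1" using G(1) N1 by (smt (verit) ln_ge_zero_iff of_nat_1 of_nat_le_iff)
  have finP: "finite P" by (simp add: P_def)
  have zeq: "(\<Sum>h=1..H. \<Sum>k=1..N div m. c h * lam k * ue (real (h * m * k) * \<theta>)) = z m" if m: "m \<in> I" for m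
  proof -
    have m1: "m \<ge> 1" "M \<le> m" using m M by (auto simp: I_def)
    have "N div m \<le> K" unfolding K_def using m1 M by (intro div_le_mono2) auto
    then have "(\<Sum>k=1..N div m. c h * lam k * ue (real (h * m * k) * \<theta>)) =
        (\<Sum>k=1..K. (if m * k \<le> N then c h * lam k else 0) * ue (real m * (real (h * k) * \<theta>)))" for h
      using m1 by (intro sum.mono_neutral_cong_left)
       (auto simp: less_eq_div_iff_mult_less_eq mult.commute mult.left_commute mult.assoc)
    then show ?thesis unfolding z_def P_def W_def pr_def by (simp add: sum.cartesian_product case_prod_beta)
  qed
  have RN: "R \<le> N"
  proof -
    have "H * N div M \<le> M * N div M" using H by (intro div_le_mono mult_right_mono) auto
    then show ?thesis using M by (simp add: R_def)
  qed
  have R1: "R \<ge> 1"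
  proof -
    have "M * 1 \<le> H * N" using H M by (simp add: order.trans[of M N "H * N"])
    then show ?thesis using M unfolding R_def by (simp add: div_greater_zero_iff Suc_leI)
  qed
  have prR: "pr p \<in> {1..R}" if pP: "p \<in> P" for p
  proof -
    obtain h k where p: "p = (h,k)" "1 \<le> h" "h \<le> H" "1 \<le> k" "k \<le> N div M" using pP by (auto simp: P_def K_def)
    then have "h * k * M \<le> H * N"
      using M mult_le_mono[of h H "k * M" N] by (simp add: less_eq_div_iff_mult_less_eq mult.assoc)
    then show ?thesis using p M by (simp add: pr_def R_def less_eq_div_iff_mult_less_eq)
  qed
  have inner: "norm (\<Sum>m\<in>I. W m p * ue (real m * (real (pr p) * \<theta>)) * cnj (W m p' * ue (real m * (real (pr p') * \<theta>))))
      \<le> geom_bound M (real (pr p') * \<theta> - real (pr p) * \<theta>)" if p: "p \<in> P" "p' \<in> P" for p p'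
  proof -
    define y where "y = min M1 (min (N div snd p) (N div snd p'))"
    have sp': "snd p \<ge> 1" "snd p' \<ge> 1" using p by (auto simp: P_def)
    define C where "C = c (fst p) * lam (snd p) * cnj (c (fst p') * lam (snd p'))"
    have "(\<Sum>m\<in>I. W m p * ue (real m * (real (pr p) * \<theta>)) * cnj (W m p' * ue (real m * (real (pr p') * \<theta>))))
      = (\<Sum>m\<in>{M0<..y}. C * ue (real m * (real (pr p) * \<theta> - real (pr p') * \<theta>)))"
    proof (rule sum.mono_neutral_cong_right)
      show "finite I" by (simp add: I_def)
      show "{M0<..y} \<subseteq> I" by (auto simp: I_def y_def)
      show "\<forall>i\<in>I - {M0<..y}. W i p * ue (real i * (real (pr p) * \<theta>)) * cnj (W i p' * ue (real i * (real (pr p') * \<theta>))) = 0"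
        using sp' by (auto simp: I_def y_def W_def less_eq_div_iff_mult_less_eq)
      fix m assume m: "m \<in> {M0<..y}"
      then have "m * snd p \<le> N" "m * snd p' \<le> N" using sp' by (auto simp: y_def less_eq_div_iff_mult_less_eq)
      moreover have "ue (real m * (real (pr p) * \<theta> - real (pr p') * \<theta>)) = ue (real m * (real (pr p) * \<theta>)) * cnj (ue (real m * (real (pr p') * \<theta>)))"
        unfolding cnj_ue ue_add[symmetric] by (simp add: algebra_simps)
      ultimately show "W m p * ue (real m * (real (pr p) * \<theta>)) * cnj (W m p' * ue (real m * (real (pr p') * \<theta>)))
         = C * ue (real m * (real (pr p) * \<theta> - real (pr p') * \<theta>))"
        by (simp add: W_def C_def)
    qed
    also have "\<dots> = C * (\<Sum>m\<in>{M0<..y}. ue (real m * (real (pr p) * \<theta> - real (pr p') * \<theta>)))" by (simp add: sum_distrib_left)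
    also have "norm \<dots> \<le> 1 * geom_bound (real (y - M0)) (real (pr p) * \<theta> - real (pr p') * \<theta>)"
      unfolding norm_mult
    proof (intro mult_mono norm_sum_ue_le)
      show "norm C \<le> 1" unfolding C_def norm_mult complex_mod_cnj
        by (intro mult_le_one c lam mult_nonneg_nonneg norm_ge_zero)
    qed auto
    also have "\<dots> \<le> geom_bound M (real (pr p) * \<theta> - real (pr p') * \<theta>)"
      using M by (simp, intro geom_bound_mono) (auto simp: y_def)
    also have "\<dots> = geom_bound M (real (pr p') * \<theta> - real (pr p) * \<theta>)"
      using geom_bound_minus[of M "real (pr p') * \<theta> - real (pr p) * \<theta>"] by simp
    finally show ?thesis .
  qed
  define \<nu> where "\<nu> r = real (card {p\<in>P. pr p = r})" for r
  have "of_real (\<Sum>m\<in>I. (norm (z m))\<^sup>2) = (\<Sum>m\<in>I. z m * cnj (z m))"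
    by (simp add: complex_norm_square[symmetric])
  also have "\<dots> = (\<Sum>m\<in>I. \<Sum>p\<in>P. \<Sum>p'\<in>P. W m p * ue (real m * (real (pr p) * \<theta>)) * cnj (W m p' * ue (real m * (real (pr p') * \<theta>))))"
    unfolding z_def by (simp add: sum_product)
  also have "\<dots> = (\<Sum>p\<in>P. \<Sum>p'\<in>P. \<Sum>m\<in>I. W m p * ue (real m * (real (pr p) * \<theta>)) * cnj (W m p' * ue (real m * (real (pr p') * \<theta>))))"
    by (subst sum.swap, intro sum.cong refl, rule sum.swap)
  finally have "norm (complex_of_real (\<Sum>m\<in>I. (norm (z m))\<^sup>2)) \<le> (\<Sum>p\<in>P. \<Sum>p'\<in>P. geom_bound M (real (pr p') * \<theta> - real (pr p) * \<theta>))"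
    by (simp only: sum_norm_le inner)
  then have "(\<Sum>m\<in>I. (norm (z m))\<^sup>2) \<le> (\<Sum>p\<in>P. \<Sum>p'\<in>P. geom_bound M (real (pr p') * \<theta> - real (pr p) * \<theta>))"
    by (simp only: norm_of_real)
  also have "\<dots> = (\<Sum>r=1..R. \<Sum>r'=1..R. \<nu> r * \<nu> r' * geom_bound M (real r' * \<theta> - real r * \<theta>))"
  proof -
    have grp: "(\<Sum>p\<in>P. F (pr p)) = (\<Sum>r=1..R. \<nu> r * F r)" for F :: "nat \<Rightarrow> real"
    proof -
      have "(\<Sum>p\<in>P. F (pr p)) = (\<Sum>r=1..R. \<Sum>p\<in>{p\<in>P. pr p = r}. F (pr p))"
        using prR finP by (intro sum.group[symmetric]) auto
      also have "\<dots> = (\<Sum>r=1..R. \<nu> r * F r)" by (intro sum.cong refl) (simp add: \<nu>_def)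
      finally show ?thesis .
    qed
    show ?thesis
      unfolding grp[of "\<lambda>r'. geom_bound M (real r' * \<theta> - x)" for x]
      using grp[of "\<lambda>r. \<Sum>r'=1..R. \<nu> r' * geom_bound M (real r' * \<theta> - real r * \<theta>)"]
      by (simp add: sum_distrib_left mult.assoc)
  qed
  also have "\<dots> \<le> X * (\<Sum>r=1..R. (\<nu> r)\<^sup>2)"
  proof (rule sum_pair_weights_le)
    fix r s
    show "geom_bound M (real s * \<theta> - real r * \<theta>) = geom_bound M (real r * \<theta> - real s * \<theta>)"
      using geom_bound_minus[of M "real s * \<theta> - real r * \<theta>"] by simp
    show "0 \<le> geom_bound M (real s * \<theta> - real r * \<theta>)" by (simp add: geom_bound_nonneg)
    have "(\<Sum>s = 1..R. geom_bound M (real s * \<theta> - real r * \<theta>)) \<le> (2 * real R / real q + 1) * (2 * real M + 2 * real q * (1 + ln (real q)))"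
      using sum_geom_bound_interval[OF sp q, where M = "real M" and R = R and s = "- real r * \<theta>"] by simp
    also have "\<dots> \<le> X" unfolding X_def by (intro mult_left_mono add_left_mono G(2)) auto
    finally show "(\<Sum>s = 1..R. geom_bound M (real s * \<theta> - real r * \<theta>)) \<le> X" .
  qed
  also have "(\<Sum>r=1..R. (\<nu> r)\<^sup>2) \<le> (\<Sum>r=1..R. (real (num_divisors r))\<^sup>2)"
  proof (intro sum_mono power_mono)
    fix r assume "r \<in> {1..R}"
    then have "card {(h,k)\<in>P. h * k = r} \<le> num_divisors r" by (intro card_products_le_num_divisors) (auto simp: P_def)
    then show "\<nu> r \<le> real (num_divisors r)" by (simp add: \<nu>_def pr_def case_prod_beta')
  qed (simp add: \<nu>_def)
  also have "\<dots> \<le> real R * G ^ 4"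
    using R1 RN G by (intro sum_num_divisors_square_le) (auto intro: order.trans[rotated])
  finally have Zb: "(\<Sum>m\<in>I. (norm (z m))\<^sup>2) \<le> X * (real R * G ^ 4)"
    using G1 by (simp add: X_def mult_left_mono)
  have Bb: "(\<Sum>m\<in>I. (norm (b m))\<^sup>2) \<le> 2 * real M * G ^ 4"
  proof -
    have "(\<Sum>m\<in>I. (norm (b m))\<^sup>2) \<le> (\<Sum>m\<in>I. (real (num_divisors m))\<^sup>2)" using b by (intro sum_mono power_mono) auto
    also have "\<dots> \<le> (\<Sum>m=1..2*M. (real (num_divisors m))\<^sup>2)" using M by (intro sum_mono2) (auto simp: I_def)
    also have "\<dots> \<le> real (2 * M) * G ^ 4"
    proof (intro sum_num_divisors_square_le)
      have "ln (real (2 * M)) \<le> ln (real N)" using M M2 by simp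
      then show "1 + ln (real (2 * M)) \<le> G" using G by linarith
    qed (use M in auto)
    finally show ?thesis by simp
  qed
  have Rle: "real R * real M \<le> real H * real N"
  proof -
    have "R * M \<le> H * N" by (simp add: R_def)
    then show ?thesis by (metis of_nat_mult of_nat_mono)
  qed
  have "(norm (\<Sum>m\<in>I. b m * z m))\<^sup>2 \<le> (2 * real M * G ^ 4) * (X * (real R * G ^ 4))"
    using Bb Zb G1 by (intro order.trans[OF norm_sum_mult_square_le] mult_mono sum_nonneg) auto
  also have "\<dots> = 2 * G ^ 8 * (real R * real M) * X" by (simp add: algebra_simps power_add[symmetric])
  also have "\<dots> \<le> 2 * G ^ 8 * (real H * real N) * (4 * G * (real H * real N / real q + real H * real N / real M + real M + real q))"
  proof (rule mult_mono)
    show "2 * G ^ 8 * (real R * real M) \<le> 2 * G ^ 8 * (real H * real N)"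
      using Rle G1 by (intro mult_left_mono) auto
    show "0 \<le> 2 * G ^ 8 * (real H * real N)" using G1 by (intro mult_nonneg_nonneg) auto
    have "X = 4 * (real R * real M / real q) + 4 * real R * G + 2 * real M + 2 * real q * G"
      unfolding X_def using q by (simp add: field_simps)
    also have "\<dots> \<le> 4 * G * (real H * real N / real q) + 4 * G * (real H * real N / real M) + 4 * G * real M + 4 * G * real q"
    proof (intro add_mono)
      have "4 * (real R * real M / real q) \<le> 4 * (real H * real N / real q)" using Rle by (simp add: divide_right_mono)
      also have "\<dots> \<le> 4 * G * (real H * real N / real q)" using G1 by (intro mult_right_mono) auto
      finally show "4 * (real R * real M / real q) \<le> 4 * G * (real H * real N / real q)" .
      have "real R \<le> real H * real N / real M" using Rle M by (simp add: field_simps)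
      then have "4 * G * real R \<le> 4 * G * (real H * real N / real M)" using G1 by (intro mult_left_mono) auto
      then show "4 * real R * G \<le> 4 * G * (real H * real N / real M)" by (simp add: mult_ac)
      have "2 * real M \<le> 4 * G * real M" using G1 by (intro mult_right_mono) auto
      then show "2 * real M \<le> 4 * G * real M" .
      have "2 * G * real q \<le> 4 * G * real q" using G1 by (intro mult_right_mono) auto
      then show "2 * real q * G \<le> 4 * G * real q" by (simp add: mult_ac)
    qed
    finally show "X \<le> 4 * G * (real H * real N / real q + real H * real N / real M + real M + real q)"
      by (simp add: distrib_left)
    show "0 \<le> X" unfolding X_def using G1 by (intro mult_nonneg_nonneg add_nonneg_nonneg) auto
  qed
  also have "\<dots> = 8 * G ^ 9 * (real H * real N) * (real H * real N / real q + real H * real N / real M + real M + real q)"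
  proof -
    have "G ^ 9 = G * G ^ 8" using power_Suc[of G 8] by simp
    then have "2 * G ^ 8 * x * (4 * G * y) = 8 * G ^ 9 * x * y" for x y by (simp add: mult_ac)
    then show ?thesis .
  qed
  finally show ?thesis using zeq by (simp add: I_def)
qed

lemma ln_two_ge_half: "1 / 2 \<le> ln (2::real)"
proof -
  have "1 - 1/2 \<le> ln (2::real)" using ln_le_minus_one[of "1/2::real"] by (simp add: ln_div)
  then show ?thesis by simp
qed

lemma power_two_ge_nat:
  assumes "N \<ge> 1" "1 + ln (real N) \<le> G"
  shows "\<exists>i. N \<le> 2 ^ i \<and> real i \<le> 2 * G"
proof -
  define x where "x = log 2 (real N)"
  define i where "i = nat \<lceil>x\<rceil>"
  have x0: "x \<ge> 0" using assms by (simp add: x_def)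
  have "real N = 2 powr x" using assms by (simp add: x_def)
  also have "\<dots> \<le> 2 powr real i" using x0 by (intro powr_mono) (auto simp: i_def)
  also have "\<dots> = real (2 ^ i)" by (simp add: powr_realpow)
  finally have "N \<le> 2 ^ i" by (simp only: of_nat_le_iff)
  moreover have "x \<le> 2 * ln (real N)"
  proof -
    have "ln (real N) * (1/2) \<le> ln (real N) * ln 2" using assms ln_two_ge_half by (intro mult_left_mono) auto
    then show ?thesis by (simp add: x_def log_def field_simps)
  qed
  then have "real i \<le> 2 * G" using assms(2) x0 unfolding i_def by linarith
  ultimately show ?thesis by blast
qed

text \<open>Dyadic decomposition of the range of m into at most 2 G blocks. Each satisfies the same
  bound, because M >= U in the term H N / M and M < Y in the term M.\<close>

lemma bilinear_sum_le:
  assumes sp: "spaced \<theta> q" and q: "q \<ge> 1" and H: "H \<ge> 1" "H \<le> U" and Y: "2 * Y \<le> N" "N \<ge> 1"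
    and G: "1 + ln (real N) \<le> G" "1 + ln (real q) \<le> G"
    and b: "\<And>m. norm (b m) \<le> real (num_divisors m)" and c: "\<And>h. norm (c h) \<le> 1" and lam: "\<And>k. norm (lam k) \<le> 1"
  shows "norm (\<Sum>m\<in>{U<..Y}. b m * (\<Sum>h=1..H. \<Sum>k=1..N div m. c h * lam k * ue (real (h * m * k) * \<theta>)))
     \<le> 2 * G * sqrt (8 * G ^ 9 * (real H * real N) * (real H * real N / real q + real H * real N / real U + real Y + real q))"
proof -
  define t where "t m = b m * (\<Sum>h=1..H. \<Sum>k=1..N div m. c h * lam k * ue (real (h * m * k) * \<theta>))" for m
  define E where "E = 8 * G ^ 9 * (real H * real N) * (real H * real N / real q + real H * real N / real U + real Y + real q)"
  have "ln (real N) \<ge> 0" using Y by simp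
  then have G1: "G \<ge> 1" using G by linarith
  have E0: "E \<ge> 0" unfolding E_def using G1 by (intro mult_nonneg_nonneg add_nonneg_nonneg) auto
  \<comment> \<open>Cutting both ends off at \<open>Y\<close> makes the blocks beyond
    \<open>Y\<close> empty, so that the induction below needs no case distinction.\<close>
  have blk: "norm (\<Sum>m\<in>{min Y M<..min Y (2 * M)}. t m) \<le> sqrt E" if M: "M \<ge> U" for M
  proof (cases "M < Y")
    case True
    have "(norm (\<Sum>m\<in>{M<..min Y (2*M)}. t m))\<^sup>2
        \<le> 8 * G ^ 9 * (real H * real N) * (real H * real N / real q + real H * real N / real M + real M + real q)"
      unfolding t_def using True M H Y by (intro bilinear_block[OF sp q _ _ _ _ _ _ _ _ G b c lam]) auto
    also have "\<dots> \<le> E" unfolding E_def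
    proof (intro mult_left_mono add_mono order.refl)
      show "real H * real N / real M \<le> real H * real N / real U"
        using M H by (intro divide_left_mono) auto
    qed (use True G1 in auto)
    finally have "norm (\<Sum>m\<in>{M<..min Y (2*M)}. t m) \<le> sqrt E" by (rule real_le_rsqrt)
    then show ?thesis using True by simp
  next
    case False
    then show ?thesis using E0 by simp
  qed
  have it: "norm (\<Sum>m\<in>{min Y U<..min Y (2 ^ i * U)}. t m) \<le> real i * sqrt E" for i
  proof (induction i)
    case (Suc i)
    define M where "M = 2 ^ i * U"
    have MU: "M \<ge> U" by (simp add: M_def)
    have "{min Y U<..min Y (2 * M)} = {min Y U<..min Y M} \<union> {min Y M<..min Y (2 * M)}"
      using MU by auto
    then have "(\<Sum>m\<in>{min Y U<..min Y (2 * M)}. t m) = (\<Sum>m\<in>{min Y U<..min Y M}. t m) + (\<Sum>m\<in>{min Y M<..min Y (2 * M)}. t m)"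
      by (simp only:) (intro sum.union_disjoint, auto)
    also have "norm \<dots> \<le> real i * sqrt E + sqrt E"
      using Suc[folded M_def] blk[OF MU] by (intro order.trans[OF norm_triangle_ineq] add_mono)
    finally show ?case by (simp add: M_def algebra_simps)
  qed (use E0 in simp)
  obtain i where i: "N \<le> 2 ^ i" "real i \<le> 2 * G" using power_two_ge_nat[OF Y(2) G(1)] by blast
  have "{U<..Y} = {min Y U<..min Y (2 ^ i * U)}"
  proof -
    have "Y \<le> 2 ^ i * 1" using Y i by linarith
    also have "\<dots> \<le> 2 ^ i * U" using H by (intro mult_left_mono) auto
    finally show ?thesis by auto
  qed
  then have "norm (\<Sum>m\<in>{U<..Y}. t m) \<le> real i * sqrt E" using it[of i] by simp
  also have "\<dots> \<le> 2 * G * sqrt E" using i E0 by (intro mult_right_mono) auto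
  finally show ?thesis unfolding t_def E_def .
qed

text \<open>Again h and d are merged into r = h d. For this the bound N / d, which depends on d, is
  weakened to H N / r. Cauchy's inequality with the weight sqrt r then separates the multiplicity,
  as the sum of the squared divisor function over r, from the sum of r g(r)^2, and r g(r) <= H N
  makes the latter linear in g.\<close>

lemma sum_geom_bound_products_le:
  assumes sp: "spaced \<theta> q" and q: "q \<ge> 2" and H: "H \<ge> 1" and U: "U \<ge> 1" and N: "H * U \<le> N"
    and G: "1 + ln (real N) \<le> G" "1 + ln (real q) \<le> G"
  shows "(\<Sum>h=1..H. \<Sum>d=1..U. geom_bound (real N / real d) (real (h * d) * \<theta>))
     \<le> sqrt (12 * G ^ 5 * (real H * real N) * (real H * real N / real q + real H * real U + real q))"
proof -
  define P where "P = {1..H} \<times> {1..U}"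
  define pr where "pr p = fst p * snd p" for p :: "nat \<times> nat"
  define R where "R = H * U"
  define X where "X = real H * real N"
  define g where "g r = geom_bound (X / real r) (real r * \<theta>)" for r :: nat
  have X0: "X \<ge> 0" by (simp add: X_def)
  have R1: "R \<ge> 1" using H U by (simp add: R_def Suc_leI)
  have lnR: "1 + ln (real R) \<le> G"
  proof -
    have "real R \<le> real N" "0 < real R" using N R1 by (simp_all only: R_def of_nat_le_iff of_nat_0_less_iff)
    then have "ln (real R) \<le> ln (real N)" by simp
    then show ?thesis using G by linarith
  qed
  have "ln (real R) \<ge> 0" using R1 by simp
  then have G1: "G \<ge> 1" using lnR by linarith
  have g0: "g r \<ge> 0" for r unfolding g_def using X0 by (intro geom_bound_nonneg) auto
  have prR: "pr p \<in> {1..R}" if "p \<in> P" for p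
    using that by (cases p) (auto simp: P_def pr_def R_def intro!: mult_le_mono Suc_leI)
  have finP: "finite P" by (simp add: P_def)
  have "(\<Sum>h=1..H. \<Sum>d=1..U. geom_bound (real N / real d) (real (h * d) * \<theta>)) \<le> (\<Sum>h=1..H. \<Sum>d=1..U. g (h * d))"
    unfolding g_def
  proof (intro sum_mono geom_bound_mono)
    fix h d assume hd: "h \<in> {1..H}" "d \<in> {1..U}"
    have "real N / real d = real h * real N / real (h * d)" using hd by (simp add: field_simps)
    also have "\<dots> \<le> X / real (h * d)" unfolding X_def using hd by (intro divide_right_mono mult_right_mono) auto
    finally show "real N / real d \<le> X / real (h * d)" .
  qed
  also have "\<dots> = (\<Sum>p\<in>P. g (pr p))" by (simp add: P_def pr_def sum.cartesian_product case_prod_beta)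
  also have "\<dots> = (\<Sum>r=1..R. \<Sum>p\<in>{p\<in>P. pr p = r}. g (pr p))"
    using prR finP by (intro sum.group[symmetric]) auto
  also have "\<dots> = (\<Sum>r=1..R. real (card {p\<in>P. pr p = r}) * g r)" by (intro sum.cong refl) simp
  also have "\<dots> \<le> (\<Sum>r=1..R. real (num_divisors r) * g r)"
  proof (intro sum_mono mult_right_mono g0)
    fix r assume "r \<in> {1..R}"
    then have "card {(h,k)\<in>P. h * k = r} \<le> num_divisors r" by (intro card_products_le_num_divisors) (auto simp: P_def)
    then show "real (card {p\<in>P. pr p = r}) \<le> real (num_divisors r)" by (simp add: pr_def case_prod_beta')
  qed
  also have "\<dots> = (\<Sum>r=1..R. (real (num_divisors r) / sqrt (real r)) * (sqrt (real r) * g r))"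
    by (intro sum.cong refl) simp
  also have "\<dots> \<le> sqrt (12 * G ^ 5 * X * (X / real q + real R + real q))"
  proof (rule real_le_rsqrt)
    have "(\<Sum>r=1..R. (real (num_divisors r) / sqrt (real r)) * (sqrt (real r) * g r))\<^sup>2
      \<le> (\<Sum>r=1..R. (real (num_divisors r) / sqrt (real r))\<^sup>2) * (\<Sum>r=1..R. (sqrt (real r) * g r)\<^sup>2)"
      by (rule Cauchy_Schwarz_ineq_sum)
    also have "\<dots> \<le> G ^ 4 * (X * (12 * G * (X / real q + real R + real q)))"
    proof (intro mult_mono)
      show "(\<Sum>r=1..R. (real (num_divisors r) / sqrt (real r))\<^sup>2) \<le> G ^ 4"
        using sum_num_divisors_square_div_le[OF R1 lnR] by (simp add: power_divide)
      have "(\<Sum>r=1..R. (sqrt (real r) * g r)\<^sup>2) \<le> (\<Sum>r=1..R. X * g r)"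
      proof (intro sum_mono)
        fix r assume r: "r \<in> {1..R}"
        have "g r \<le> X / real r" unfolding g_def by (rule geom_bound_le)
        then have "real r * g r \<le> X" using r by (simp add: field_simps)
        then have "(real r * g r) * g r \<le> X * g r" using g0 by (intro mult_right_mono) auto
        moreover have "(sqrt (real r) * g r)\<^sup>2 = real r * g r * g r"
          by (simp only: power_mult_distrib real_sqrt_pow2 of_nat_0_le_iff) (simp add: power2_eq_square)
        ultimately show "(sqrt (real r) * g r)\<^sup>2 \<le> X * g r" by simp
      qed
      also have "\<dots> = X * (\<Sum>r=1..R. g r)" by (simp add: sum_distrib_left)
      also have "\<dots> \<le> X * (12 * G * (X / real q + real R + real q))"
        unfolding g_def using sum_inverse_geom_bound[OF sp q X0 G(2) lnR R1] X0 by (intro mult_left_mono) auto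
      finally show "(\<Sum>r=1..R. (sqrt (real r) * g r)\<^sup>2) \<le> X * (12 * G * (X / real q + real R + real q))" .
    qed (use G1 in \<open>auto intro!: sum_nonneg\<close>)
    also have "\<dots> = 12 * G ^ 5 * X * (X / real q + real R + real q)"
    proof -
      have "G ^ 5 = G * G ^ 4" using power_Suc[of G 4] by simp
      then have "G ^ 4 * (X * (12 * G * y)) = 12 * G ^ 5 * X * y" for y by (simp add: mult_ac)
      then show ?thesis .
    qed
    finally show "(\<Sum>r=1..R. (real (num_divisors r) / sqrt (real r)) * (sqrt (real r) * g r))\<^sup>2
       \<le> 12 * G ^ 5 * X * (X / real q + real R + real q)" .
  qed
  finally show ?thesis by (simp add: X_def R_def mult.assoc)
qed

text \<open>Partial summation: ln n is the sum of the nonnegative increments \<delta> j with j <= n,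
  so exchanging the sums produces tails of z with total weight ln K.\<close>

lemma norm_sum_ln_mult_le:
  assumes tail: "\<And>j. 1 \<le> j \<Longrightarrow> norm (\<Sum>n\<in>{j..K}. z n) \<le> B" and B: "0 \<le> B"
  shows "norm (\<Sum>n=1..K. of_real (ln (real n)) * (z n :: complex)) \<le> ln (real K) * B"
proof -
  define \<delta> where "\<delta> j = (if j \<le> 1 then 0 else ln (real j) - ln (real (j - 1)))" for j
  have \<delta>0: "\<delta> j \<ge> 0" for j by (auto simp: \<delta>_def)
  have tele: "(\<Sum>j=1..n. \<delta> j) = ln (real n)" if "n \<ge> 1" for n
    using that by (induction n rule: dec_induct) (auto simp: \<delta>_def)
  have "(\<Sum>n=1..K. of_real (ln (real n)) * z n) = (\<Sum>n=1..K. \<Sum>j=1..n. of_real (\<delta> j) * z n)"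
    by (intro sum.cong refl) (simp add: tele[symmetric] sum_distrib_right)
  also have "\<dots> = (\<Sum>n=1..K. \<Sum>j=1..K. if j \<le> n then of_real (\<delta> j) * z n else 0)"
    by (intro sum.cong refl sum.mono_neutral_cong_left) auto
  also have "\<dots> = (\<Sum>j=1..K. \<Sum>n=1..K. if j \<le> n then of_real (\<delta> j) * z n else 0)"
    by (rule sum.swap)
  also have "\<dots> = (\<Sum>j=1..K. of_real (\<delta> j) * (\<Sum>n\<in>{j..K}. z n))"
    unfolding sum_distrib_left by (intro sum.cong refl sum.mono_neutral_cong_right) auto
  also have "norm \<dots> \<le> (\<Sum>j=1..K. \<delta> j * B)"
    using tail \<delta>0 by (intro sum_norm_le) (auto simp: norm_mult intro!: mult_mono)
  also have "\<dots> = (\<Sum>j=1..K. \<delta> j) * B" by (simp add: sum_distrib_right)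
  also have "\<dots> = ln (real K) * B"
    using tele[of K] by (cases K) auto
  finally show ?thesis .
qed

section \<open>Vaughan's identity\<close>

text \<open>For n > 1 fix a prime p dividing n. Multiplication by p pairs the squarefree divisors
  prime to p with those divisible by p and reverses the sign. Only the two properties stated are
  needed later, so the function itself is hidden.\<close>

lemma moebius_function_exists:
  "\<exists>\<mu> :: nat \<Rightarrow> real. (\<forall>n. \<bar>\<mu> n\<bar> \<le> 1) \<and> (\<forall>n>0. (\<Sum>d | d dvd n. \<mu> d) = (if n = 1 then 1 else 0))"
proof -
  define \<mu> where "\<mu> n = (if squarefree n then (-1) ^ card (prime_factors n) else 0 :: real)" for n :: nat
  have "\<bar>\<mu> n\<bar> \<le> 1" for n by (simp add: \<mu>_def power_abs)
  moreover have "(\<Sum>d | d dvd n. \<mu> d) = (if n = 1 then 1 else 0)" if n: "n > 0" for n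
  proof (cases "n = 1")
    case True
    then show ?thesis using squarefree_1[where 'a = nat] by (simp add: \<mu>_def)
  next
    case False
    then obtain p where p: "prime p" "p dvd n" using prime_factor_nat by blast
    define D where "D = {d. d dvd n}"
    define D1 where "D1 = {d \<in> D. squarefree d \<and> \<not> p dvd d}"
    define D2 where "D2 = {d \<in> D. squarefree d \<and> p dvd d}"
    have finD: "finite D" using n by (simp add: D_def)
    have pos: "d > 0" if "d \<in> D" for d using that n by (auto simp: D_def intro!: Nat.gr0I)
    have bij: "bij_betw (\<lambda>d. p * d) D1 D2"
    proof (rule bij_betwI[where g = "\<lambda>d. d div p"])
      show "(\<lambda>d. p * d) \<in> D1 \<rightarrow> D2"
      proof
        fix d assume d: "d \<in> D1"
        have cop: "coprime p d" using d p by (simp add: D1_def prime_imp_coprime)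
        then have "p * d dvd n" using d p by (intro divides_mult) (auto simp: D1_def D_def)
        moreover have "squarefree (p * d)" using d by (intro squarefree_mult_coprime cop squarefree_prime[OF p(1)]) (auto simp: D1_def)
        ultimately show "p * d \<in> D2" by (simp add: D2_def D_def)
      qed
      show "(\<lambda>d. d div p) \<in> D2 \<rightarrow> D1"
      proof
        fix d assume d: "d \<in> D2"
        then obtain e where e: "d = p * e" by (auto simp: D2_def)
        have p0: "p > 0" using p by (simp add: prime_gt_0_nat)
        have "\<not> p dvd e"
        proof
          assume "p dvd e"
          then have "p ^ 2 dvd d" unfolding e by (simp add: power2_eq_square)
          moreover have "squarefree d" using d by (simp add: D2_def)
          ultimately have "p dvd 1" by (rule squarefreeD[rotated])
          then show False using p by simp
        qed
        moreover have "e dvd n" using d e by (auto simp: D2_def D_def dest: dvd_mult_right)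
        moreover have "squarefree e" using d e squarefree_mono[of e d] by (auto simp: D2_def)
        ultimately show "d div p \<in> D1" using e p0 by (simp add: D1_def D_def)
      qed
    qed (use p in \<open>auto simp: D1_def D2_def prime_gt_0_nat\<close>)
    have flip: "\<mu> (p * d) = - \<mu> d" if d: "d \<in> D1" for d
    proof -
      have "squarefree (p * d)" using bij_betwE[OF bij] d by (auto simp: D2_def)
      moreover have "prime_factors (p * d) = insert p (prime_factors d)"
        using p d pos[of d] by (simp add: D1_def prime_factors_product prime_prime_factors)
      moreover have "p \<notin> prime_factors d" using d by (auto simp: D1_def)
      ultimately show ?thesis using d by (simp add: \<mu>_def D1_def)
    qed
    have "(\<Sum>d\<in>D. \<mu> d) = (\<Sum>d\<in>D1 \<union> D2. \<mu> d)"
      using finD by (intro sum.mono_neutral_right) (auto simp: D1_def D2_def \<mu>_def)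
    also have "\<dots> = (\<Sum>d\<in>D1. \<mu> d) + (\<Sum>d\<in>D2. \<mu> d)"
      using finD by (intro sum.union_disjoint) (auto simp: D1_def D2_def)
    also have "(\<Sum>d\<in>D2. \<mu> d) = (\<Sum>d\<in>D1. \<mu> (p * d))"
      by (rule sum.reindex_bij_betw[OF bij, symmetric])
    also have "\<dots> = - (\<Sum>d\<in>D1. \<mu> d)" by (simp add: flip sum_negf)
    finally show ?thesis using False by (simp add: D_def)
  qed
  ultimately show ?thesis by blast
qed

text \<open>Dirichlet convolution. At 0 the set of divisors is infinite and the sum defaults to 0,
  hence the assumption n > 0 in the laws below.\<close>

definition dconv :: "(nat \<Rightarrow> real) \<Rightarrow> (nat \<Rightarrow> real) \<Rightarrow> nat \<Rightarrow> real" where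
  "dconv f g n = (\<Sum>d | d dvd n. f d * g (n div d))"

lemma dconv_commute:
  assumes "n > 0" shows "dconv f g n = dconv g f n"
  unfolding dconv_def
  using assms
  by (intro sum.reindex_bij_witness[where i = "\<lambda>d. n div d" and j = "\<lambda>d. n div d"])
     (auto simp: div_dvd_iff_mult elim!: dvdE)

lemma dconv_assoc:
  assumes "n > 0" shows "dconv (dconv f g) h n = dconv f (dconv g h) n"
proof -
  have "dconv (dconv f g) h n = (\<Sum>(d,e)\<in>(SIGMA d:{d. d dvd n}. {e. e dvd d}). f e * g (d div e) * h (n div d))"
    unfolding dconv_def sum_distrib_right using assms
    by (subst sum.Sigma) (auto intro!: Nat.gr0I)
  also have "\<dots> = (\<Sum>(e,k)\<in>(SIGMA e:{e. e dvd n}. {k. k dvd n div e}). f e * (g k * h (n div e div k)))"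
  proof (rule sum.reindex_bij_witness[where i = "\<lambda>(e,k). (e*k,e)" and j = "\<lambda>(d,e). (e, d div e)"], goal_cases)
    case (1 x) then show ?case by auto
  next
    case (2 x)
    then obtain d e where x: "x = (d,e)" "d dvd n" "e dvd d" by auto
    then obtain k l where kl: "d = e * k" "n = d * l" by (elim dvdE)
    then show ?case using x assms by (auto simp: mult.assoc)
  next
    case (3 x)
    then obtain e k where x: "x = (e,k)" "e dvd n" "k dvd n div e" by auto
    then obtain l where l: "n = e * l" by (elim dvdE)
    then show ?case using x assms by auto
  next
    case (4 x)
    then obtain e k where x: "x = (e,k)" "e dvd n" "k dvd n div e" by auto
    then obtain l where l: "n = e * l" by (elim dvdE)
    then show ?case using x assms by auto
  next
    case (5 x)
    then obtain d e where x: "x = (d,e)" "d dvd n" "e dvd d" by auto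
    then obtain k l where kl: "d = e * k" "n = d * l" by (elim dvdE)
    then show ?case using x assms by (auto simp: mult.assoc)
  qed
  also have "\<dots> = dconv f (dconv g h) n"
    unfolding dconv_def sum_distrib_left using assms
    by (subst sum.Sigma) (auto intro!: Nat.gr0I simp: dvd_div_eq_0_iff)
  finally show ?thesis .
qed

lemma dconv_cong:
  assumes "n > 0" "\<And>d. d dvd n \<Longrightarrow> f d = f' d" "\<And>d. d dvd n \<Longrightarrow> g d = g' d"
  shows "dconv f g n = dconv f' g' n"
  unfolding dconv_def using assms by (intro sum.cong) auto

text \<open>Write * for convolution and 1 for the constant function. As ln = 1 * \<Lambda>, the last
  three terms are \<mu>1 * 1 * \<Lambda> - \<mu>1 * 1 * \<Lambda>1 + \<mu>2 * 1 * \<Lambda>2. The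
  first two combine to \<mu>1 * 1 * \<Lambda>2, and \<mu>1 + \<mu>2 = \<mu> is inverse to 1, so that
  \<Lambda>2 remains.\<close>

lemma vaughan_identity:
  fixes \<mu> :: "nat \<Rightarrow> real" and U V :: nat
  assumes \<mu>: "\<And>n. n > 0 \<Longrightarrow> (\<Sum>d | d dvd n. \<mu> d) = (if n = 1 then 1 else 0)" and n: "n > 0"
  defines "\<mu>1 \<equiv> \<lambda>d. if d \<le> U then \<mu> d else 0" and "\<mu>2 \<equiv> \<lambda>d. if d > U then \<mu> d else 0"
    and "\<Lambda>1 \<equiv> \<lambda>k. if k \<le> V then mangoldt k else 0" and "\<Lambda>2 \<equiv> \<lambda>k. if k > V then mangoldt k else 0"
  shows "mangoldt n = \<Lambda>1 n + dconv \<mu>1 (\<lambda>m. ln (real m)) n - dconv (dconv \<mu>1 \<Lambda>1) (\<lambda>_. 1) n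
           + dconv (dconv \<mu>2 (\<lambda>_. 1)) \<Lambda>2 n"
proof -
  let ?one = "\<lambda>_::nat. 1 :: real"
  have pos: "d > 0" if "d dvd n" for d using that n by (auto intro!: Nat.gr0I)
  have "dconv \<mu>1 (\<lambda>m. ln (real m)) n = dconv \<mu>1 (dconv ?one mangoldt) n"
  proof (rule dconv_cong[OF n])
    fix d assume "d dvd n"
    then have d: "d > 0" by (rule pos)
    have "dconv mangoldt ?one d = ln (real d)" using mangoldt_sum[of d, where 'a = real] d by (simp add: dconv_def)
    then show "ln (real d) = dconv ?one mangoldt d" using dconv_commute[OF d] by metis
  qed simp
  also have "\<dots> = dconv (dconv \<mu>1 ?one) mangoldt n" by (rule dconv_assoc[OF n, symmetric])
  finally have A: "dconv \<mu>1 (\<lambda>m. ln (real m)) n = dconv (dconv \<mu>1 ?one) mangoldt n" .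
  have "dconv (dconv \<mu>1 \<Lambda>1) ?one n = dconv \<mu>1 (dconv \<Lambda>1 ?one) n" by (rule dconv_assoc[OF n])
  also have "\<dots> = dconv \<mu>1 (dconv ?one \<Lambda>1) n"
    by (rule dconv_cong[OF n]) (auto intro: dconv_commute pos)
  also have "\<dots> = dconv (dconv \<mu>1 ?one) \<Lambda>1 n" by (rule dconv_assoc[OF n, symmetric])
  finally have B: "dconv (dconv \<mu>1 \<Lambda>1) ?one n = dconv (dconv \<mu>1 ?one) \<Lambda>1 n" .
  have one: "dconv \<mu>1 ?one d + dconv \<mu>2 ?one d = (if d = 1 then 1 else 0)" if "d dvd n" for d
  proof -
    have "dconv \<mu>1 ?one d + dconv \<mu>2 ?one d = (\<Sum>e | e dvd d. \<mu> e)"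
      unfolding dconv_def sum.distrib[symmetric] by (intro sum.cong) (auto simp: \<mu>1_def \<mu>2_def)
    then show ?thesis using \<mu>[OF pos[OF that]] by simp
  qed
  have "dconv (dconv \<mu>1 ?one) mangoldt n - dconv (dconv \<mu>1 ?one) \<Lambda>1 n + dconv (dconv \<mu>2 ?one) \<Lambda>2 n
      = (\<Sum>d | d dvd n. (dconv \<mu>1 ?one d + dconv \<mu>2 ?one d) * \<Lambda>2 (n div d))"
    unfolding dconv_def[of _ _ n] sum_subtractf[symmetric] sum.distrib[symmetric]
    by (intro sum.cong refl) (auto simp: \<Lambda>1_def \<Lambda>2_def algebra_simps)
  also have "\<dots> = (\<Sum>d | d dvd n. if d = 1 then \<Lambda>2 n else 0)"
    by (intro sum.cong refl) (simp add: one)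
  also have "\<dots> = \<Lambda>2 n" using n by (subst sum.delta) auto
  finally have "\<Lambda>2 n = dconv \<mu>1 (\<lambda>m. ln (real m)) n - dconv (dconv \<mu>1 \<Lambda>1) ?one n + dconv (dconv \<mu>2 ?one) \<Lambda>2 n"
    by (simp add: A B)
  moreover have "mangoldt n = \<Lambda>1 n + \<Lambda>2 n" by (simp add: \<Lambda>1_def \<Lambda>2_def)
  ultimately show ?thesis by simp
qed

lemma sum_dconv_ue:
  "(\<Sum>n=1..N. of_real (dconv f g n) * ue (real (h * n) * \<theta>))
    = (\<Sum>d=1..N. of_real (f d) * (\<Sum>m=1..N div d. of_real (g m) * ue (real (h * d * m) * \<theta>)))"
proof -
  have "(\<Sum>n=1..N. of_real (dconv f g n) * ue (real (h * n) * \<theta>))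
     = (\<Sum>n=1..N. \<Sum>d | d dvd n. of_real (f d) * (of_real (g (n div d)) * ue (real (h * d * (n div d)) * \<theta>)))"
    unfolding dconv_def of_real_sum sum_distrib_right
    by (intro sum.cong refl) (auto simp: mult.assoc)
  also have "\<dots> = (\<Sum>d=1..N. \<Sum>m=1..N div d. of_real (f d) * (of_real (g m) * ue (real (h * d * m) * \<theta>)))"
    by (rule sum_divisors_swap)
  finally show ?thesis by (simp add: sum_distrib_left)
qed

text \<open>In Vaughan's identity \<open>S0\<close> is short and bounded trivially.
  \<open>SA\<close> and the part d <= U of \<open>SB\<close> have inner sums with smooth
  coefficients, handled by geometric bounds averaged over h. The rest of \<open>SB\<close> and
  \<open>SC\<close> are bilinear with outer variable between U and N / V. Each of the two square
  roots arises twice, whence the factors 2 and 4.\<close>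

lemma exp_sum_mangoldt_le:
  fixes c :: "nat \<Rightarrow> complex"
  assumes sp: "spaced \<theta> q" and q: "q \<ge> 2" and H: "H \<ge> 1" "H \<le> U" and UV: "2 * (U * V) \<le> N" "V \<ge> 2" "U * V\<^sup>2 \<le> N" "H * U \<le> N"
    and G: "1 + ln (real N) \<le> G" "1 + ln (real q) \<le> G"
    and c: "\<And>h. norm (c h) \<le> 1"
  shows "norm (\<Sum>h=1..H. c h * (\<Sum>n=1..N. of_real (mangoldt n) * ue (real (h * n) * \<theta>)))
    \<le> real H * real V * G
      + 2 * G * sqrt (12 * G ^ 5 * (real H * real N) * (real H * real N / real q + real H * real U + real q))
      + 4 * G\<^sup>2 * sqrt (8 * G ^ 9 * (real H * real N) * (real H * real N / real q + real H * real N / real U + real N / real V + real q))"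
proof -
  obtain \<mu> :: "nat \<Rightarrow> real" where \<mu>: "\<And>n. \<bar>\<mu> n\<bar> \<le> 1" "\<And>n. n > 0 \<Longrightarrow> (\<Sum>d | d dvd n. \<mu> d) = (if n = 1 then 1 else 0)"
    using moebius_function_exists by blast
  define \<mu>1 where "\<mu>1 = (\<lambda>d. if d \<le> U then \<mu> d else 0)"
  define \<mu>2 where "\<mu>2 = (\<lambda>d. if d > U then \<mu> d else 0)"
  define \<Lambda>1 :: "nat \<Rightarrow> real" where "\<Lambda>1 = (\<lambda>k. if k \<le> V then mangoldt k else 0)"
  define \<Lambda>2 :: "nat \<Rightarrow> real" where "\<Lambda>2 = (\<lambda>k. if k > V then mangoldt k else 0)"
  define g where "g = dconv \<mu>1 \<Lambda>1"
  define b where "b = dconv \<mu>2 (\<lambda>_. 1)"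
  define T1 where "T1 = 12 * G ^ 5 * (real H * real N) * (real H * real N / real q + real H * real U + real q)"
  define T2 where "T2 = 8 * G ^ 9 * (real H * real N) * (real H * real N / real q + real H * real N / real U + real N / real V + real q)"
  have U1: "U \<ge> 1" using H by simp
  have "1 * 1 \<le> H * U" using H U1 by (intro mult_le_mono)
  then have N1: "N \<ge> 1" using UV by linarith
  have UN: "U \<le> N"
  proof -
    have "1 * U \<le> H * U" using H by (intro mult_le_mono) auto
    then show ?thesis using UV by linarith
  qed
  have "ln (real N) \<ge> 0" using N1 by simp
  then have G1: "G \<ge> 1" using G by linarith
  have lnN: "ln (real n) \<le> G" if "n \<ge> 1" "n \<le> N" for n
  proof -
    have "ln (real n) \<le> ln (real N)" using that by simp
    then show ?thesis using G by linarith
  qed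
  have T2le: "8 * G ^ 9 * (real H * real N) * (real H * real N / real q + real H * real N / real U + real Y + real q) \<le> T2"
    if "real Y \<le> real N / real V" for Y
    unfolding T2_def using that G1 by (intro mult_left_mono add_mono order.refl mult_nonneg_nonneg) auto
  have T2: "T2 \<ge> 0" unfolding T2_def using G1 by (intro mult_nonneg_nonneg add_nonneg_nonneg) auto
  have ml: "(mangoldt k :: real) \<le> G" if "k \<le> N" for k
  proof (cases "k = 0")
    case False
    then have "(mangoldt k :: real) \<le> ln (real k)" by (intro mangoldt_le) auto
    then show ?thesis using lnN[of k] that False by simp
  qed (use G1 in simp)
  define E where "E h n = ue (real (h * n) * \<theta>)" for h n :: nat
  define S0 where "S0 h = (\<Sum>n=1..N. of_real (\<Lambda>1 n) * E h n)" for h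
  define SA where "SA h = (\<Sum>n=1..N. of_real (dconv \<mu>1 (\<lambda>m. ln (real m)) n) * E h n)" for h
  define SB where "SB h = (\<Sum>n=1..N. of_real (dconv g (\<lambda>_. 1) n) * E h n)" for h
  define SC where "SC h = (\<Sum>n=1..N. of_real (dconv b \<Lambda>2 n) * E h n)" for h
  have split: "(\<Sum>n=1..N. of_real (mangoldt n) * E h n) = S0 h + SA h - SB h + SC h" for h
    unfolding S0_def SA_def SB_def SC_def sum.distrib[symmetric] sum_subtractf[symmetric]
  proof (intro sum.cong refl)
    fix n assume "n \<in> {1..N}"
    then have "n > 0" by simp
    from vaughan_identity[OF \<mu>(2) this, where U = U and V = V]
    have v: "mangoldt n = \<Lambda>1 n + dconv \<mu>1 (\<lambda>m. ln (real m)) n - dconv g (\<lambda>_. 1) n + dconv b \<Lambda>2 n"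
      by (simp only: \<mu>1_def \<mu>2_def \<Lambda>1_def \<Lambda>2_def g_def b_def)
    have "complex_of_real (mangoldt n) = of_real (\<Lambda>1 n) + of_real (dconv \<mu>1 (\<lambda>m. ln (real m)) n) - of_real (dconv g (\<lambda>_. 1) n) + of_real (dconv b \<Lambda>2 n)"
      by (subst v) simp
    then show "of_real (mangoldt n) * E h n = of_real (\<Lambda>1 n) * E h n + of_real (dconv \<mu>1 (\<lambda>m. ln (real m)) n) * E h n
        - of_real (dconv g (\<lambda>_. 1) n) * E h n + of_real (dconv b \<Lambda>2 n) * E h n"
      by (simp add: ring_distribs)
  qed
  have cn: "norm (\<Sum>h=1..H. c h * z h) \<le> (\<Sum>h=1..H. norm (z h))" for z
  proof (rule sum_norm_le)
    fix h show "norm (c h * z h) \<le> norm (z h)"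
      using c[of h] by (simp add: norm_mult mult_left_le_one_le)
  qed
  have b0: "norm (\<Sum>h=1..H. c h * S0 h) \<le> real H * real V * G"
  proof -
    have "norm (S0 h) \<le> real V * G" for h
    proof -
      have "S0 h = (\<Sum>n\<in>{1..min V N}. of_real (\<Lambda>1 n) * E h n)" unfolding S0_def
        by (intro sum.mono_neutral_right) (auto simp: \<Lambda>1_def)
      also have "norm \<dots> \<le> (\<Sum>n\<in>{1..min V N}. G)"
        using ml by (intro sum_norm_le) (auto simp: norm_mult \<Lambda>1_def E_def mangoldt_nonneg)
      also have "\<dots> = real (min V N) * G" by simp
      also have "\<dots> \<le> real V * G" using G1 by (intro mult_right_mono) auto
      finally show ?thesis .
    qed
    then have "(\<Sum>h=1..H. norm (S0 h)) \<le> (\<Sum>h=1..H. real V * G)" by (intro sum_mono) auto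
    then show ?thesis using cn[of S0] by simp
  qed
  have geo: "norm (\<Sum>m\<in>{j..K}. E h (d * m)) \<le> geom_bound (real N / real d) (real (h * d) * \<theta>)"
    if j: "1 \<le> j" and K: "K \<le> N div d" and d: "d \<ge> 1" for j K h d
  proof -
    have "{j..K} = {j-1<..K}" using j by auto
    then have "(\<Sum>m\<in>{j..K}. E h (d * m)) = (\<Sum>m\<in>{j-1<..K}. ue (real m * (real (h * d) * \<theta>)))"
      by (intro sum.cong) (auto simp: E_def algebra_simps)
    then have "norm (\<Sum>m\<in>{j..K}. E h (d * m)) \<le> geom_bound (real (K - (j - 1))) (real (h * d) * \<theta>)"
      by (simp only: norm_sum_ue_le)
    also have "\<dots> \<le> geom_bound (real N / real d) (real (h * d) * \<theta>)"
    proof (rule geom_bound_mono)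
      have "K * d \<le> N" using K d by (simp add: less_eq_div_iff_mult_less_eq)
      then have "real K * real d \<le> real N" by (metis of_nat_mult of_nat_mono)
      then have "real K \<le> real N / real d" using d by (simp add: field_simps)
      moreover have "real (K - (j - 1)) \<le> real K" by simp
      ultimately show "real (K - (j - 1)) \<le> real N / real d" by linarith
    qed
    finally show ?thesis .
  qed
  define W where "W = (\<Sum>h=1..H. \<Sum>d=1..U. geom_bound (real N / real d) (real (h * d) * \<theta>))"
  have W: "W \<le> sqrt T1" unfolding W_def T1_def
    by (rule sum_geom_bound_products_le[OF sp q H(1) U1 UV(4) G])
  have bA: "norm (\<Sum>h=1..H. c h * SA h) \<le> G * sqrt T1"
  proof -
    have "norm (SA h) \<le> (\<Sum>d=1..U. G * geom_bound (real N / real d) (real (h * d) * \<theta>))" for h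
    proof -
      have "SA h = (\<Sum>d=1..N. of_real (\<mu>1 d) * (\<Sum>m=1..N div d. of_real (ln (real m)) * E h (d * m)))"
        unfolding SA_def E_def sum_dconv_ue by (simp add: mult.assoc)
      also have "\<dots> = (\<Sum>d=1..U. of_real (\<mu>1 d) * (\<Sum>m=1..N div d. of_real (ln (real m)) * E h (d * m)))"
        using UN by (intro sum.mono_neutral_right) (auto simp: \<mu>1_def)
      also have "norm \<dots> \<le> (\<Sum>d=1..U. G * geom_bound (real N / real d) (real (h * d) * \<theta>))"
      proof (rule sum_norm_le)
        fix d assume d: "d \<in> {1..U}"
        have g0: "0 \<le> geom_bound (real N / real d) (real (h * d) * \<theta>)" by (intro geom_bound_nonneg) auto
        have "norm (of_real (\<mu>1 d) * (\<Sum>m=1..N div d. of_real (ln (real m)) * E h (d * m))) \<le>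
           1 * norm (\<Sum>m=1..N div d. of_real (ln (real m)) * E h (d * m))"
          unfolding norm_mult using \<mu>(1)[of d] by (intro mult_right_mono) (auto simp: \<mu>1_def)
        also have "\<dots> \<le> ln (real (N div d)) * geom_bound (real N / real d) (real (h * d) * \<theta>)"
          unfolding mult_1 by (rule norm_sum_ln_mult_le[OF _ g0]) (rule geo, use d in auto)
        also have "\<dots> \<le> G * geom_bound (real N / real d) (real (h * d) * \<theta>)"
        proof (rule mult_right_mono[OF _ g0])
          have "1 \<le> N div d" using d UN by (simp add: less_eq_div_iff_mult_less_eq)
          then show "ln (real (N div d)) \<le> G" by (intro lnN) auto
        qed
        finally show "norm (of_real (\<mu>1 d) * (\<Sum>m=1..N div d. of_real (ln (real m)) * E h (d * m))) \<le> G * geom_bound (real N / real d) (real (h * d) * \<theta>)" .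
      qed
      finally show ?thesis .
    qed
    then have "(\<Sum>h=1..H. norm (SA h)) \<le> G * W"
      unfolding W_def sum_distrib_left by (intro sum_mono) auto
    also have "\<dots> \<le> G * sqrt T1" using W G1 by (intro mult_left_mono) auto
    finally show ?thesis using cn[of SA] by linarith
  qed
  \<comment> \<open>The coefficients of \<mu>1 * \<Lambda>1 are dominated by those of 1 * \<Lambda>
    = ln.\<close>
  have gb: "\<bar>g d\<bar> \<le> G" if d: "d \<ge> 1" "d \<le> N" for d
  proof -
    have "\<bar>g d\<bar> \<le> (\<Sum>e | e dvd d. \<bar>\<mu>1 e * \<Lambda>1 (d div e)\<bar>)" unfolding g_def dconv_def by (rule sum_abs)
    also have "\<dots> \<le> (\<Sum>e | e dvd d. 1 * mangoldt (d div e))"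
      unfolding abs_mult using \<mu>(1) by (intro sum_mono mult_mono) (auto simp: \<mu>1_def \<Lambda>1_def mangoldt_nonneg)
    also have "\<dots> = dconv (\<lambda>_. 1) mangoldt d" by (simp add: dconv_def)
    also have "\<dots> = dconv mangoldt (\<lambda>_. 1) d" using d by (intro dconv_commute) auto
    also have "\<dots> = ln (real d)" using mangoldt_sum[of d, where 'a = real] d by (simp add: dconv_def)
    also have "\<dots> \<le> G" using d by (intro lnN)
    finally show ?thesis .
  qed
  have gz: "g d = 0" if d: "d > U * V" for d
    unfolding g_def dconv_def
  proof (intro sum.neutral ballI)
    fix e assume "e \<in> {e. e dvd d}"
    then obtain k where k: "d = e * k" by (auto elim: dvdE)
    have "e > 0" using k d by (auto intro!: Nat.gr0I)
    moreover have "\<not> (e \<le> U \<and> k \<le> V)"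
    proof
      assume "e \<le> U \<and> k \<le> V"
      then have "e * k \<le> U * V" by (intro mult_le_mono) auto
      then show False using k d by simp
    qed
    ultimately show "\<mu>1 e * \<Lambda>1 (d div e) = 0" using k by (auto simp: \<mu>1_def \<Lambda>1_def)
  qed
  have UVN: "U * V \<le> N" using UV by simp
  \<comment> \<open>Beyond U the outer variable is long enough for Cauchy's inequality, and U V^2 <=
    N keeps it below N / V, the range that occurs in \<open>SC\<close> as well.\<close>
  define SB1 where "SB1 h = (\<Sum>d=1..U. of_real (g d) * (\<Sum>m=1..N div d. E h (d * m)))" for h
  define SB2 where "SB2 h = (\<Sum>d\<in>{U<..U*V}. of_real (g d) * (\<Sum>m=1..N div d. E h (d * m)))" for h
  have SBs: "SB h = SB1 h + SB2 h" for h
  proof -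
    have "SB h = (\<Sum>d=1..N. of_real (g d) * (\<Sum>m=1..N div d. E h (d * m)))"
      unfolding SB_def E_def sum_dconv_ue by (simp add: mult.assoc)
    also have "\<dots> = (\<Sum>d\<in>{1..U} \<union> {U<..U*V}. of_real (g d) * (\<Sum>m=1..N div d. E h (d * m)))"
      using UN UVN gz by (intro sum.mono_neutral_right) auto
    also have "\<dots> = SB1 h + SB2 h" unfolding SB1_def SB2_def by (intro sum.union_disjoint) auto
    finally show ?thesis .
  qed
  have bB1: "norm (\<Sum>h=1..H. c h * SB1 h) \<le> G * sqrt T1"
  proof -
    have "norm (SB1 h) \<le> (\<Sum>d=1..U. G * geom_bound (real N / real d) (real (h * d) * \<theta>))" for h
      unfolding SB1_def
    proof (rule sum_norm_le)
      fix d assume d: "d \<in> {1..U}"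
      have g0: "0 \<le> geom_bound (real N / real d) (real (h * d) * \<theta>)" by (intro geom_bound_nonneg) auto
      show "norm (of_real (g d) * (\<Sum>m=1..N div d. E h (d * m))) \<le> G * geom_bound (real N / real d) (real (h * d) * \<theta>)"
        unfolding norm_mult using gb[of d] d UN G1 geo[of 1 "N div d" d h] by (intro mult_mono) auto
    qed
    then have "(\<Sum>h=1..H. norm (SB1 h)) \<le> G * W"
      unfolding W_def sum_distrib_left by (intro sum_mono) auto
    also have "\<dots> \<le> G * sqrt T1" using W G1 by (intro mult_left_mono) auto
    finally show ?thesis using cn[of SB1] by linarith
  qed
  \<comment> \<open>\<open>bilinear_sum_le\<close> wants coefficients bounded by the divisor
    function and by 1. The constants \<open>C\<close> and \<open>D\<close> are divided out; their
    product G comes back as one of the two factors in G^2.\<close>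
  have typeII: "norm (\<Sum>h=1..H. c h * (\<Sum>m\<in>{U<..Y}. of_real (x m) * (\<Sum>k=1..N div m. of_real (y k) * E h (m * k)))) \<le> 2 * G\<^sup>2 * sqrt T2"
    if x: "\<And>m. \<bar>x m\<bar> \<le> C * real (num_divisors m)" and y: "\<And>k. \<bar>y k\<bar> \<le> D" and CD: "C > 0" "D > 0" "C * D = G"
      and Y: "2 * Y \<le> N" "real Y \<le> real N / real V" for x y :: "nat \<Rightarrow> real" and Y C D
  proof -
    have "(\<Sum>h=1..H. c h * (\<Sum>m\<in>{U<..Y}. of_real (x m) * (\<Sum>k=1..N div m. of_real (y k) * E h (m * k))))
       = (\<Sum>h=1..H. \<Sum>m\<in>{U<..Y}. of_real (x m) * (\<Sum>k=1..N div m. c h * (of_real (y k) * E h (m * k))))"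
      by (simp add: sum_distrib_left mult.left_commute)
    also have "\<dots> = (\<Sum>m\<in>{U<..Y}. \<Sum>h=1..H. of_real (x m) * (\<Sum>k=1..N div m. c h * (of_real (y k) * E h (m * k))))"
      by (rule sum.swap)
    also have "\<dots> = of_real G * (\<Sum>m\<in>{U<..Y}. of_real (x m / C) * (\<Sum>h=1..H. \<Sum>k=1..N div m. c h * of_real (y k / D) * ue (real (h * m * k) * \<theta>)))"
    proof -
      have "complex_of_real G = of_real C * of_real D" by (simp add: CD(3)[symmetric])
      then show ?thesis unfolding sum_distrib_left using CD(1,2)
        by (intro sum.cong refl) (simp add: E_def mult.assoc)
    qed
    also have "norm \<dots> \<le> G * (2 * G * sqrt T2)"
      unfolding norm_mult
    proof (intro mult_mono)
      have "norm (\<Sum>m\<in>{U<..Y}. of_real (x m / C) * (\<Sum>h=1..H. \<Sum>k=1..N div m. c h * of_real (y k / D) * ue (real (h * m * k) * \<theta>)))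
        \<le> 2 * G * sqrt (8 * G ^ 9 * (real H * real N) * (real H * real N / real q + real H * real N / real U + real Y + real q))"
      proof (rule bilinear_sum_le[OF sp _ H Y(1) N1 G])
        show "norm (complex_of_real (x m / C)) \<le> real (num_divisors m)" for m
          using x[of m] CD(1) by (simp only: norm_of_real abs_divide) (simp add: field_simps)
        show "norm (complex_of_real (y m / D)) \<le> 1" for m
          using y[of m] CD(2) by (simp only: norm_of_real abs_divide) (simp add: field_simps)
      qed (use c q in auto)
      also have "\<dots> \<le> 2 * G * sqrt T2"
        using T2le[OF Y(2)] G1 by (intro mult_left_mono real_sqrt_le_mono) auto
      finally show "norm (\<Sum>m\<in>{U<..Y}. of_real (x m / C) * (\<Sum>h=1..H. \<Sum>k=1..N div m. c h * of_real (y k / D) * ue (real (h * m * k) * \<theta>))) \<le> 2 * G * sqrt T2" .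
    qed (use G1 in auto)
    finally show ?thesis by (simp add: power2_eq_square mult_ac)
  qed
  have nd1: "real (num_divisors m) \<ge> 1" if "m \<ge> 1" for m
  proof -
    have "card {1::nat} \<le> num_divisors m" unfolding num_divisors_def using that by (intro card_mono) auto
    then show ?thesis by simp
  qed
  have bB2: "norm (\<Sum>h=1..H. c h * SB2 h) \<le> 2 * G\<^sup>2 * sqrt T2"
  proof -
    \<comment> \<open>Restricting the coefficient to 1 <= m <= N changes no term of the sum;
      \<open>typeII\<close> requires a bound for every m, while \<open>gb\<close> is valid only
      there.\<close>
    have "norm (\<Sum>h=1..H. c h * (\<Sum>m\<in>{U<..U*V}. of_real (if 1 \<le> m \<and> m \<le> N then g m else 0) * (\<Sum>k=1..N div m. of_real ((\<lambda>_. 1) k) * E h (m * k)))) \<le> 2 * G\<^sup>2 * sqrt T2"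
    proof (rule typeII[where C = G and D = 1])
      show "\<bar>if 1 \<le> m \<and> m \<le> N then g m else 0\<bar> \<le> G * real (num_divisors m)" for m
      proof (cases "1 \<le> m \<and> m \<le> N")
        case True
        then have "\<bar>g m\<bar> \<le> G * 1" using gb by simp
        also have "\<dots> \<le> G * real (num_divisors m)" using True G1 nd1[of m] by (intro mult_left_mono) auto
        finally show ?thesis using True by simp
      qed (use G1 in auto)
      have "U * V * V \<le> N" using UV(3) by (simp add: power2_eq_square mult.assoc)
      then have "real (U * V) * real V \<le> real N" by (metis of_nat_mult of_nat_mono)
      then show "real (U * V) \<le> real N / real V" using UV(2) by (simp add: field_simps)
    qed (use UV G1 in auto)
    also have "(\<Sum>h=1..H. c h * (\<Sum>m\<in>{U<..U*V}. of_real (if 1 \<le> m \<and> m \<le> N then g m else 0) * (\<Sum>k=1..N div m. of_real ((\<lambda>_. 1) k) * E h (m * k)))) = (\<Sum>h=1..H. c h * SB2 h)"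
      unfolding SB2_def using UVN by (intro sum.cong refl arg_cong2[where f = "(*)"]) auto
    finally show ?thesis .
  qed
  have bz: "b m = 0" if m: "m \<ge> 1" "m \<le> U" for m
    unfolding b_def dconv_def
  proof (intro sum.neutral ballI)
    fix e assume "e \<in> {e. e dvd m}"
    then have "e \<le> m" using m by (auto intro: dvd_imp_le)
    then show "\<mu>2 e * 1 = 0" using m by (simp add: \<mu>2_def)
  qed
  have bC: "norm (\<Sum>h=1..H. c h * SC h) \<le> 2 * G\<^sup>2 * sqrt T2"
  proof -
    define y where "y k = (if k \<le> N then \<Lambda>2 k else 0)" for k
    have "norm (\<Sum>h=1..H. c h * (\<Sum>m\<in>{U<..N div V}. of_real (b m) * (\<Sum>k=1..N div m. of_real (y k) * E h (m * k)))) \<le> 2 * G\<^sup>2 * sqrt T2"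
    proof (rule typeII[where C = 1 and D = G])
      show "\<bar>b m\<bar> \<le> 1 * real (num_divisors m)" for m
      proof -
        have "\<bar>b m\<bar> \<le> (\<Sum>e | e dvd m. \<bar>\<mu>2 e * 1\<bar>)" unfolding b_def dconv_def by (rule sum_abs)
        also have "\<dots> \<le> (\<Sum>e | e dvd m. 1)" using \<mu>(1) by (intro sum_mono) (auto simp: \<mu>2_def)
        finally show ?thesis by (simp add: num_divisors_def)
      qed
      show "\<bar>y k\<bar> \<le> G" for k using ml[of k] G1 by (auto simp: y_def \<Lambda>2_def mangoldt_nonneg)
      have "2 * (N div V) \<le> V * (N div V)" using UV(2) by (intro mult_le_mono) auto
      also have "\<dots> \<le> N" by simp
      finally show "2 * (N div V) \<le> N" .
      have "V * (N div V) \<le> N" by simp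
      then have "real V * real (N div V) \<le> real N" by (metis of_nat_mult of_nat_mono)
      then show "real (N div V) \<le> real N / real V" using UV(2) by (simp add: field_simps)
    qed (use G1 in auto)
    also have "(\<Sum>h=1..H. c h * (\<Sum>m\<in>{U<..N div V}. of_real (b m) * (\<Sum>k=1..N div m. of_real (y k) * E h (m * k)))) = (\<Sum>h=1..H. c h * SC h)"
    proof (intro sum.cong refl arg_cong2[where f = "(*)"])
      fix h
      have "SC h = (\<Sum>m=1..N. of_real (b m) * (\<Sum>k=1..N div m. of_real (\<Lambda>2 k) * E h (m * k)))"
        unfolding SC_def E_def sum_dconv_ue by (simp add: mult.assoc)
      also have "\<dots> = (\<Sum>m=1..N. of_real (b m) * (\<Sum>k=1..N div m. of_real (y k) * E h (m * k)))"
      proof (intro sum.cong refl arg_cong2[where f = "(*)"])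
        fix m k assume "m \<in> {1..N}" "k \<in> {1..N div m}"
        then have "k \<le> N" by (meson atLeastAtMost_iff div_le_dividend order.trans)
        then show "complex_of_real (\<Lambda>2 k) = of_real (y k)" by (simp add: y_def)
      qed
      also have "\<dots> = (\<Sum>m\<in>{U<..N div V}. of_real (b m) * (\<Sum>k=1..N div m. of_real (y k) * E h (m * k)))"
      proof (rule sum.mono_neutral_right)
        show "{U<..N div V} \<subseteq> {1..N}" by (auto intro: order.trans[OF _ div_le_dividend])
        show "\<forall>i\<in>{1..N} - {U<..N div V}. of_real (b i) * (\<Sum>k=1..N div i. of_real (y k) * E h (i * k)) = 0"
        proof
          fix i assume i: "i \<in> {1..N} - {U<..N div V}"
          show "of_real (b i) * (\<Sum>k=1..N div i. of_real (y k) * E h (i * k)) = 0"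
          proof (cases "i \<le> U")
            case True then show ?thesis using bz i by auto
          next
            case False
            then have iV: "i > N div V" using i by auto
            have "y k = 0" if k: "k \<in> {1..N div i}" for k
            proof (rule ccontr)
              assume "y k \<noteq> 0"
              then have "k > V" by (auto simp: y_def \<Lambda>2_def split: if_splits)
              then have "i * V \<le> i * k" by simp
              also have "\<dots> \<le> N" using k i by (simp add: less_eq_div_iff_mult_less_eq mult.commute)
              finally have "i \<le> N div V" using UV(2) by (simp add: less_eq_div_iff_mult_less_eq)
              then show False using iV by simp
            qed
            then show ?thesis by simp
          qed
        qed
      qed simp
      finally show "(\<Sum>m\<in>{U<..N div V}. of_real (b m) * (\<Sum>k=1..N div m. of_real (y k) * E h (m * k))) = SC h" by simp
    qed
    finally show ?thesis .
  qed
  have "(\<Sum>h=1..H. c h * (\<Sum>n=1..N. of_real (mangoldt n) * E h n))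
     = (\<Sum>h=1..H. c h * S0 h) + (\<Sum>h=1..H. c h * SA h) - ((\<Sum>h=1..H. c h * SB1 h) + (\<Sum>h=1..H. c h * SB2 h)) + (\<Sum>h=1..H. c h * SC h)"
    unfolding split SBs by (simp add: ring_distribs sum.distrib sum_subtractf)
  also have "norm \<dots> \<le> real H * real V * G + G * sqrt T1 + (G * sqrt T1 + 2 * G\<^sup>2 * sqrt T2) + 2 * G\<^sup>2 * sqrt T2"
    by (intro order.trans[OF norm_triangle_ineq] order.trans[OF norm_triangle_ineq4] add_mono b0 bA bB1 bB2 bC)
  finally show ?thesis unfolding E_def T1_def T2_def by (simp add: algebra_simps)
qed

section \<open>Chebyshev's lower bound\<close>

definition chebyshev_psi :: "nat \<Rightarrow> real" where
  "chebyshev_psi N = (\<Sum>n=1..N. mangoldt n)"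

lemma ln_fact_eq_sum_mangoldt: "ln (fact N) = (\<Sum>d=1..N. mangoldt d * real (N div d))"
proof -
  have "ln (fact N) = (\<Sum>n=1..N. ln (real n))"
    by (induction N) (simp_all add: ln_mult add.commute)
  also have "\<dots> = (\<Sum>n=1..N. \<Sum>d | d dvd n. mangoldt d)"
    by (intro sum.cong refl) (use mangoldt_sum[where 'a = real] in auto)
  also have "\<dots> = (\<Sum>d=1..N. \<Sum>m=1..N div d. mangoldt d)" by (rule sum_divisors_swap)
  finally show ?thesis by (simp add: mult.commute)
qed

text \<open>Chebyshev's argument: in ln N! - 2 ln (N div 2)! the von Mangoldt function has
  coefficients 0 or 1, while the middle binomial coefficient is at least 2^N / (N + 1).\<close>

lemma chebyshev_psi_ge:
  assumes "N \<ge> 20" shows "real N / 4 \<le> chebyshev_psi N"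
proof -
  define M where "M = N div 2"
  have "ln (fact N) - 2 * ln (fact M) \<le> chebyshev_psi N"
  proof -
    have "ln (fact M) = (\<Sum>d=1..N. mangoldt d * real (M div d))"
      unfolding ln_fact_eq_sum_mangoldt by (intro sum.mono_neutral_left) (auto simp: M_def)
    then have "ln (fact N) - 2 * ln (fact M) = (\<Sum>d=1..N. mangoldt d * (real (N div d) - 2 * real (M div d)))"
      unfolding ln_fact_eq_sum_mangoldt[of N]
      by (simp add: sum_distrib_left sum_subtractf[symmetric] algebra_simps)
    also have "\<dots> \<le> (\<Sum>d=1..N. mangoldt d * 1)"
    proof (intro sum_mono mult_left_mono mangoldt_nonneg)
      fix d
      have "M div d = (N div d) div 2" by (simp add: M_def div_mult2_eq[symmetric] mult.commute)
      then show "real (N div d) - 2 * real (M div d) \<le> 1" by linarith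
    qed
    finally show ?thesis by (simp add: chebyshev_psi_def)
  qed
  moreover have "ln (2 ^ N / (real N + 1)) \<le> ln (fact N) - 2 * ln (fact M)"
  proof -
    have "(2::nat) ^ N = (\<Sum>k\<le>N. N choose k)" by (simp add: choose_row_sum)
    also have "\<dots> \<le> (\<Sum>k\<le>N. N choose M)" unfolding M_def by (intro sum_mono binomial_maximum)
    finally have c: "(2::nat) ^ N \<le> (N + 1) * (N choose M)" by simp
    have "(N choose M) * (fact M * fact M) \<le> (N choose M) * (fact M * fact (N - M) :: nat)"
      by (intro mult_left_mono fact_mono) (auto simp: M_def)
    also have "\<dots> = fact N" using binomial_fact_lemma[of M N] by (simp add: M_def mult_ac)
    finally have f: "(N choose M) * (fact M * fact M) \<le> (fact N :: nat)" .
    have "2 ^ N * (fact M * fact M) \<le> (N + 1) * (N choose M) * (fact M * fact M :: nat)"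
      using c by (intro mult_right_mono) auto
    also have "\<dots> \<le> (N + 1) * fact N" using mult_left_mono[OF f, of "N + 1"] by (simp add: mult_ac)
    finally have "real (2 ^ N * (fact M * fact M)) \<le> real ((N + 1) * fact N)" by (rule of_nat_mono)
    then have "2 ^ N / (real N + 1) \<le> fact N / (fact M * fact M)" by (simp add: field_simps)
    then have "ln (2 ^ N / (real N + 1)) \<le> ln (fact N / (fact M * fact M))" by simp
    also have "\<dots> = ln (fact N) - 2 * ln (fact M)" by (simp add: ln_div ln_mult)
    finally show ?thesis .
  qed
  moreover have "ln (2 ^ N / (real N + 1)) = real N * ln 2 - ln (real N + 1)"
    by (simp add: ln_div ln_realpow)
  moreover have "real N * (1/2) \<le> real N * ln 2" using ln_two_ge_half by (intro mult_left_mono) auto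
  moreover have "20 \<le> real N" using assms by simp
  \<comment> \<open>The tangent to the logarithm at 16, where ln 16 - 1 is rounded up to 3. Then N /
    2 - (N + 1) / 16 - 3 >= N / 4 holds for N >= 20.\<close>
  moreover have "ln (real N + 1) \<le> (real N + 1) / 16 + 3"
  proof -
    have "ln ((real N + 1) / 16) \<le> (real N + 1) / 16 - 1" by (intro ln_le_minus_one) simp
    moreover have "ln (16::real) = 4 * ln 2" using ln_realpow[of 2 4] by simp
    moreover have "ln (2::real) \<le> 1" using ln_le_minus_one[of "2::real"] by simp
    ultimately show ?thesis by (simp add: ln_div)
  qed
  ultimately show ?thesis by argo
qed

text \<open>Only powers p^k with k >= 2 contribute. They have p <= sqrt N and k <= 2 G, and each has
  weight at most G.\<close>

lemma sum_mangoldt_not_prime_le: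
  assumes N: "N \<ge> 1" and G: "1 + ln (real N) \<le> G"
  shows "(\<Sum>n\<in>{n\<in>{1..N}. \<not> prime n}. mangoldt n) \<le> 2 * sqrt (real N) * G\<^sup>2"
proof -
  define S where "S = {n\<in>{1..N}. \<not> prime n \<and> (mangoldt n :: real) \<noteq> 0}"
  define s where "s = nat \<lfloor>sqrt (real N)\<rfloor>"
  define t where "t = nat \<lfloor>2 * G\<rfloor>"
  have "ln (real N) \<ge> 0" using N by simp
  then have G1: "G \<ge> 1" using G by linarith
  have "S \<subseteq> (\<lambda>(p,k). p ^ k) ` ({1..s} \<times> {1..t})"
  proof
    fix n assume n: "n \<in> S"
    then have "primepow n" by (auto simp: S_def mangoldt_def split: if_splits)
    then obtain p k where pk: "prime p" "k > 0" "n = p ^ k" by (auto simp: primepow_def)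
    have "k \<noteq> 1" using n pk by (auto simp: S_def)
    then have k: "k \<ge> 2" using pk by simp
    have nN: "n \<le> N" using n by (simp add: S_def)
    have p2: "p \<ge> 2" using pk by (simp add: prime_ge_2_nat)
    have "p ^ 2 \<le> p ^ k" using k p2 by (intro power_increasing) auto
    then have "p ^ 2 \<le> N" using pk nN by simp
    then have "(real p)\<^sup>2 \<le> real N" by (metis of_nat_mono of_nat_power)
    then have "real p \<le> sqrt (real N)" by (rule real_le_rsqrt)
    then have ps: "p \<le> s" unfolding s_def by linarith
    have "2 ^ k \<le> p ^ k" using p2 by (intro power_mono) auto
    then have "2 ^ k \<le> N" using pk(3) nN by linarith
    then have "(2::real) ^ k \<le> real N" by (metis of_nat_mono of_nat_power of_nat_numeral)
    then have "ln ((2::real) ^ k) \<le> ln (real N)" using N by simp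
    then have "real k * ln 2 \<le> ln (real N)" by (simp add: ln_realpow)
    moreover have "real k * (1/2) \<le> real k * ln 2" using ln_two_ge_half by (intro mult_left_mono) auto
    ultimately have "real k \<le> 2 * G" using G by linarith
    then have "k \<le> t" unfolding t_def by linarith
    then show "n \<in> (\<lambda>(p,k). p ^ k) ` ({1..s} \<times> {1..t})" using ps pk p2 by (intro image_eqI[of _ _ "(p,k)"]) auto
  qed
  then have "card S \<le> card ({1..s} \<times> {1..t})" by (intro surj_card_le) auto
  then have "real (card S) \<le> real s * real t" by (simp add: card_cartesian_product flip: of_nat_mult)
  also have "\<dots> \<le> sqrt (real N) * (2 * G)"
    using G1 by (intro mult_mono) (auto simp: s_def t_def)
  finally have card: "real (card S) \<le> sqrt (real N) * (2 * G)" .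
  have "(\<Sum>n\<in>{n\<in>{1..N}. \<not> prime n}. mangoldt n :: real) = (\<Sum>n\<in>S. mangoldt n)"
    unfolding S_def by (intro sum.mono_neutral_right) auto
  also have "\<dots> \<le> (\<Sum>n\<in>S. G)"
  proof (intro sum_mono)
    fix n assume n: "n \<in> S"
    then have "(mangoldt n :: real) \<le> ln (real n)" by (intro mangoldt_le) (auto simp: S_def)
    also have "\<dots> \<le> ln (real N)" using n by (auto simp: S_def)
    finally show "(mangoldt n :: real) \<le> G" using G by linarith
  qed
  also have "\<dots> \<le> (sqrt (real N) * (2 * G)) * G" using card G1 by (simp add: mult_right_mono)
  finally show ?thesis by (simp add: power2_eq_square mult_ac)
qed

section \<open>Detecting a short interval modulo 1\<close>

text \<open>The coefficients are the eigenvector of the path with J vertices for its largest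
  eigenvalue 2 cos (pi / (J + 1)). This choice maximises the mean of cos(2 pi x) |A(x)|^2 relative
  to that of |A(x)|^2.\<close>

definition fejer_poly :: "nat \<Rightarrow> real \<Rightarrow> complex" where
  "fejer_poly J x = (\<Sum>j=1..J. of_real (sin (real j * (pi / real (J + 1)))) * ue (real j * x))"

context
  fixes J :: nat and \<phi> :: real and a :: "nat \<Rightarrow> real"
  assumes J: "J \<ge> 1"
  defines "\<phi> \<equiv> pi / real (J + 1)" and "a \<equiv> \<lambda>j. sin (real j * \<phi>)"
begin

section \<open>Identities for Fejer's polynomial\<close>

lemma fejer_poly_eq: "fejer_poly J x = (\<Sum>j=1..J. of_real (a j) * ue (real j * x))"
  unfolding fejer_poly_def a_def \<phi>_def ..

lemma fejer_angle: "0 < \<phi>" "\<phi> \<le> pi / 2" "real (J + 1) * \<phi> = pi" "0 < sin \<phi>"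
proof -
  show p: "0 < \<phi>" unfolding \<phi>_def by (rule divide_pos_pos) simp_all
  show h: "\<phi> \<le> pi / 2" unfolding \<phi>_def using J by (intro divide_left_mono) auto
  show "real (J + 1) * \<phi> = pi" by (simp add: \<phi>_def)
  have "\<phi> < pi" using h pi_gt_zero by argo
  with p show "0 < sin \<phi>" by (rule sin_gt_zero)
qed

lemma fejer_coeff_reflect:
  assumes "j \<le> J + 1" shows "a (J + 1 - j) = a j"
proof -
  have "real (J + 1 - j) * \<phi> = pi - real j * \<phi>"
    unfolding of_nat_diff[OF assms] left_diff_distrib fejer_angle(3) ..
  then have "a (J + 1 - j) = sin (pi - real j * \<phi>)" unfolding a_def by (rule arg_cong)
  also have "\<dots> = a j" unfolding a_def by (rule sin_pi_minus)
  finally show ?thesis .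
qed

lemma fejer_coeff_le_one: "\<bar>a j\<bar> \<le> 1"
  by (simp add: a_def)

lemma sum_fejer_coeff_square: "(\<Sum>j=1..J. (a j)\<^sup>2) = real (J + 1) / 2"
proof -
  have tele: "2 * sin \<phi> * (\<Sum>j=1..n. cos (2 * (real j * \<phi>))) = sin ((2 * real n + 1) * \<phi>) - sin \<phi>" for n
  proof (induction n)
    case (Suc n)
    have "2 * sin \<phi> * cos (2 * (real (Suc n) * \<phi>)) = sin ((2 * real (Suc n) + 1) * \<phi>) - sin ((2 * real n + 1) * \<phi>)"
    proof -
      have "(2 * real (Suc n) + 1) * \<phi> = 2 * (real (Suc n) * \<phi>) + \<phi>" "(2 * real n + 1) * \<phi> = 2 * (real (Suc n) * \<phi>) - \<phi>"
        by (simp_all add: algebra_simps)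
      then show ?thesis by (simp only: sin_add sin_diff) simp
    qed
    then show ?case using Suc by (simp add: distrib_left)
  qed simp
  have "(2 * real J + 1) * \<phi> = 2 * pi - \<phi>" using fejer_angle(3) by (simp add: algebra_simps)
  then have "2 * sin \<phi> * (\<Sum>j=1..J. cos (2 * (real j * \<phi>))) = - 2 * sin \<phi>"
    unfolding tele by (simp add: sin_diff)
  then have "sin \<phi> * (\<Sum>j=1..J. cos (2 * (real j * \<phi>))) = sin \<phi> * (-1)" by simp
  then have c: "(\<Sum>j=1..J. cos (2 * (real j * \<phi>))) = -1" using fejer_angle(4) by (simp only: mult_cancel_left) simp
  have "(\<Sum>j=1..J. (a j)\<^sup>2) = (\<Sum>j=1..J. (1 - cos (2 * (real j * \<phi>))) / 2)"
    by (intro sum.cong refl) (simp only: a_def cos_double_sin, simp)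
  also have "\<dots> = (real J - (\<Sum>j=1..J. cos (2 * (real j * \<phi>)))) / 2"
    by (simp add: sum_subtractf sum_divide_distrib[symmetric])
  finally show ?thesis using c by simp
qed

text \<open>The eigenvector relation \<open>a (j + 1) + a (j - 1) = 2 * cos \<phi> * a j\<close>
  cancels everything but the ends, where \<open>a 0 = a (J + 1) = 0\<close> and
  \<open>a 1 = a J = sin \<phi>\<close> leave the frequencies 0 and J + 1.\<close>

lemma cos_mult_fejer_poly:
  "2 * of_real (cos (2 * pi * x)) * fejer_poly J x
     = 2 * of_real (cos \<phi>) * fejer_poly J x + of_real (sin \<phi>) * (1 + ue (real (J + 1) * x))"
proof -
  have c: "2 * of_real (cos (2 * pi * x)) = ue x + ue (- x)"
    by (simp add: complex_eq_iff ue_def)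
  have rec: "2 * cos \<phi> * a j = a (j + 1) + a (j - 1)" if "j \<ge> 1" for j
  proof -
    have "real (j - 1) * \<phi> = real j * \<phi> - \<phi>" using that by (simp add: of_nat_diff algebra_simps)
    moreover have "real (j + 1) * \<phi> = real j * \<phi> + \<phi>" by (simp add: algebra_simps)
    ultimately show ?thesis by (simp add: a_def sin_add sin_diff)
  qed
  have tele: "(\<Sum>j=1..n. of_real (a j) * (ue (real (j + 1) * x) + ue (real (j - 1) * x)) - of_real (a (j + 1) + a (j - 1)) * ue (real j * x))
     = of_real (a n) * ue (real (n + 1) * x) + of_real (a 1) - of_real (a (n + 1)) * ue (real n * x)" for n
  proof (induction n)
    case 0
    show ?case by (simp add: a_def ue_def)
  next
    case (Suc n)
    then show ?case by (simp add: algebra_simps)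
  qed
  have "(ue x + ue (- x)) * fejer_poly J x - 2 * of_real (cos \<phi>) * fejer_poly J x
    = (\<Sum>j=1..J. of_real (a j) * (ue (real (j + 1) * x) + ue (real (j - 1) * x)) - of_real (a (j + 1) + a (j - 1)) * ue (real j * x))"
    unfolding fejer_poly_eq sum_distrib_left sum_subtractf[symmetric]
  proof (intro sum.cong refl)
    fix j assume j: "j \<in> {1..J}"
    have e: "ue (real (j + 1) * x) = ue x * ue (real j * x)" "ue (real (j - 1) * x) = ue (- x) * ue (real j * x)"
      using j by (simp_all add: ue_add[symmetric] of_nat_diff algebra_simps)
    have r: "complex_of_real (a (j + 1) + a (j - 1)) = 2 * of_real (cos \<phi>) * of_real (a j)"
    proof -
      have "a (j + 1) + a (j - 1) = 2 * cos \<phi> * a j" using rec[of j] j by simp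
      then show ?thesis by (simp only: of_real_mult of_real_numeral)
    qed
    show "(ue x + ue (- x)) * (of_real (a j) * ue (real j * x)) - 2 * of_real (cos \<phi>) * (of_real (a j) * ue (real j * x))
      = of_real (a j) * (ue (real (j + 1) * x) + ue (real (j - 1) * x)) - of_real (a (j + 1) + a (j - 1)) * ue (real j * x)"
      unfolding e r by (simp add: algebra_simps)
  qed
  also have "\<dots> = of_real (a J) * ue (real (J + 1) * x) + of_real (a 1) - of_real (a (J + 1)) * ue (real J * x)"
    by (rule tele)
  also have "a (J + 1) = 0" using fejer_angle(3) by (simp add: a_def)
  also have "a J = sin \<phi>" using fejer_coeff_reflect[of 1] by (simp add: a_def)
  also have "a 1 = sin \<phi>" by (simp add: a_def)
  finally show ?thesis unfolding c by (simp add: algebra_simps)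
qed

text \<open>After multiplication by the conjugate polynomial, the reflection j -> J + 1 - j shows
  that both end terms have the same real part. The last sum has no constant term: in the mean, cos(2
  pi x) acts on |A|^2 like the number cos \<phi>.\<close>

lemma cos_mult_norm_fejer_poly:
  "cos (2 * pi * x) * (norm (fejer_poly J x))\<^sup>2 = cos \<phi> * (norm (fejer_poly J x))\<^sup>2 + sin \<phi> * (\<Sum>j=1..J. a j * cos (2 * pi * (real j * x)))"
proof -
  define A where "A = fejer_poly J x"
  define Cs where "Cs = (\<Sum>j=1..J. a j * cos (2 * pi * (real j * x)))"
  have n: "A * cnj A = of_real ((norm A)\<^sup>2)" by (rule complex_norm_square[symmetric])
  have cA: "cnj A = (\<Sum>j=1..J. of_real (a j) * ue (- (real j * x)))"
    by (simp add: A_def fejer_poly_eq cnj_ue)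
  have r1: "Re (cnj A) = Cs"
    unfolding cA Cs_def Re_sum by (intro sum.cong refl) (simp add: Re_ue)
  have r2: "Re (ue (real (J + 1) * x) * cnj A) = Cs"
  proof -
    have "ue (real (J + 1) * x) * cnj A = (\<Sum>j=1..J. of_real (a j) * ue (real (J + 1 - j) * x))"
      unfolding cA sum_distrib_left
      by (intro sum.cong refl) (auto simp: mult.left_commute ue_add[symmetric] of_nat_diff algebra_simps)
    then have "Re (ue (real (J + 1) * x) * cnj A) = (\<Sum>j=1..J. a j * cos (2 * pi * (real (J + 1 - j) * x)))"
      by (simp only: Re_sum) (intro sum.cong refl, simp add: Re_ue)
    also have "\<dots> = (\<Sum>j=1..J. a (J + 1 - j) * cos (2 * pi * (real (J + 1 - j) * x)))"
      by (intro sum.cong refl) (use fejer_coeff_reflect in auto)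
    also have "\<dots> = Cs" unfolding Cs_def
      by (rule sum.reindex_bij_witness[where i = "\<lambda>j. J + 1 - j" and j = "\<lambda>j. J + 1 - j"]) auto
    finally show ?thesis .
  qed
  have "2 * of_real (cos (2 * pi * x)) * (A * cnj A) = 2 * of_real (cos \<phi>) * (A * cnj A) + of_real (sin \<phi>) * (cnj A + ue (real (J + 1) * x) * cnj A)"
    using arg_cong[OF cos_mult_fejer_poly[of x, folded A_def], of "\<lambda>z. z * cnj A"]
    by (simp add: ring_distribs mult.assoc)
  then have "Re (of_real (2 * cos (2 * pi * x) * (norm A)\<^sup>2)) = Re (of_real (2 * cos \<phi> * (norm A)\<^sup>2) + of_real (sin \<phi>) * (cnj A + ue (real (J + 1) * x) * cnj A))"
    unfolding n by simp
  then have "2 * cos (2 * pi * x) * (norm A)\<^sup>2 = 2 * cos \<phi> * (norm A)\<^sup>2 + sin \<phi> * (Cs + Cs)"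
    using r1 r2 by simp
  then show ?thesis by (simp add: A_def Cs_def)
qed

text \<open>The coefficient of a single cos(2 pi h x), an autocorrelation of \<open>a\<close>, can
  be of order J. It is left split by i, so that every inner sum over h has coefficients of modulus
  at most 1, as the bound for exponential sums demands.\<close>

lemma norm_fejer_poly_square:
  "(norm (fejer_poly J x))\<^sup>2 = real (J + 1) / 2
     + 2 * (\<Sum>i=1..J. a i * (\<Sum>h=1..J. (if i + h \<le> J then a (i + h) else 0) * cos (2 * pi * (real h * x))))"
proof -
  have twice: "u = v + w + w \<Longrightarrow> u = v + 2 * w" for u v w :: real by simp
  define F where "F i j = a i * a j * cos (2 * pi * ((real i - real j) * x))" for i j
  have Fs: "F i j = F j i" for i j
  proof -
    have "2 * pi * ((real i - real j) * x) = - (2 * pi * ((real j - real i) * x))" by (simp add: algebra_simps)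
    then show ?thesis unfolding F_def by (simp only: cos_minus mult_ac)
  qed
  have "complex_of_real ((norm (fejer_poly J x))\<^sup>2) = fejer_poly J x * cnj (fejer_poly J x)" by (rule complex_norm_square)
  also have "\<dots> = (\<Sum>i=1..J. \<Sum>j=1..J. of_real (a i * a j) * ue ((real i - real j) * x))"
    unfolding fejer_poly_eq cnj_sum sum_product
    by (intro sum.cong refl) (simp add: cnj_ue ue_add[symmetric] algebra_simps)
  finally have "Re (complex_of_real ((norm (fejer_poly J x))\<^sup>2)) = (\<Sum>i=1..J. \<Sum>j=1..J. F i j)"
    by (simp only: Re_sum) (simp add: F_def Re_ue)
  then have "(norm (fejer_poly J x))\<^sup>2 = (\<Sum>i=1..J. \<Sum>j=1..J. F i j)" by simp
  also have "\<dots> = (\<Sum>i=1..J. \<Sum>j=1..J. (if i = j then F i j else 0) + (if i < j then F i j else 0) + (if j < i then F i j else 0))"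
    by (intro sum.cong refl) auto
  also have "\<dots> = (\<Sum>i=1..J. F i i) + (\<Sum>i=1..J. \<Sum>j=1..J. if i < j then F i j else 0) + (\<Sum>i=1..J. \<Sum>j=1..J. if j < i then F i j else 0)"
    by (simp add: sum.distrib)
  also have "(\<Sum>i=1..J. \<Sum>j=1..J. if j < i then F i j else 0) = (\<Sum>i=1..J. \<Sum>j=1..J. if i < j then F i j else 0)"
    by (subst sum.swap) (intro sum.cong refl, use Fs in auto)
  also have "(\<Sum>i=1..J. F i i) = real (J + 1) / 2"
    using sum_fejer_coeff_square by (simp add: F_def power2_eq_square)
  also have "(\<Sum>i=1..J. \<Sum>j=1..J. if i < j then F i j else 0) = (\<Sum>i=1..J. a i * (\<Sum>h=1..J. (if i + h \<le> J then a (i + h) else 0) * cos (2 * pi * (real h * x))))"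
  proof (intro sum.cong refl)
    fix i assume i: "i \<in> {1..J}"
    have "(\<Sum>j=1..J. if i < j then F i j else 0) = (\<Sum>j\<in>{i<..J}. F i j)"
      by (intro sum.mono_neutral_cong_right) auto
    also have "\<dots> = (\<Sum>h\<in>{1..J-i}. F i (i + h))"
      by (rule sum.reindex_bij_witness[where i = "\<lambda>h. i + h" and j = "\<lambda>j. j - i"]) auto
    also have "\<dots> = (\<Sum>h\<in>{1..J-i}. a i * (a (i + h) * cos (2 * pi * (real h * x))))"
    proof (intro sum.cong refl)
      fix h
      have "2 * pi * ((real i - real (i + h)) * x) = - (2 * pi * (real h * x))" by (simp add: algebra_simps)
      then show "F i (i + h) = a i * (a (i + h) * cos (2 * pi * (real h * x)))"
        unfolding F_def by (simp only: cos_minus mult.assoc)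
    qed
    also have "\<dots> = (\<Sum>h=1..J. a i * ((if i + h \<le> J then a (i + h) else 0) * cos (2 * pi * (real h * x))))"
      by (intro sum.mono_neutral_cong_left) auto
    finally show "(\<Sum>j=1..J. if i < j then F i j else 0) = a i * (\<Sum>h=1..J. (if i + h \<le> J then a (i + h) else 0) * cos (2 * pi * (real h * x)))"
      by (simp only: sum_distrib_left)
  qed
  finally show ?thesis by (rule twice)
qed

lemma norm_fejer_poly_le: "(norm (fejer_poly J x))\<^sup>2 \<le> (real J)\<^sup>2"
proof -
  have "norm (fejer_poly J x) \<le> (\<Sum>j=1..J. 1)"
    unfolding fejer_poly_eq by (intro sum_norm_le) (simp add: norm_mult fejer_coeff_le_one)
  then show ?thesis by (intro power_mono) auto
qed

text \<open>For \<psi> = pi / \<alpha> the mean of the detector is (cos \<phi> - cos \<psi>) (J + 1)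
  / 2, so all errors must be measured by this difference, however small it is. The estimates follow
  from cos \<psi> <= cos 2\<phi> = 1 - 2 sin^2 \<phi>, from 1 - cos \<phi> <= sin^2 \<phi>, and from
  sin \<phi> >= 2 / (J + 1).\<close>

lemma cos_fejer_angle_gap:
  assumes "2 * \<phi> \<le> \<psi>" "\<psi> \<le> pi"
  shows "(1 - cos \<psi>) \<le> 2 * (cos \<phi> - cos \<psi>)" and "sin \<phi> \<le> (cos \<phi> - cos \<psi>) * (real (J + 1) / 2)" and "0 < cos \<phi> - cos \<psi>"
proof -
  have c0: "cos \<phi> \<ge> 0" "cos \<phi> \<le> 1" using fejer_angle by (auto intro!: cos_ge_zero)
  have s2: "1 - cos \<phi> \<le> (sin \<phi>)\<^sup>2"
  proof -
    have "cos \<phi> * cos \<phi> \<le> 1 * cos \<phi>" using c0 by (intro mult_right_mono)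
    moreover have "(sin \<phi>)\<^sup>2 = 1 - cos \<phi> * cos \<phi>" by (simp only: sin_squared_eq power2_eq_square[of "cos \<phi>"])
    ultimately show ?thesis by linarith
  qed
  have "cos \<psi> \<le> cos (2 * \<phi>)" using assms fejer_angle by (intro cos_monotone_0_pi_le) auto
  also have "\<dots> = 1 - 2 * (sin \<phi>)\<^sup>2" by (simp add: cos_double_sin)
  finally have cp: "2 * (sin \<phi>)\<^sup>2 \<le> 1 - cos \<psi>" by simp
  show g: "(1 - cos \<psi>) \<le> 2 * (cos \<phi> - cos \<psi>)" using s2 cp by simp
  have sq: "(sin \<phi>)\<^sup>2 \<le> cos \<phi> - cos \<psi>" using g cp by simp
  show "0 < cos \<phi> - cos \<psi>" using sq fejer_angle(4) by (meson less_le_trans zero_less_power)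
  have "2 * \<phi> / pi \<le> sin \<phi>" using fejer_angle by (intro sin_ge_linear) auto
  moreover have "2 * \<phi> / pi = 2 / real (J + 1)" by (simp add: \<phi>_def)
  ultimately have "2 / real (J + 1) \<le> sin \<phi>" by simp
  then have "1 \<le> sin \<phi> * (real (J + 1) / 2)" by (simp add: field_simps)
  then have "sin \<phi> * 1 \<le> sin \<phi> * (sin \<phi> * (real (J + 1) / 2))" using fejer_angle(4) by (intro mult_left_mono) auto
  also have "\<dots> = (sin \<phi>)\<^sup>2 * (real (J + 1) / 2)" by (simp add: power2_eq_square)
  also have "\<dots> \<le> (cos \<phi> - cos \<psi>) * (real (J + 1) / 2)" using sq by (intro mult_right_mono) auto
  finally show "sin \<phi> \<le> (cos \<phi> - cos \<psi>) * (real (J + 1) / 2)" by simp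
qed

end

text \<open>The floor of n \<alpha> + \<beta> is p iff n \<alpha> lies in [p - \<beta>, p - \<beta>
  + 1). The summand 1/2 moves to the centre of this interval, and the strict cosine test says that
  some integer n is closer than 1 / (2 \<alpha>) to the centre divided by \<alpha>, away from the
  end points.\<close>

lemma prime_in_beatty_if_cos_gt:
  assumes \<alpha>: "\<alpha> > 1" and p: "\<beta> < real p" and c: "cos (pi / \<alpha>) < cos (2 * pi * ((real p - \<beta> + 1/2) / \<alpha>))"
  shows "int p \<in> beatty \<alpha> \<beta>"
proof -
  define x where "x = (real p - \<beta> + 1/2) / \<alpha>"
  define n where "n = round x"
  define y where "y = x - of_int n"
  have y: "\<bar>y\<bar> \<le> 1/2" using dist_int_le_half[of x] by (simp add: dist_int_def y_def n_def)
  have "cos (2 * pi * x) = cos (2 * pi * y)"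
  proof -
    have "2 * pi * x = 2 * pi * y + 2 * pi * of_int n" by (simp add: y_def algebra_simps)
    then show ?thesis by (simp only: cos_add cos_int_2pin sin_int_2pin)
  qed
  then have "cos (pi / \<alpha>) < cos (2 * pi * \<bar>y\<bar>)" using c by (simp add: x_def abs_if)
  then have "2 * pi * \<bar>y\<bar> < pi / \<alpha>"
    using y \<alpha> by (subst (asm) cos_mono_less_eq) (auto simp: field_simps)
  then have yb: "\<bar>y\<bar> < 1 / (2 * \<alpha>)" using \<alpha> by (simp add: field_simps)
  have "\<alpha> * \<bar>y\<bar> < 1 / 2" using yb \<alpha> by (simp add: field_simps)
  then have ay: "\<bar>\<alpha> * y\<bar> < 1/2" using \<alpha> by (simp add: abs_mult)
  have "\<alpha> * x = real p - \<beta> + 1/2" using \<alpha> by (simp add: x_def)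
  moreover have "\<alpha> * x = \<alpha> * y + \<alpha> * of_int n" by (simp add: y_def algebra_simps)
  ultimately have e: "of_int n * \<alpha> + \<beta> = real p + 1/2 - \<alpha> * y" by (simp add: algebra_simps)
  have fl: "\<lfloor>of_int n * \<alpha> + \<beta>\<rfloor> = int p" unfolding e using ay by (intro floor_unique) (auto simp: abs_less_iff)
  \<comment> \<open>The sequence starts at n = 1; positivity of n is where p > \<beta> is
    used.\<close>
  have "of_int n * \<alpha> > 0" using e ay p by (auto simp: abs_less_iff)
  then have "n > 0" using \<alpha> by (simp add: zero_less_mult_iff)
  then have "n = int (nat n)" "nat n \<ge> 1" by auto
  then show ?thesis using fl unfolding beatty_def by (metis (mono_tags, lifting) mem_Collect_eq of_int_of_nat_eq)
qed

text \<open>The detector is summed against \<Lambda> and evaluated twice. Expanded in frequencies,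
  it gives its mean times \<psi>(N), up to multiples of E. Termwise, it is at most the contribution
  of prime powers and of n <= \<beta>, as at every other prime it is nonpositive. Arbitrary
  coefficients are allowed in \<open>E\<close> because the shift by 1/2 - \<beta> turns into a phase
  depending on h.\<close>

lemma chebyshev_psi_le_if_no_beatty_prime:
  assumes \<alpha>: "\<alpha> > 1" and \<beta>: "\<beta> \<ge> 0" and J: "J \<ge> 1" "2 * \<alpha> \<le> real (J + 1)" and N: "N \<ge> 1" and G: "1 + ln (real N) \<le> G"
    and no: "\<And>p. prime p \<Longrightarrow> \<beta> < real p \<Longrightarrow> p \<le> N \<Longrightarrow> int p \<notin> beatty \<alpha> \<beta>"
    and E: "\<And>c. (\<And>h. norm (c h) \<le> 1) \<Longrightarrow>
       norm (\<Sum>h=1..J. c h * (\<Sum>n=1..N. of_real (mangoldt n) * ue (real (h * n) * (1 / \<alpha>)))) \<le> E"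
  shows "chebyshev_psi N \<le> 5 * E + 4 * real J * (2 * sqrt (real N) * G\<^sup>2 + \<beta> * G)"
proof -
  define \<phi> where "\<phi> = pi / real (J + 1)"
  define a where "a = (\<lambda>j::nat. sin (real j * \<phi>))"
  define x where "x n = (real n - \<beta> + 1/2) / \<alpha>" for n :: nat
  define c0 where "c0 = cos (pi / \<alpha>)"
  define A where "A n = (norm (fejer_poly J (x n)))\<^sup>2" for n
  define Z where "Z h = (\<Sum>n=1..N. mangoldt n * cos (2 * pi * (real h * x n)))" for h :: nat
  define D where "D = cos \<phi> - c0"
  define bad where "bad = {n\<in>{1..N}. \<not> prime n} \<union> {n\<in>{1..N}. real n \<le> \<beta>}"
  have twist: "cos (2 * pi * y) * (norm (fejer_poly J y))\<^sup>2 = cos \<phi> * (norm (fejer_poly J y))\<^sup>2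
      + sin \<phi> * (\<Sum>j=1..J. a j * cos (2 * pi * (real j * y)))" for y
    unfolding a_def \<phi>_def by (rule cos_mult_norm_fejer_poly[OF J(1)])
  have expand: "(norm (fejer_poly J y))\<^sup>2 = real (J + 1) / 2
     + 2 * (\<Sum>i=1..J. a i * (\<Sum>h=1..J. (if i + h \<le> J then a (i + h) else 0) * cos (2 * pi * (real h * y))))" for y
    unfolding a_def \<phi>_def by (rule norm_fejer_poly_square[OF J(1)])
  have sin_pos: "0 < sin \<phi>" unfolding \<phi>_def by (rule fejer_angle(4)[OF J(1)])
  have "pi / (real (J + 1) / 2) \<le> pi / \<alpha>" using J \<alpha> by (intro divide_left_mono) auto
  then have ang1: "2 * \<phi> \<le> pi / \<alpha>" by (simp add: \<phi>_def mult.commute)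
  have ang2: "pi / \<alpha> \<le> pi" using \<alpha> by (simp add: field_simps)
  note gap = cos_fejer_angle_gap[OF J(1), folded \<phi>_def, OF ang1 ang2, folded c0_def, folded D_def]
  have "ln (real N) \<ge> 0" using N by simp
  then have G1: "G \<ge> 1" using G by linarith
  have a1: "\<bar>a j\<bar> \<le> 1" for j by (simp add: a_def)
  have ZE: "\<bar>\<Sum>h=1..J. u h * Z h\<bar> \<le> E" if u: "\<And>h. \<bar>u h\<bar> \<le> 1" for u :: "nat \<Rightarrow> real"
  proof -
    define c where "c h = of_real (u h) * ue (real h * ((1/2 - \<beta>) / \<alpha>))" for h :: nat
    have "norm (c h) \<le> 1" for h using u[of h] by (simp add: c_def norm_mult)
    note bd = E[of c, OF this]
    have eq: "(\<Sum>h=1..J. u h * Z h) = Re (\<Sum>h=1..J. c h * (\<Sum>n=1..N. of_real (mangoldt n) * ue (real (h * n) * (1 / \<alpha>))))"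
      unfolding Re_sum
    proof (intro sum.cong refl)
      fix h
      have "c h * (\<Sum>n=1..N. of_real (mangoldt n) * ue (real (h * n) * (1 / \<alpha>)))
          = of_real (u h) * (\<Sum>n=1..N. of_real (mangoldt n) * ue (real h * x n))"
        unfolding c_def mult.assoc sum_distrib_left
      proof (rule sum.cong[OF refl])
        fix n
        have "real h * x n = real h * ((1/2 - \<beta>) / \<alpha>) + real (h * n) * (1 / \<alpha>)"
            using \<alpha> by (simp add: x_def add_divide_distrib diff_divide_distrib algebra_simps)
        then show "of_real (u h) * (ue (real h * ((1/2 - \<beta>) / \<alpha>)) * (of_real (mangoldt n) * ue (real (h * n) * (1 / \<alpha>))))
            = of_real (u h) * (of_real (mangoldt n) * ue (real h * x n))"
          by (simp only: ue_add mult.left_commute)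
      qed
      then show "u h * Z h = Re (c h * (\<Sum>n=1..N. of_real (mangoldt n) * ue (real (h * n) * (1 / \<alpha>))))"
        by (simp add: Z_def Re_ue)
    qed
    show ?thesis unfolding eq by (rule order.trans[OF abs_Re_le_cmod bd])
  qed
  have E0: "E \<ge> 0" using ZE[of "\<lambda>_. 0"] by simp
  have lower: "D * (real (J + 1) / 2 * chebyshev_psi N - 2 * real J * E) - sin \<phi> * E \<le> (\<Sum>n=1..N. mangoldt n * ((cos (2 * pi * x n) - c0) * A n))"
  proof -
    have "(cos (2 * pi * x n) - c0) * A n = D * A n + sin \<phi> * (\<Sum>j=1..J. a j * cos (2 * pi * (real j * x n)))" for n
      using twist[of "x n"] by (simp add: A_def D_def algebra_simps)
    then have "(\<Sum>n=1..N. mangoldt n * ((cos (2 * pi * x n) - c0) * A n))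
        = D * (\<Sum>n=1..N. mangoldt n * A n) + sin \<phi> * (\<Sum>n=1..N. \<Sum>j=1..J. mangoldt n * (a j * cos (2 * pi * (real j * x n))))"
      by (simp add: sum_distrib_left sum.distrib algebra_simps)
    also have "(\<Sum>n=1..N. \<Sum>j=1..J. mangoldt n * (a j * cos (2 * pi * (real j * x n)))) = (\<Sum>j=1..J. a j * Z j)"
      by (subst sum.swap) (simp add: Z_def sum_distrib_left mult.left_commute)
    also have "(\<Sum>n=1..N. mangoldt n * A n) = real (J + 1) / 2 * chebyshev_psi N + 2 * (\<Sum>i=1..J. a i * (\<Sum>h=1..J. (if i + h \<le> J then a (i + h) else 0) * Z h))"
    proof -
      have "(\<Sum>n=1..N. mangoldt n * A n) = (\<Sum>n=1..N. real (J + 1) / 2 * mangoldt n) + (\<Sum>n=1..N. 2 * (\<Sum>i=1..J. a i * (\<Sum>h=1..J. (if i + h \<le> J then a (i + h) else 0) * (mangoldt n * cos (2 * pi * (real h * x n))))))"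
        unfolding sum.distrib[symmetric] A_def expand
        by (intro sum.cong refl) (simp add: sum_distrib_left mult_ac distrib_left)
      also have "(\<Sum>n=1..N. 2 * (\<Sum>i=1..J. a i * (\<Sum>h=1..J. (if i + h \<le> J then a (i + h) else 0) * (mangoldt n * cos (2 * pi * (real h * x n))))))
         = 2 * (\<Sum>i=1..J. \<Sum>n=1..N. a i * (\<Sum>h=1..J. (if i + h \<le> J then a (i + h) else 0) * (mangoldt n * cos (2 * pi * (real h * x n)))))"
        by (subst sum.swap[where A = "{1..J}" and B = "{1..N}"]) (rule sum_distrib_left[symmetric])
      also have "(\<Sum>i=1..J. \<Sum>n=1..N. a i * (\<Sum>h=1..J. (if i + h \<le> J then a (i + h) else 0) * (mangoldt n * cos (2 * pi * (real h * x n)))))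
         = (\<Sum>i=1..J. a i * (\<Sum>h=1..J. (if i + h \<le> J then a (i + h) else 0) * Z h))"
        unfolding Z_def sum_distrib_left by (rule sum.cong[OF refl]) (rule sum.swap)
      finally show ?thesis by (simp add: chebyshev_psi_def sum_distrib_left)
    qed
    finally have eq: "(\<Sum>n=1..N. mangoldt n * ((cos (2 * pi * x n) - c0) * A n)) =
      D * (real (J + 1) / 2 * chebyshev_psi N + 2 * (\<Sum>i=1..J. a i * (\<Sum>h=1..J. (if i + h \<le> J then a (i + h) else 0) * Z h)))
        + sin \<phi> * (\<Sum>j=1..J. a j * Z j)" .
    have "- (real J * E) \<le> (\<Sum>i=1..J. a i * (\<Sum>h=1..J. (if i + h \<le> J then a (i + h) else 0) * Z h))"
    proof -
      have "\<bar>\<Sum>i=1..J. a i * (\<Sum>h=1..J. (if i + h \<le> J then a (i + h) else 0) * Z h)\<bar> \<le> (\<Sum>i=1..J. 1 * E)"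
      proof (intro order.trans[OF sum_abs] sum_mono)
        fix i
        have "\<bar>\<Sum>h=1..J. (if i + h \<le> J then a (i + h) else 0) * Z h\<bar> \<le> E" by (rule ZE) (use a1 in auto)
        then show "\<bar>a i * (\<Sum>h=1..J. (if i + h \<le> J then a (i + h) else 0) * Z h)\<bar> \<le> 1 * E"
          unfolding abs_mult using a1 by (intro mult_mono) auto
      qed
      then show ?thesis by (simp only: sum_constant abs_le_iff) simp
    qed
    then have "D * (real (J + 1) / 2 * chebyshev_psi N - 2 * real J * E) \<le>
        D * (real (J + 1) / 2 * chebyshev_psi N + 2 * (\<Sum>i=1..J. a i * (\<Sum>h=1..J. (if i + h \<le> J then a (i + h) else 0) * Z h)))"
      using gap(3) by (intro mult_left_mono) linarith+
    moreover have "- E \<le> (\<Sum>j=1..J. a j * Z j)" using ZE[of a] a1 by (simp add: abs_le_iff)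
    then have "sin \<phi> * (- E) \<le> sin \<phi> * (\<Sum>j=1..J. a j * Z j)" using sin_pos by (intro mult_left_mono) auto
    ultimately show ?thesis unfolding eq by linarith
  qed
  have upper: "(\<Sum>n=1..N. mangoldt n * ((cos (2 * pi * x n) - c0) * A n)) \<le> (1 - c0) * (real J)\<^sup>2 * (\<Sum>n\<in>bad. mangoldt n)"
  proof -
    have c01: "c0 \<le> 1" by (simp add: c0_def)
    have "(\<Sum>n=1..N. mangoldt n * ((cos (2 * pi * x n) - c0) * A n)) \<le> (\<Sum>n=1..N. if n \<in> bad then (1 - c0) * (real J)\<^sup>2 * mangoldt n else 0)"
    proof (intro sum_mono)
      fix n assume n: "n \<in> {1..N}"
      show "mangoldt n * ((cos (2 * pi * x n) - c0) * A n) \<le> (if n \<in> bad then (1 - c0) * (real J)\<^sup>2 * mangoldt n else 0)"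
      proof (cases "n \<in> bad")
        case True
        have "(cos (2 * pi * x n) - c0) * A n \<le> (1 - c0) * (real J)\<^sup>2"
          using norm_fejer_poly_le[OF J(1), of "x n"] c01 by (intro mult_mono) (auto simp: A_def)
        then show ?thesis using True mangoldt_nonneg[of n] by (simp add: mult_left_mono mult.commute[of "mangoldt n"] mult_right_mono)
      next
        case False
        then have "prime n" "\<beta> < real n" "n \<le> N" using n by (auto simp: bad_def)
        then have "\<not> (c0 < cos (2 * pi * x n))"
          using no prime_in_beatty_if_cos_gt[OF \<alpha>, of \<beta> n] unfolding c0_def x_def by blast
        then have "mangoldt n * ((cos (2 * pi * x n) - c0) * A n) \<le> 0"
          using mangoldt_nonneg[of n] by (intro mult_nonneg_nonpos mult_nonpos_nonneg) (auto simp: A_def)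
        then show ?thesis using False by simp
      qed
    qed
    also have "\<dots> = (\<Sum>n\<in>bad. (1 - c0) * (real J)\<^sup>2 * mangoldt n)"
      by (intro sum.mono_neutral_cong_right) (auto simp: bad_def)
    finally show ?thesis by (simp add: sum_distrib_left)
  qed
  have P: "(\<Sum>n\<in>bad. mangoldt n) \<le> 2 * sqrt (real N) * G\<^sup>2 + \<beta> * G"
  proof -
    have "(\<Sum>n\<in>bad. mangoldt n :: real) \<le> (\<Sum>n\<in>{n\<in>{1..N}. \<not> prime n}. mangoldt n) + (\<Sum>n\<in>{n\<in>{1..N}. real n \<le> \<beta>}. mangoldt n)"
      unfolding bad_def by (subst sum.union_inter[symmetric]) (auto intro!: sum_nonneg mangoldt_nonneg)
    also have "(\<Sum>n\<in>{n\<in>{1..N}. \<not> prime n}. mangoldt n) \<le> 2 * sqrt (real N) * G\<^sup>2" by (rule sum_mangoldt_not_prime_le[OF N G])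
    also have "(\<Sum>n\<in>{n\<in>{1..N}. real n \<le> \<beta>}. mangoldt n) \<le> (\<Sum>n\<in>{n\<in>{1..N}. real n \<le> \<beta>}. G)"
    proof (intro sum_mono)
      fix n assume n: "n \<in> {n\<in>{1..N}. real n \<le> \<beta>}"
      then have "(mangoldt n :: real) \<le> ln (real n)" by (intro mangoldt_le) auto
      also have "\<dots> \<le> ln (real N)" using n by auto
      finally show "(mangoldt n :: real) \<le> G" using G by linarith
    qed
    also have "\<dots> \<le> \<beta> * G"
    proof -
      have "card {n\<in>{1..N}. real n \<le> \<beta>} \<le> card {1..nat \<lfloor>\<beta>\<rfloor>}" by (intro card_mono) (auto simp: le_nat_floor)
      then have "real (card {n\<in>{1..N}. real n \<le> \<beta>}) \<le> \<beta>" using \<beta> by (simp, linarith)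
      then show ?thesis using G1 by (simp add: mult_right_mono)
    qed
    finally show ?thesis by simp
  qed
  define PP where "PP = 2 * sqrt (real N) * G\<^sup>2 + \<beta> * G"
  have PP0: "PP \<ge> 0" using \<beta> G1 by (simp add: PP_def)
  have "D * (real (J + 1) / 2 * chebyshev_psi N - 2 * real J * E) - sin \<phi> * E \<le> (1 - c0) * (real J)\<^sup>2 * PP"
    using lower upper mult_left_mono[OF P, of "(1 - c0) * (real J)\<^sup>2"] by (simp add: PP_def c0_def)
  also have "\<dots> \<le> 2 * D * (real J)\<^sup>2 * PP" using gap(1) PP0 by (intro mult_right_mono) auto
  finally have "D * (real (J + 1) / 2 * chebyshev_psi N - 2 * real J * E) \<le> 2 * D * (real J)\<^sup>2 * PP + sin \<phi> * E" by simp
  \<comment> \<open>From here on every term carries the factor \<open>D\<close>, which can be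
    cancelled although it tends to 0 for large \<alpha>.\<close>
  also have "sin \<phi> * E \<le> D * (real (J + 1) / 2) * E" using gap(2) E0 by (intro mult_right_mono)
  finally have "D * (real (J + 1) / 2 * chebyshev_psi N - 2 * real J * E) \<le> D * (2 * (real J)\<^sup>2 * PP + real (J + 1) / 2 * E)"
    by (simp add: algebra_simps)
  then have m: "real (J + 1) / 2 * chebyshev_psi N - 2 * real J * E \<le> 2 * (real J)\<^sup>2 * PP + real (J + 1) / 2 * E"
    using gap(3) by simp
  \<comment> \<open>Division by (J + 1) / 2 bounds the coefficient 2 J of E by 4, and one more E
    comes from the sin \<phi> term: together the 5 of the statement.\<close>
  have "real (J + 1) / 2 * chebyshev_psi N \<le> real (J + 1) / 2 * (5 * E + 4 * real J * PP)"
  proof -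
    have "2 * (real J)\<^sup>2 * PP \<le> real (J + 1) / 2 * (4 * real J * PP)" using PP0 by (simp add: power2_eq_square algebra_simps)
    moreover have "2 * real J * E \<le> real (J + 1) / 2 * (4 * E)" using E0 by (simp add: algebra_simps)
    moreover have "t * (5 * E + y) = t * (4 * E) + t * y + t * E" for t y by (simp add: algebra_simps)
    then have "real (J + 1) / 2 * (5 * E + 4 * real J * PP)
        = real (J + 1) / 2 * (4 * E) + real (J + 1) / 2 * (4 * real J * PP) + real (J + 1) / 2 * E" .
    ultimately show ?thesis using m by linarith
  qed
  then show ?thesis by (simp add: PP_def)
qed

section \<open>Primes in Beatty sequences\<close>

text \<open>\<open>c1\<close> and \<open>c2\<close> control the terms with q, \<open>c3\<close> is U
  V^2 <= N for the cut-offs below, and \<open>c4\<close> disposes of n <= \<beta>. Without a prime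
  in the sequence, N / 4 <= \<psi>(N) <= N / 10 + N / 16 + N / 16, a contradiction. The logarithm is
  rounded up to a natural number \<open>g\<close> so that the cut-offs are natural numbers.\<close>

lemma exists_beatty_prime:
  fixes J g N q :: nat
  assumes \<alpha>: "\<alpha> > 1" and \<beta>: "\<beta> \<ge> 0" and J: "J \<ge> 2" "2 * \<alpha> \<le> real (J + 1)" and sp: "spaced (1 / \<alpha>) q" and q: "q \<ge> 2"
    and G: "1 + ln (real N) \<le> real g"
    and c1: "10 ^ 8 * real J ^ 2 * real g ^ 13 \<le> real q" and c2: "10 ^ 8 * real J * real g ^ 13 * real q \<le> real N"
    and c3: "10 ^ 24 * real J ^ 4 * real g ^ 39 \<le> real N" and c4: "64 * real J * \<beta> * real g \<le> real N"
    and N: "N \<ge> 20"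
  shows "\<exists>p. prime p \<and> p \<le> N \<and> int p \<in> beatty \<alpha> \<beta>"
proof (rule ccontr)
  assume no: "\<not> (\<exists>p. prime p \<and> p \<le> N \<and> int p \<in> beatty \<alpha> \<beta>)"
  \<comment> \<open>With these cut-offs each term under the square roots of \<open>exp_sum_mangoldt_le\<close> is at most
    \<open>N\<^sup>2 / (10\<^sup>8 g\<^sup>1\<^sup>3)\<close>, up to its explicit powers of \<open>g\<close>; these, multiplied by the square of the
    factor in front of the root, are at most \<open>g\<^sup>1\<^sup>3\<close>.\<close>
  define U where "U = 10 ^ 8 * J ^ 2 * g ^ 13"
  define V where "V = 10 ^ 8 * J * g ^ 13"
  have lnN: "ln (real N) \<ge> 0" using N by simp
  then have "real g \<ge> 1" using G by linarith
  then have g: "g \<ge> 1" by simp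
  have gpow: "1 \<le> real g ^ n" for n using g by (intro one_le_power) simp
  have UV2: "U * V\<^sup>2 \<le> N"
  proof -
    have "U * V\<^sup>2 = 10 ^ 24 * J ^ 4 * g ^ 39"
      by (simp add: U_def V_def power_mult_distrib power_mult[symmetric] power_add[symmetric] power2_eq_square algebra_simps power4_eq_xxxx)
    then have "real (U * V\<^sup>2) \<le> real N" using c3 by simp
    then show ?thesis by (simp only: of_nat_le_iff)
  qed
  have Jnat: "J \<le> V" unfolding V_def
  proof -
    have "1 * J * 1 \<le> 10 ^ 8 * J * g ^ 13" using g by (intro mult_le_mono) auto
    then show "J \<le> 10 ^ 8 * J * g ^ 13" by simp
  qed
  have U1: "U \<ge> 1" using J g by (simp add: U_def Suc_leI)
  have V2: "V \<ge> 2" using J Jnat by linarith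
  have JU: "J \<le> U"
  proof -
    have "1 * (J * J) * 1 \<le> 10 ^ 8 * J ^ 2 * g ^ 13" using g by (intro mult_le_mono) (auto simp: power2_eq_square)
    then have "J * J \<le> U" by (simp add: U_def)
    moreover have "J * 1 \<le> J * J" using J by (intro mult_le_mono) auto
    ultimately show ?thesis by linarith
  qed
  have UVV: "U * V * V \<le> N" using UV2 by (simp add: power2_eq_square mult.assoc)
  have UVN: "2 * (U * V) \<le> N"
  proof -
    have "U * V * 2 \<le> U * V * V" using V2 by (intro mult_le_mono) auto
    then show ?thesis using UVV by linarith
  qed
  have JUN: "J * U \<le> N"
  proof -
    have "U * J * 1 \<le> U * V * V" using V2 Jnat by (intro mult_le_mono) auto
    then have "U * J \<le> N" using UVV by linarith
    then show ?thesis by (simp only: mult.commute)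
  qed
  have qN: "q \<le> N"
  proof -
    have "1 * 1 * 1 * real q \<le> 10 ^ 8 * real J * real g ^ 13 * real q"
      using J gpow[of 13] by (intro mult_right_mono mult_mono) auto
    then have "real q \<le> real N" using c2 by simp
    then show ?thesis by simp
  qed
  have "ln (real q) \<le> ln (real N)" using qN q by simp
  then have Gq: "1 + ln (real q) \<le> real g" using G by linarith
  define w where "w = 1 / (10 ^ 8 * real g ^ 13)"
  have Nr: "real N > 0" using N by simp
  have gr: "real g > 0" using g by simp
  have b1: "real J ^ 2 / real q \<le> w"
    unfolding w_def using c1 q g by (simp add: field_simps)
  have b2: "real J * real q / real N \<le> w"
    unfolding w_def using c2 Nr g by (simp add: field_simps)
  have b3: "real J ^ 2 / real U = w"
    using J g by (simp add: w_def U_def)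
  have b4: "real J / real V = w"
    using J g by (simp add: w_def V_def)
  have b5: "real J ^ 2 * real U / real N \<le> w"
  proof -
    have "10 ^ 8 * real g ^ 13 * (real J ^ 2 * real U) = 10 ^ 16 * real J ^ 4 * real g ^ 26"
      by (simp add: U_def power_add[symmetric] algebra_simps)
    also have "\<dots> \<le> 10 ^ 24 * real J ^ 4 * real g ^ 39"
      using g J by (intro mult_mono power_increasing) auto
    also have "\<dots> \<le> real N" by (rule c3)
    finally show ?thesis unfolding w_def using Nr g by (simp add: field_simps)
  qed
  let ?T1 = "12 * real g ^ 5 * (real J * real N) * (real J * real N / real q + real J * real U + real q)"
  let ?T2 = "8 * real g ^ 9 * (real J * real N) * (real J * real N / real q + real J * real N / real U + real N / real V + real q)"
  have T1: "?T1 \<le> (6 * real N / (10 ^ 4 * real g))\<^sup>2"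
  proof -
    have "(real J * real N) * (real J * real N / real q + real J * real U + real q)
        = (real N)\<^sup>2 * (real J ^ 2 / real q + real J ^ 2 * real U / real N + real J * real q / real N)"
      using Nr q by (simp add: field_simps power2_eq_square)
    also have "\<dots> \<le> (real N)\<^sup>2 * (w + w + w)"
      using b1 b2 b5 by (intro mult_left_mono add_mono) auto
    finally have "12 * real g ^ 5 * ((real J * real N) * (real J * real N / real q + real J * real U + real q)) \<le> 12 * real g ^ 5 * ((real N)\<^sup>2 * (3 * w))"
      by (intro mult_left_mono) auto
    also have "\<dots> = 36 * (real N)\<^sup>2 / 10 ^ 8 * (real g ^ 5 / real g ^ 13)" by (simp add: w_def)
    also have "\<dots> \<le> 36 * (real N)\<^sup>2 / 10 ^ 8 * (1 / (real g)\<^sup>2)"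
    proof (rule mult_left_mono)
      have "real g ^ 5 * (real g)\<^sup>2 \<le> real g ^ 13" using g by (simp add: power_add[symmetric] power_increasing)
      then show "real g ^ 5 / real g ^ 13 \<le> 1 / (real g)\<^sup>2" using gr by (simp add: field_simps)
    qed simp
    also have "36 * (real N)\<^sup>2 / 10 ^ 8 * (1 / (real g)\<^sup>2) = (6 * real N / (10 ^ 4 * real g))\<^sup>2"
      by (simp add: power_mult_distrib power_divide)
    finally show ?thesis by (simp add: mult.assoc)
  qed
  have T2: "?T2 \<le> (6 * real N / (10 ^ 4 * (real g)\<^sup>2))\<^sup>2"
  proof -
    have "(real J * real N) * (real J * real N / real q + real J * real N / real U + real N / real V + real q)
        = (real N)\<^sup>2 * (real J ^ 2 / real q + real J ^ 2 / real U + real J / real V + real J * real q / real N)"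
      using Nr q U1 V2 by (simp add: field_simps power2_eq_square)
    also have "\<dots> \<le> (real N)\<^sup>2 * (w + w + w + w)"
      using b1 b2 b3 b4 by (intro mult_left_mono add_mono) auto
    finally have "8 * real g ^ 9 * ((real J * real N) * (real J * real N / real q + real J * real N / real U + real N / real V + real q)) \<le> 8 * real g ^ 9 * ((real N)\<^sup>2 * (4 * w))"
      by (intro mult_left_mono) auto
    also have "\<dots> = 32 * (real N)\<^sup>2 / 10 ^ 8 * (real g ^ 9 / real g ^ 13)" by (simp add: w_def)
    also have "real g ^ 9 / real g ^ 13 = 1 / (real g) ^ 4"
      using gr by (simp add: field_simps power_add[symmetric])
    \<comment> \<open>32 is raised to the square 36, which makes the root rational.\<close>
    also have "32 * (real N)\<^sup>2 / 10 ^ 8 * (1 / (real g) ^ 4) \<le> 36 * (real N)\<^sup>2 / 10 ^ 8 * (1 / (real g) ^ 4)"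
      by (intro mult_right_mono divide_right_mono) auto
    also have "\<dots> = (6 * real N / (10 ^ 4 * (real g)\<^sup>2))\<^sup>2"
      by (simp add: power_mult_distrib power_divide power_mult[symmetric])
    finally show ?thesis by (simp add: mult.assoc)
  qed
  have s1: "2 * real g * sqrt (?T1) \<le> 12 * real N / 10 ^ 4"
  proof -
    have "sqrt (?T1) \<le> 6 * real N / (10 ^ 4 * real g)"
      by (rule real_le_lsqrt[OF _ T1]) simp
    then have "2 * real g * sqrt (?T1) \<le> 2 * real g * (6 * real N / (10 ^ 4 * real g))"
      by (rule mult_left_mono) simp
    also have "\<dots> = 12 * real N / 10 ^ 4" using gr by simp
    finally show ?thesis .
  qed
  have s2: "4 * (real g)\<^sup>2 * sqrt (?T2) \<le> 24 * real N / 10 ^ 4"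
  proof -
    have "sqrt (?T2) \<le> 6 * real N / (10 ^ 4 * (real g)\<^sup>2)"
      by (rule real_le_lsqrt[OF _ T2]) simp
    then have "4 * (real g)\<^sup>2 * sqrt (?T2) \<le> 4 * (real g)\<^sup>2 * (6 * real N / (10 ^ 4 * (real g)\<^sup>2))"
      by (rule mult_left_mono) simp
    also have "\<dots> = 24 * real N / 10 ^ 4" using gr by simp
    finally show ?thesis .
  qed
  have s0: "real J * real V * real g \<le> real N / 100"
  proof -
    have "100 * (real J * real V * real g) = 10 ^ 10 * real J ^ 2 * real g ^ 14"
      by (simp add: V_def power2_eq_square power_Suc[of "real g" 13, symmetric] mult_ac)
    also have "\<dots> \<le> 10 ^ 24 * real J ^ 4 * real g ^ 39"
      using g J by (intro mult_mono power_increasing) auto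
    also have "\<dots> \<le> real N" by (rule c3)
    finally show ?thesis by simp
  qed
  have bound: "norm (\<Sum>h=1..J. c h * (\<Sum>n=1..N. of_real (mangoldt n) * ue (real (h * n) * (1 / \<alpha>)))) \<le> real N / 50"
    if "\<And>h. norm (c h) \<le> 1" for c :: "nat \<Rightarrow> complex"
  proof -
    have "norm (\<Sum>h=1..J. c h * (\<Sum>n=1..N. of_real (mangoldt n) * ue (real (h * n) * (1 / \<alpha>)))) \<le> real J * real V * real g
      + 2 * real g * sqrt (?T1)
      + 4 * (real g)\<^sup>2 * sqrt (?T2)"
      using J by (intro exp_sum_mangoldt_le[OF sp q _ JU UVN V2 UV2 JUN G Gq that]) auto
    also have "\<dots> \<le> real N / 100 + 12 * real N / 10 ^ 4 + 24 * real N / 10 ^ 4"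
      by (intro add_mono s0 s1 s2)
    also have "\<dots> \<le> real N / 50" by simp
    finally show ?thesis .
  qed
  have "chebyshev_psi N \<le> 5 * (real N / 50) + 4 * real J * (2 * sqrt (real N) * (real g)\<^sup>2 + \<beta> * real g)"
    using J N no by (intro chebyshev_psi_le_if_no_beatty_prime[OF \<alpha> \<beta> _ J(2) _ G _ bound]) auto
  moreover have "4 * real J * (2 * sqrt (real N) * (real g)\<^sup>2) \<le> real N / 16"
  proof -
    have "(128 * real J * (real g)\<^sup>2)\<^sup>2 = 2 ^ 14 * real J ^ 2 * real g ^ 4"
      by (simp add: power_mult_distrib power_mult[symmetric])
    also have "\<dots> \<le> 10 ^ 24 * real J ^ 4 * real g ^ 39"
      using g J by (intro mult_mono power_increasing) auto
    also have "\<dots> \<le> real N" by (rule c3)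
    finally have "128 * real J * (real g)\<^sup>2 \<le> sqrt (real N)" by (rule real_le_rsqrt)
    then have "128 * real J * (real g)\<^sup>2 * sqrt (real N) \<le> sqrt (real N) * sqrt (real N)" by (intro mult_right_mono) auto
    then show ?thesis by (simp add: mult_ac)
  qed
  moreover have "4 * real J * (\<beta> * real g) \<le> real N / 16" using c4 by (simp add: mult_ac)
  moreover have "real N / 4 \<le> chebyshev_psi N" using N by (rule chebyshev_psi_ge)
  moreover have "4 * real J * (2 * sqrt (real N) * (real g)\<^sup>2 + \<beta> * real g) = 4 * real J * (2 * sqrt (real N) * (real g)\<^sup>2) + 4 * real J * (\<beta> * real g)"
    by (rule distrib_left)
  ultimately show False using Nr by linarith
qed

section \<open>Convergents\<close>

text \<open>Same index shift as for the numerators: index k belongs to the convergent k - 2, and the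
  recursion starts from the denominators 1 and 0.\<close>

fun shifted_denominator :: "real \<Rightarrow> nat \<Rightarrow> int" where
  "shifted_denominator \<alpha> 0 = 1"
| "shifted_denominator \<alpha> (Suc 0) = 0"
| "shifted_denominator \<alpha> (Suc (Suc k)) =
     partial_quotient \<alpha> k * shifted_denominator \<alpha> (Suc k) + shifted_denominator \<alpha> k"

lemma complete_quotient_irrational:
  assumes "\<alpha> > 1" "\<alpha> \<notin> \<rat>"
  shows "complete_quotient \<alpha> k > 1 \<and> complete_quotient \<alpha> k \<notin> \<rat>"
proof (induction k)
  case (Suc k)
  define x where "x = complete_quotient \<alpha> k"
  have x: "x \<notin> \<rat>" using Suc by (simp add: x_def)
  have fr: "frac x \<notin> \<rat>"
  proof
    assume "frac x \<in> \<rat>"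
    then have "frac x + of_int \<lfloor>x\<rfloor> \<in> \<rat>" by (intro Rats_add) auto
    then show False using x by (simp add: frac_def)
  qed
  have "frac x \<noteq> 0" using fr Rats_0 by metis
  then have f: "0 < frac x" "frac x < 1" using frac_ge_0[of x] frac_lt_1[of x] by linarith+
  have "1 / frac x \<notin> \<rat>"
  proof
    assume "1 / frac x \<in> \<rat>"
    then have "1 / (1 / frac x) \<in> \<rat>" by (rule Rats_divide[OF Rats_1])
    then show False using fr by simp
  qed
  then show ?case using f by (simp add: x_def field_simps)
qed (use assms in simp)

context
  fixes \<alpha> :: real
  assumes \<alpha>: "\<alpha> > 1" "\<alpha> \<notin> \<rat>"
begin

lemma partial_quotient_ge_one: "partial_quotient \<alpha> k \<ge> 1"
  unfolding partial_quotient_def using complete_quotient_irrational[OF \<alpha>, of k] by simp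

lemma shifted_numerator_nonneg: "shifted_numerator \<alpha> k \<ge> 0 \<and> shifted_numerator \<alpha> (Suc k) \<ge> 1"
proof (induction k)
  case (Suc k)
  have "1 * 1 \<le> partial_quotient \<alpha> k * shifted_numerator \<alpha> (Suc k)"
    using Suc partial_quotient_ge_one[of k] by (intro mult_mono) auto
  then show ?case using Suc by simp
qed simp

lemma shifted_numerator_ge_add: "shifted_numerator \<alpha> (Suc k) + shifted_numerator \<alpha> k \<le> shifted_numerator \<alpha> (Suc (Suc k))"
proof -
  have "1 * shifted_numerator \<alpha> (Suc k) \<le> partial_quotient \<alpha> k * shifted_numerator \<alpha> (Suc k)"
    using partial_quotient_ge_one[of k] shifted_numerator_nonneg[of k] by (intro mult_right_mono) auto
  then show ?thesis by simp
qed

lemma shifted_numerator_mono: "j \<le> k \<Longrightarrow> shifted_numerator \<alpha> j \<le> shifted_numerator \<alpha> k"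
proof (rule lift_Suc_mono_le)
  show "shifted_numerator \<alpha> n \<le> shifted_numerator \<alpha> (Suc n)" for n
  proof (cases n)
    case (Suc m)
    then show ?thesis unfolding Suc using shifted_numerator_ge_add[of m] shifted_numerator_nonneg[of m] by linarith
  qed simp
qed

text \<open>p_(n+2) >= p_(n+1) + p_n >= 2 p_n. This is the source of the exponential growth of
  Q.\<close>

lemma shifted_numerator_doubling: "2 ^ i * shifted_numerator \<alpha> k \<le> shifted_numerator \<alpha> (k + 2 * i)"
proof (induction i)
  case (Suc i)
  have "2 * shifted_numerator \<alpha> (k + 2 * i) \<le> shifted_numerator \<alpha> (Suc (Suc (k + 2 * i)))"
    using shifted_numerator_ge_add[of "k + 2 * i"] shifted_numerator_mono[of "k + 2 * i" "Suc (k + 2 * i)"] by simp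
  then show ?case using Suc by simp
qed simp

lemma shifted_numerator_unbounded: "\<exists>k. X < real_of_int (shifted_numerator \<alpha> (Suc k))"
proof -
  obtain i where i: "X < 2 ^ i" using real_arch_pow[of 2 X] by auto
  have "2 ^ i * 1 \<le> shifted_numerator \<alpha> (1 + 2 * i)" using shifted_numerator_doubling[of i 1] by simp
  then have "real_of_int (2 ^ i) \<le> real_of_int (shifted_numerator \<alpha> (Suc (2 * i)))" by (simp only: of_int_le_iff) simp
  moreover have "real_of_int (2 ^ i) = 2 ^ i" by simp
  ultimately have "X < real_of_int (shifted_numerator \<alpha> (Suc (2 * i)))" using i by linarith
  then show ?thesis ..
qed

text \<open>The expression of \<alpha> through a complete quotient x, \<alpha> = (x p + p') / (x d +
  d'), multiplied out so that the induction needs no positivity of the denominator.\<close>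

lemma complete_quotient_relation:
  "\<alpha> * (complete_quotient \<alpha> k * shifted_denominator \<alpha> (Suc k) + shifted_denominator \<alpha> k)
    = complete_quotient \<alpha> k * shifted_numerator \<alpha> (Suc k) + shifted_numerator \<alpha> k"
proof (induction k)
  case (Suc k)
  define x where "x = complete_quotient \<alpha> k"
  define y where "y = complete_quotient \<alpha> (Suc k)"
  have y: "y > 1" unfolding y_def using complete_quotient_irrational[OF \<alpha>] by blast
  have fy: "y = 1 / frac x" by (simp add: x_def y_def)
  then have "frac x = 1 / y" by simp
  then have "x - of_int (partial_quotient \<alpha> k) = 1 / y" by (simp add: frac_def x_def partial_quotient_def)
  then have xy: "y * x = y * of_int (partial_quotient \<alpha> k) + 1" using y by (simp add: field_simps)
  have "y * (\<alpha> * (x * shifted_denominator \<alpha> (Suc k) + shifted_denominator \<alpha> k)) = y * (x * shifted_numerator \<alpha> (Suc k) + shifted_numerator \<alpha> k)"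
    using Suc by (simp add: x_def)
  then have "\<alpha> * ((y * x) * shifted_denominator \<alpha> (Suc k) + y * shifted_denominator \<alpha> k) = (y * x) * shifted_numerator \<alpha> (Suc k) + y * shifted_numerator \<alpha> k"
    by (simp add: algebra_simps)
  then show ?case unfolding xy y_def[symmetric] by (simp add: algebra_simps)
qed simp

lemma shifted_determinant:
  "\<bar>shifted_numerator \<alpha> (Suc k) * shifted_denominator \<alpha> k - shifted_numerator \<alpha> k * shifted_denominator \<alpha> (Suc k)\<bar> = 1"
proof (induction k)
  case (Suc k)
  have "shifted_numerator \<alpha> (Suc (Suc k)) * shifted_denominator \<alpha> (Suc k) - shifted_numerator \<alpha> (Suc k) * shifted_denominator \<alpha> (Suc (Suc k))
    = - (shifted_numerator \<alpha> (Suc k) * shifted_denominator \<alpha> k - shifted_numerator \<alpha> k * shifted_denominator \<alpha> (Suc k))"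
    by (simp add: algebra_simps)
  then show ?case using Suc by (simp only: abs_minus_cancel)
qed simp

text \<open>By the determinant relation p and d are coprime and |1 / \<alpha> - d / p| = 1 / ((x p +
  p') p) <= 1 / p^2. For 0 < |j| <= p / 2 the number j d / p is not an integer, hence at least 1 / p
  away from all of them, and replacing d / p by 1 / \<alpha> moves it by at most 1 / (2p).\<close>

lemma spaced_shifted_numerator: "spaced (1 / \<alpha>) (nat (shifted_numerator \<alpha> (Suc k)))"
proof -
  define p where "p = shifted_numerator \<alpha> (Suc k)"
  define p' where "p' = shifted_numerator \<alpha> k"
  define d where "d = shifted_denominator \<alpha> (Suc k)"
  define d' where "d' = shifted_denominator \<alpha> k"
  define x where "x = complete_quotient \<alpha> k"
  have x: "x > 1" unfolding x_def using complete_quotient_irrational[OF \<alpha>] by blast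
  have p: "p \<ge> 1" "p' \<ge> 0" using shifted_numerator_nonneg[of k] by (auto simp: p_def p'_def)
  have det: "\<bar>p * d' - p' * d\<bar> = 1" using shifted_determinant[of k] by (simp add: p_def p'_def d_def d'_def)
  have rel: "\<alpha> * (x * d + d') = x * p + p'" using complete_quotient_relation[of k] by (simp add: p_def p'_def d_def d'_def x_def)
  have pos: "x * real_of_int p + real_of_int p' > 0" using x p by (intro add_pos_nonneg mult_pos_pos) auto
  have cop: "coprime p d"
  proof (rule coprimeI)
    fix c assume "c dvd p" "c dvd d"
    then have "c dvd p * d' - p' * d" by simp
    then have "c dvd \<bar>p * d' - p' * d\<bar>" by simp
    then show "is_unit c" using det by simp
  qed
  have inv: "1 / \<alpha> = (x * d + d') / (x * p + p')"
    using rel \<alpha>(1) pos by (simp add: field_simps)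
  have "1 / \<alpha> - of_int d / of_int p = of_int (p * d' - p' * d) / ((x * p + p') * p)"
    unfolding inv using pos p by (simp add: field_simps)
  then have "\<bar>1 / \<alpha> - of_int d / of_int p\<bar> = 1 / ((x * p + p') * p)"
    using det pos p by (simp only: abs_divide of_int_abs[symmetric]) (simp add: abs_mult)
  also have "\<dots> \<le> 1 / (of_int p * of_int p)"
  proof -
    have "1 * real_of_int p + 0 \<le> x * p + p'" using x p by (intro add_mono mult_right_mono) auto
    then show ?thesis using p pos by (intro divide_left_mono mult_right_mono mult_pos_pos) auto
  qed
  finally have approx: "\<bar>1 / \<alpha> - of_int d / of_int p\<bar> \<le> 1 / (of_int p * of_int p)" .
  show ?thesis unfolding spaced_def p_def[symmetric]
  proof (intro allI impI)
    fix j :: int assume j: "j \<noteq> 0" "2 * \<bar>j\<bar> \<le> int (nat p)"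
    then have j2: "2 * \<bar>j\<bar> \<le> p" using p by simp
    define n where "n = round (of_int j * (1 / \<alpha>))"
    have "j * d - n * p \<noteq> 0"
    proof
      assume "j * d - n * p = 0"
      then have "p dvd j * d" by (metis dvd_triv_right eq_iff_diff_eq_0)
      then have "p dvd j" using cop by (simp add: coprime_dvd_mult_left_iff)
      then have "\<bar>p\<bar> \<le> \<bar>j\<bar>" using j(1) by (rule dvd_imp_le_int[rotated])
      then show False using j2 j(1) p by linarith
    qed
    then have "1 \<le> \<bar>j * d - n * p\<bar>" by linarith
    then have "1 \<le> \<bar>real_of_int (j * d - n * p)\<bar>" by linarith
    then have one: "1 / of_int p \<le> \<bar>of_int j * (of_int d / of_int p) - real_of_int n\<bar>"
    proof -
      assume a: "1 \<le> \<bar>real_of_int (j * d - n * p)\<bar>"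
      have "of_int j * (of_int d / of_int p) - real_of_int n = real_of_int (j * d - n * p) / of_int p" using p by (simp add: field_simps)
      then show ?thesis using a p by (simp add: divide_right_mono abs_divide)
    qed
    have "\<bar>of_int j * (1 / \<alpha>) - of_int j * (of_int d / of_int p)\<bar> = \<bar>real_of_int j\<bar> * \<bar>1 / \<alpha> - of_int d / of_int p\<bar>"
      by (simp only: right_diff_distrib[symmetric] abs_mult)
    also have "\<dots> \<le> (of_int p / 2) * (1 / (of_int p * of_int p))"
      using approx j2 p by (intro mult_mono) linarith+
    also have "\<dots> = 1 / (2 * of_int p)" using p by simp
    finally have two: "\<bar>of_int j * (1 / \<alpha>) - of_int j * (of_int d / of_int p)\<bar> \<le> 1 / (2 * of_int p)" .
    have tri: "t \<le> \<bar>u - y\<bar>" if "2 * t \<le> \<bar>v - y\<bar>" "\<bar>u - v\<bar> \<le> t" for t u v y :: real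
      using that by linarith
    have "1 / (2 * real_of_int p) \<le> \<bar>of_int j * (1 / \<alpha>) - of_int n\<bar>"
      using one by (intro tri[OF _ two]) simp
    then show "1 / (2 * real (nat p)) \<le> dist_int (of_int j * (1 / \<alpha>))" using p by (simp add: dist_int_def n_def)
  qed
qed

lemma numerator_bracket_iff:
  "numerator_bracket \<alpha> X m \<longleftrightarrow>
     m \<ge> -2 \<and> real_of_int (shifted_numerator \<alpha> (nat (m + 2))) \<le> X \<and> X < real_of_int (shifted_numerator \<alpha> (Suc (nat (m + 2))))"
proof (cases "m \<ge> -2")
  case True
  then have "nat (m + 1 + 2) = Suc (nat (m + 2))" by linarith
  then show ?thesis by (simp add: numerator_bracket_def conv_numerator_def)
qed (simp add: numerator_bracket_def)

text \<open>For \<alpha> < 2 the numerators p_(-1) and p_0 are both 1, so the sequence is only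
  weakly increasing. The bracket is unique nevertheless, because one of its two inequalities is
  strict.\<close>

lemma ex1_numerator_bracket:
  assumes X: "X \<ge> 0" shows "\<exists>!m. numerator_bracket \<alpha> X m"
proof -
  define k where "k = (LEAST k. X < real_of_int (shifted_numerator \<alpha> (Suc k)))"
  have k: "X < real_of_int (shifted_numerator \<alpha> (Suc k))"
    unfolding k_def by (rule LeastI_ex) (rule shifted_numerator_unbounded)
  have k': "real_of_int (shifted_numerator \<alpha> k) \<le> X"
  proof (cases k)
    case (Suc j)
    then have "\<not> X < real_of_int (shifted_numerator \<alpha> (Suc j))" unfolding k_def by (intro not_less_Least) simp
    then show ?thesis using Suc by simp
  qed (use X in simp)
  show ?thesis
  proof (rule ex1I[of _ "int k - 2"])
    show "numerator_bracket \<alpha> X (int k - 2)" using k k' by (simp add: numerator_bracket_iff)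
    fix m assume m: "numerator_bracket \<alpha> X m"
    define j where "j = nat (m + 2)"
    have j: "real_of_int (shifted_numerator \<alpha> j) \<le> X" "X < real_of_int (shifted_numerator \<alpha> (Suc j))" "m = int j - 2"
      using m by (auto simp: numerator_bracket_iff j_def)
    have "\<not> Suc j \<le> k"
    proof
      assume "Suc j \<le> k"
      then have "shifted_numerator \<alpha> (Suc j) \<le> shifted_numerator \<alpha> k" by (rule shifted_numerator_mono)
      then have "real_of_int (shifted_numerator \<alpha> (Suc j)) \<le> real_of_int (shifted_numerator \<alpha> k)" by simp
      then show False using j k' by linarith
    qed
    moreover have "\<not> Suc k \<le> j"
    proof
      assume "Suc k \<le> j"
      then have "shifted_numerator \<alpha> (Suc k) \<le> shifted_numerator \<alpha> j" by (rule shifted_numerator_mono)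
      then have "real_of_int (shifted_numerator \<alpha> (Suc k)) \<le> real_of_int (shifted_numerator \<alpha> j)" by simp
      then show False using j k by linarith
    qed
    ultimately show "m = int k - 2" using j by simp
  qed
qed

end

section \<open>Choice of the index shift and its computability\<close>

text \<open>Let t = ln Q, so that K <= \<epsilon>^2 t and K t <= (\<epsilon> t)^2. Raising 39 to 40
  turns the left side into at most (\<epsilon> t)^80 / 80^80, which y <= exp y at y = \<epsilon> t /
  80 bounds by exp (\<epsilon> t); 2^39 comes from 1 + t <= 2 t. A threshold of order (1 /
  \<epsilon>) log (1 / \<epsilon>) would do; 1 / \<epsilon>^2 is simpler to compute.\<close>

lemma powr_beats_ln_power:
  assumes C: "C \<ge> 1"
  shows "\<exists>K::nat. K \<ge> 1 \<and> (\<forall>\<epsilon> Q. 0 < \<epsilon> \<longrightarrow> \<epsilon> \<le> 1 \<longrightarrow> Q > 0 \<longrightarrow> real K / \<epsilon>\<^sup>2 \<le> ln Q \<longrightarrow> C * (1 + ln Q) ^ 39 \<le> Q powr \<epsilon>)"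
proof -
  define A B :: real where "A = 80 ^ 80" and "B = 2 ^ 39"
  have AB: "A \<ge> 1" "B \<ge> 1" unfolding A_def B_def by (rule one_le_power, simp)+
  define K where "K = nat \<lceil>C * B * A\<rceil>"
  have "1 * 1 * 1 \<le> C * B * A" using C AB by (intro mult_mono) auto
  then have KC: "C * B * A \<le> real K" "real K \<ge> 1" unfolding K_def by linarith+
  show ?thesis
  proof (intro exI[of _ K] conjI allI impI)
    show "K \<ge> 1" using KC by simp
    fix \<epsilon> Q :: real
    assume e: "0 < \<epsilon>" "\<epsilon> \<le> 1" and Q: "Q > 0" and KQ: "real K / \<epsilon>\<^sup>2 \<le> ln Q"
    define t where "t = ln Q"
    have e2: "\<epsilon>\<^sup>2 \<le> 1" using e by (simp add: power_le_one)
    have Kt: "real K \<le> \<epsilon>\<^sup>2 * t" using KQ e by (simp add: t_def field_simps)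
    have "real K / 1 \<le> real K / \<epsilon>\<^sup>2" using e e2 by (intro divide_left_mono) auto
    then have t1: "t \<ge> 1" using KQ KC by (simp add: t_def)
    have "C * (1 + t) ^ 39 \<le> C * (2 * t) ^ 39" using C t1 by (intro mult_left_mono power_mono) auto
    also have "\<dots> = (C * B) * t ^ 39" unfolding B_def power_mult_distrib by (simp only: mult.assoc)
    also have "\<dots> \<le> (C * B) * t ^ 40" using C AB t1 by (intro mult_left_mono power_increasing) auto
    also have "\<dots> \<le> (real K / A) * t ^ 40"
    proof (rule mult_right_mono)
      show "C * B \<le> real K / A" using KC(1) AB by (simp add: pos_le_divide_eq)
    qed (use t1 in simp)
    also have "\<dots> \<le> (real K ^ 40 / A) * t ^ 40"
      using KC AB t1 by (intro mult_right_mono divide_right_mono self_le_power) auto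
    also have "\<dots> = (real K * t) ^ 40 / A" unfolding power_mult_distrib by simp
    also have "\<dots> \<le> ((\<epsilon> * t)\<^sup>2) ^ 40 / A"
    proof (intro divide_right_mono power_mono)
      show "real K * t \<le> (\<epsilon> * t)\<^sup>2" using mult_right_mono[OF Kt, of t] t1 by (simp add: power2_eq_square mult_ac)
    qed (use t1 AB in auto)
    also have "\<dots> = (\<epsilon> * t / 80) ^ 80"
      unfolding power_mult[symmetric] power_divide A_def[symmetric] by simp
    also have "\<dots> \<le> exp (\<epsilon> * t / 80) ^ 80"
    proof (rule power_mono)
      show "\<epsilon> * t / 80 \<le> exp (\<epsilon> * t / 80)" using exp_ge_add_one_self[of "\<epsilon> * t / 80"] by linarith
    qed (use e t1 in auto)
    also have "\<dots> = exp (\<epsilon> * t)" by (subst exp_of_nat_mult[symmetric]) simp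
    also have "\<dots> = Q powr \<epsilon>" using Q by (simp add: powr_def t_def)
    finally show "C * (1 + ln Q) ^ 39 \<le> Q powr \<epsilon>" unfolding t_def .
  qed
qed

text \<open>\<open>recursive_fun\<close> speaks of particular functions on all lists and is not
  evidently closed under changes at lists of the wrong length. Here only the values at lists of
  length n count, so functions can be rewritten freely.\<close>

definition represents_recursive :: "nat \<Rightarrow> (nat list \<Rightarrow> nat) \<Rightarrow> bool" where
  "represents_recursive n f \<longleftrightarrow> (\<exists>F. recursive_fun n F \<and> (\<forall>xs. length xs = n \<longrightarrow> F xs = f xs))"

lemma represents_recursiveI:
  "recursive_fun n F \<Longrightarrow> (\<And>xs. length xs = n \<Longrightarrow> F xs = f xs) \<Longrightarrow> represents_recursive n f"
  unfolding represents_recursive_def by blast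

lemma represents_recursiveE:
  assumes "represents_recursive n f"
  obtains F where "recursive_fun n F" "\<And>xs. length xs = n \<Longrightarrow> F xs = f xs"
  using assms unfolding represents_recursive_def by blast

lemma represents_recursive_proj: "i < n \<Longrightarrow> represents_recursive n (\<lambda>xs. xs ! i)"
  by (rule represents_recursiveI[OF recursive_fun.proj]) auto

lemma represents_recursive_comp1:
  assumes "represents_recursive 1 f" "represents_recursive n g"
  shows "represents_recursive n (\<lambda>xs. f [g xs])"
proof -
  obtain F where F: "recursive_fun 1 F" "\<And>xs. length xs = 1 \<Longrightarrow> F xs = f xs"
    using represents_recursiveE[OF assms(1)] by blast
  obtain G where G: "recursive_fun n G" "\<And>xs. length xs = n \<Longrightarrow> G xs = g xs"
    using represents_recursiveE[OF assms(2)] by blast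
  have "recursive_fun n (\<lambda>xs. F (map (\<lambda>g. g xs) [G]))"
    by (rule recursive_fun.comp[where gs = "[G]" and f = F]) (use F(1) G(1) in simp_all)
  then show ?thesis by (rule represents_recursiveI) (simp add: F(2) G(2))
qed

lemma represents_recursive_comp2:
  assumes "represents_recursive 2 f" "represents_recursive n g" "represents_recursive n h"
  shows "represents_recursive n (\<lambda>xs. f [g xs, h xs])"
proof -
  obtain F where F: "recursive_fun 2 F" "\<And>xs. length xs = 2 \<Longrightarrow> F xs = f xs"
    using represents_recursiveE[OF assms(1)] by blast
  obtain G where G: "recursive_fun n G" "\<And>xs. length xs = n \<Longrightarrow> G xs = g xs"
    using represents_recursiveE[OF assms(2)] by blast
  obtain H where H: "recursive_fun n H" "\<And>xs. length xs = n \<Longrightarrow> H xs = h xs"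
    using represents_recursiveE[OF assms(3)] by blast
  have "recursive_fun n (\<lambda>xs. F (map (\<lambda>g. g xs) [G, H]))"
    by (rule recursive_fun.comp[where gs = "[G, H]" and f = F]) (use F(1) G(1) H(1) in \<open>simp_all add: numeral_2_eq_2\<close>)
  then show ?thesis by (rule represents_recursiveI) (simp add: F(2) G(2) H(2))
qed

section \<open>Arithmetic operations as recursive functions\<close>

lemma represents_recursive_Suc:
  assumes "represents_recursive n g" shows "represents_recursive n (\<lambda>xs. Suc (g xs))"
proof -
  have "represents_recursive 1 (\<lambda>xs. Suc (xs ! 0))"
    by (rule represents_recursiveI[OF recursive_fun.succ]) simp
  from represents_recursive_comp1[OF this assms] show ?thesis by simp
qed

lemma represents_recursive_const: "represents_recursive n (\<lambda>_. c)"
proof (induction c)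
  case 0
  show ?case by (rule represents_recursiveI[OF recursive_fun.zero]) simp
qed (rule represents_recursive_Suc)

lemma represents_recursive_prim_rec:
  assumes "represents_recursive n f" "represents_recursive (n + 2) g"
  shows "represents_recursive (Suc n) (\<lambda>xs. rec_nat (f (tl xs)) (\<lambda>k r. g (k # r # tl xs)) (hd xs))"
proof -
  obtain F where F: "recursive_fun n F" "\<And>xs. length xs = n \<Longrightarrow> F xs = f xs"
    using represents_recursiveE[OF assms(1)] by blast
  obtain G where G: "recursive_fun (n + 2) G" "\<And>xs. length xs = n + 2 \<Longrightarrow> G xs = g xs"
    using represents_recursiveE[OF assms(2)] by blast
  have "rec_nat (F (tl xs)) (\<lambda>k r. G (k # r # tl xs)) m = rec_nat (f (tl xs)) (\<lambda>k r. g (k # r # tl xs)) m"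
    if "length xs = Suc n" for xs m
    using that F(2) G(2) by (induction m) auto
  then show ?thesis by (rule represents_recursiveI[OF recursive_fun.prim_rec[OF F(1) G(1)]])
qed

lemma represents_recursive_cong:
  assumes "represents_recursive n f" "\<And>xs. length xs = n \<Longrightarrow> f xs = g xs"
  shows "represents_recursive n g"
proof -
  obtain F where F: "recursive_fun n F" "\<And>xs. length xs = n \<Longrightarrow> F xs = f xs"
    using represents_recursiveE[OF assms(1)] by blast
  then show ?thesis using assms(2) by (intro represents_recursiveI[of n F]) auto
qed

lemma represents_recursive_add:
  assumes "represents_recursive n g" "represents_recursive n h"
  shows "represents_recursive n (\<lambda>xs. g xs + h xs)"
proof -
  have "represents_recursive (Suc 1) (\<lambda>xs. rec_nat (tl xs ! 0) (\<lambda>k r. Suc ((k # r # tl xs) ! 1)) (hd xs))"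
    by (rule represents_recursive_prim_rec[where g = "\<lambda>xs. Suc (xs ! 1)"])
       (auto intro: represents_recursive_Suc represents_recursive_proj)
  then have "represents_recursive 2 (\<lambda>xs. xs ! 0 + xs ! 1)"
    unfolding Suc_1
  proof (rule represents_recursive_cong)
    fix xs :: "nat list" assume "length xs = 2"
    then obtain x y where xs: "xs = [x, y]" by (auto simp: numeral_2_eq_2 length_Suc_conv)
    have "rec_nat y (\<lambda>k r. Suc r) x = x + y" by (induction x) auto
    then show "rec_nat (tl xs ! 0) (\<lambda>k r. Suc ((k # r # tl xs) ! 1)) (hd xs) = xs ! 0 + xs ! 1" by (simp add: xs)
  qed
  from represents_recursive_comp2[OF this assms] show ?thesis by simp
qed

lemma represents_recursive_mult:
  assumes "represents_recursive n g" "represents_recursive n h"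
  shows "represents_recursive n (\<lambda>xs. g xs * h xs)"
proof -
  have "represents_recursive (Suc 1) (\<lambda>xs. rec_nat 0 (\<lambda>k r. (k # r # tl xs) ! 1 + (k # r # tl xs) ! 2) (hd xs))"
    by (rule represents_recursive_prim_rec[where f = "\<lambda>_. 0" and g = "\<lambda>xs. xs ! 1 + xs ! 2"])
       (auto intro!: represents_recursive_add represents_recursive_proj represents_recursive_const)
  then have "represents_recursive 2 (\<lambda>xs. xs ! 0 * xs ! 1)"
    unfolding Suc_1
  proof (rule represents_recursive_cong)
    fix xs :: "nat list" assume "length xs = 2"
    then obtain x y where xs: "xs = [x, y]" by (auto simp: numeral_2_eq_2 length_Suc_conv)
    have "rec_nat 0 (\<lambda>k r. r + y) x = x * y" by (induction x) auto
    then show "rec_nat 0 (\<lambda>k r. (k # r # tl xs) ! 1 + (k # r # tl xs) ! 2) (hd xs) = xs ! 0 * xs ! 1" by (simp add: xs numeral_2_eq_2)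
  qed
  from represents_recursive_comp2[OF this assms] show ?thesis by simp
qed

lemma represents_recursive_pred:
  assumes "represents_recursive n g" shows "represents_recursive n (\<lambda>xs. g xs - 1)"
proof -
  have "represents_recursive (Suc 0) (\<lambda>xs. rec_nat 0 (\<lambda>k r. (k # r # tl xs) ! 0) (hd xs))"
    by (rule represents_recursive_prim_rec[where f = "\<lambda>_. 0" and g = "\<lambda>xs. xs ! 0"])
       (auto intro!: represents_recursive_proj represents_recursive_const)
  then have "represents_recursive 1 (\<lambda>xs. xs ! 0 - 1)"
    unfolding One_nat_def
  proof (rule represents_recursive_cong)
    fix xs :: "nat list" assume "length xs = Suc 0"
    then obtain x where xs: "xs = [x]" by (auto simp: length_Suc_conv)
    show "rec_nat 0 (\<lambda>k r. (k # r # tl xs) ! 0) (hd xs) = xs ! 0 - Suc 0" by (cases x) (auto simp: xs)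
  qed
  from represents_recursive_comp1[OF this assms] show ?thesis by simp
qed

lemma represents_recursive_diff:
  assumes "represents_recursive n g" "represents_recursive n h"
  shows "represents_recursive n (\<lambda>xs. g xs - h xs)"
proof -
  \<comment> \<open>The recursion runs over the first argument and iterates the predecessor, so the
    subtrahend comes first; the two are exchanged at the end.\<close>
  have "represents_recursive (Suc 1) (\<lambda>xs. rec_nat (tl xs ! 0) (\<lambda>k r. (k # r # tl xs) ! 1 - 1) (hd xs))"
    by (rule represents_recursive_prim_rec[where f = "\<lambda>xs. xs ! 0" and g = "\<lambda>xs. xs ! 1 - 1"])
       (rule represents_recursive_pred represents_recursive_proj, simp)+
  then have "represents_recursive 2 (\<lambda>xs. xs ! 1 - xs ! 0)"
    unfolding Suc_1
  proof (rule represents_recursive_cong)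
    fix xs :: "nat list" assume "length xs = 2"
    then obtain x y where xs: "xs = [x, y]" by (auto simp: numeral_2_eq_2 length_Suc_conv)
    have "rec_nat y (\<lambda>k r. r - 1) x = y - x" by (induction x) auto
    then show "rec_nat (tl xs ! 0) (\<lambda>k r. (k # r # tl xs) ! 1 - 1) (hd xs) = xs ! 1 - xs ! 0" by (simp add: xs)
  qed
  from represents_recursive_comp2[OF this assms(2,1)] show ?thesis by simp
qed

lemma represents_recursive_Least:
  assumes "represents_recursive (Suc n) f" "\<And>xs. length xs = n \<Longrightarrow> \<exists>y. f (y # xs) = 0"
  shows "represents_recursive n (\<lambda>xs. LEAST y. f (y # xs) = 0)"
proof -
  obtain F where F: "recursive_fun (Suc n) F" "\<And>xs. length xs = Suc n \<Longrightarrow> F xs = f xs"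
    using assms(1) unfolding represents_recursive_def by blast
  have "recursive_fun n (\<lambda>xs. LEAST y. F (y # xs) = 0)"
    by (rule recursive_fun.minim[OF F(1)]) (use F(2) assms(2) in auto)
  then show ?thesis by (rule represents_recursiveI) (simp add: F(2))
qed

text \<open>The factor \<open>a\<close> makes the minimisation total: for \<open>a = 0\<close> the minimised function vanishes identically.\<close>

lemma represents_recursive_ceiling_div:
  "represents_recursive 2 (\<lambda>xs. LEAST y. xs ! 0 * (xs ! 1 - xs ! 0 * y) = 0)"
proof -
  have "represents_recursive (Suc 2) (\<lambda>ys. ys ! 1 * (ys ! 2 - ys ! 1 * ys ! 0))"
    by (intro represents_recursive_mult represents_recursive_diff represents_recursive_proj) auto
  moreover have "\<exists>y. ((y # xs) ! 1 * ((y # xs) ! 2 - (y # xs) ! 1 * (y # xs) ! 0)) = 0" if "length xs = 2" for xs :: "nat list"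
  proof (cases "xs ! 0 = 0")
    case False
    then have "xs ! 1 * 1 \<le> xs ! 0 * xs ! 1" by (simp add: mult.commute)
    then show ?thesis by (intro exI[of _ "xs ! 1"]) (simp add: numeral_2_eq_2)
  qed simp
  ultimately have "represents_recursive 2 (\<lambda>xs. LEAST y. ((y # xs) ! 1 * ((y # xs) ! 2 - (y # xs) ! 1 * (y # xs) ! 0)) = 0)"
    by (rule represents_recursive_Least)
  then show ?thesis by (simp add: numeral_2_eq_2)
qed

text \<open>At \<epsilon> = a / b the ceiling of 1 / \<epsilon> is the least y with b <= a y, that
  is, with vanishing truncated difference b - a y.\<close>

lemma computable_ceiling_inverse_square:
  "computable_at_pos_rationals (\<lambda>\<epsilon>. 2 * (K * (nat \<lceil>1 / \<epsilon>\<rceil>)\<^sup>2) + 1)"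
proof -
  define c where "c xs = (LEAST y. xs ! 0 * (xs ! 1 - xs ! 0 * y) = 0)" for xs :: "nat list"
  have c: "represents_recursive 2 c"
    unfolding c_def by (rule represents_recursive_ceiling_div)
  have rep: "represents_recursive 2 (\<lambda>xs. 2 * (K * (c xs * c xs)) + 1)"
    by (rule represents_recursive_add[OF represents_recursive_mult[OF represents_recursive_const
          represents_recursive_mult[OF represents_recursive_const represents_recursive_mult[OF c c]]] represents_recursive_const])
  obtain F where F: "recursive_fun 2 F" "\<And>xs. length xs = 2 \<Longrightarrow> F xs = 2 * (K * (c xs * c xs)) + 1"
    using represents_recursiveE[OF rep] by blast
  have "2 * (K * (nat \<lceil>1 / (real a / real b)\<rceil>)\<^sup>2) + 1 = F [a, b]" if "a > 0" "b > 0" for a b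
  proof -
    have "c [a, b] = nat \<lceil>real b / real a\<rceil>"
      unfolding c_def
    proof (rule Least_equality)
      have "real b / real a \<le> real (nat \<lceil>real b / real a\<rceil>)" by (rule real_nat_ceiling_ge)
      then have "real b \<le> real (nat \<lceil>real b / real a\<rceil>) * real a"
        using that by (simp only: pos_divide_le_eq of_nat_0_less_iff)
      then have "real b \<le> real (a * nat \<lceil>real b / real a\<rceil>)" by (simp only: of_nat_mult mult.commute)
      then have "b \<le> a * nat \<lceil>real b / real a\<rceil>" by (simp only: of_nat_le_iff)
      then show "[a, b] ! 0 * ([a, b] ! 1 - [a, b] ! 0 * nat \<lceil>real b / real a\<rceil>) = 0" by simp
      fix y assume "[a, b] ! 0 * ([a, b] ! 1 - [a, b] ! 0 * y) = 0"
      then have "b \<le> a * y" using that by simp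
      then have "real b \<le> real (a * y)" by (simp only: of_nat_le_iff)
      then have "real b / real a \<le> real y" using that by (simp add: field_simps)
      then show "nat \<lceil>real b / real a\<rceil> \<le> y" by (simp add: nat_le_iff ceiling_le_iff)
    qed
    then show ?thesis using F(2)[of "[a, b]"] by (simp add: power2_eq_square)
  qed
  then show ?thesis unfolding computable_at_pos_rationals_def by (intro exI[of _ F] conjI F(1)) simp
qed

lemma least_prime_in_exists:
  assumes "prime p" "int p \<in> S"
  shows "\<exists>r. is_least_prime_in r S \<and> r \<le> int p"
proof -
  define r where "r = (LEAST r. prime r \<and> int r \<in> S)"
  have r: "prime r \<and> int r \<in> S"
    unfolding r_def by (rule LeastI[where k = p]) (use assms in simp)
  have le: "r \<le> x" if "prime x" "int x \<in> S" for x
    unfolding r_def by (rule Least_le) (use that in simp)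
  have "is_least_prime_in (int r) S"
    unfolding is_least_prime_in_def
  proof (intro conjI ballI impI)
    fix x assume x: "x \<in> S" "prime x"
    have "0 \<le> x" using x(2) by (rule prime_ge_0_int)
    then obtain y where y: "x = int y" by (rule nonneg_int_cases)
    then show "int r \<le> x" using le[of y] x by simp
  qed (use r in auto)
  then show ?thesis using le[OF assms] by auto
qed

section \<open>The bound\<close>

text \<open>10^24 is the constant in U V^2 and 60^39 comes from g <= 60 L (1 + ln Q). The power of 2
  covers J <= 2 \<alpha>, the rounding of N, and the factors 1/2 lost where powers of L are
  raised.\<close>

definition prime_bound_constant :: real where
  "prime_bound_constant = 10 ^ 24 * 60 ^ 39 * 2 ^ 60"

text \<open>Since q = L^16 \<alpha>^2 Q, the bound equals \<open>Y\<close> = L^51 \<alpha>^4 B Q^(1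
  + \<epsilon>), and N is its integer part. Each condition of \<open>exists_beatty_prime\<close> is
  checked by letting Q^\<epsilon> absorb the constant and the powers of \<open>W\<close>, and
  raising the remaining power of L to the one available.\<close>

lemma exists_beatty_prime_le:
  fixes \<alpha> \<beta> \<epsilon> B L X Q :: real and q :: nat
  assumes \<alpha>: "\<alpha> > 1" and \<beta>: "\<beta> \<ge> 0" and sp: "spaced (1 / \<alpha>) q" and q: "q \<ge> 2" and \<epsilon>: "0 < \<epsilon>" "\<epsilon> \<le> 1"
  defines "B \<equiv> max 1 \<beta>" and "L \<equiv> ln (2 * \<alpha> * B)" and "X \<equiv> L ^ 16 * \<alpha>\<^sup>2" and "Q \<equiv> real q / X"
  assumes Q1: "Q \<ge> 1" and big: "prime_bound_constant * (1 + ln Q) ^ 39 \<le> Q powr \<epsilon>"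
  shows "\<exists>p. prime p \<and> int p \<in> beatty \<alpha> \<beta> \<and> real p \<le> L ^ 35 * \<alpha>\<^sup>2 * B * real q * Q powr \<epsilon>"
proof -
  define C where "C = prime_bound_constant"
  have C: "C = 10 ^ 24 * 60 ^ 39 * 2 ^ 60" by (simp only: C_def prime_bound_constant_def)
  define W where "W = 1 + ln Q"
  define E where "E = Q powr \<epsilon>"
  define Y where "Y = L ^ 35 * \<alpha>\<^sup>2 * B * real q * E"
  have lnQ: "ln Q \<ge> 0" using Q1 by simp
  have W1: "W \<ge> 1" using lnQ by (simp add: W_def)
  have B1: "B \<ge> 1" "\<beta> \<le> B" by (simp_all add: B_def)
  have Leq: "L = ln 2 + ln \<alpha> + ln B" using \<alpha> B1 by (simp add: L_def ln_mult)
  have lns: "ln \<alpha> \<ge> 0" "ln B \<ge> 0" using \<alpha> B1 by auto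
  have L: "1 / 2 \<le> L" using ln_two_ge_half lns unfolding Leq by linarith
  have L0: "L > 0" using L by linarith
  \<comment> \<open>L may be below 1, so raising its exponent costs a factor 1/2 per step.\<close>
  have Lp: "L ^ a * (1 / 2) ^ b \<le> L ^ (a + b)" for a b
    unfolding power_add using L L0 by (intro mult_left_mono power_mono) auto
  have X0: "X > 0" unfolding X_def using L0 \<alpha> by simp
  have "real q = X * Q" using X0 by (simp add: Q_def)
  then have qX: "real q = L ^ 16 * (\<alpha>\<^sup>2 * Q)" by (simp only: X_def mult.assoc)
  have WC: "C * W ^ n \<le> E" if "n \<le> 39" for n
  proof -
    have "C * W ^ n \<le> C * W ^ 39" using that W1 by (intro mult_left_mono power_increasing) (auto simp: C)
    then show ?thesis using big by (simp add: W_def E_def C_def)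
  qed
  \<comment> \<open>Here \<epsilon> <= 1 matters: in \<open>c1\<close> only Q is available, since q
    = X Q has no factor Q^\<epsilon>.\<close>
  have EQ: "E \<le> Q" unfolding E_def using powr_mono[of \<epsilon> 1 Q] \<epsilon> Q1 by simp
  have E1: "E \<ge> 1" unfolding E_def using Q1 \<epsilon> by (intro ge_one_powr_ge_zero) auto
  have Y2: "Y = L ^ 51 * \<alpha> ^ 4 * B * Q * E"
  proof -
    have "L ^ 35 * \<alpha>\<^sup>2 * B * (L ^ 16 * (\<alpha>\<^sup>2 * Q)) * E = (L ^ 35 * L ^ 16) * (\<alpha>\<^sup>2 * \<alpha>\<^sup>2) * B * Q * E"
      by (simp only: mult_ac)
    then show ?thesis unfolding Y_def qX by (simp add: power_add[symmetric])
  qed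
  have Ybig: "L ^ n * (1 / 2) ^ (51 - n) * \<alpha> ^ k * B * (C * W ^ j) \<le> Y" if "n \<le> 51" "k \<le> 4" "j \<le> 39" for n k j
  proof -
    have "L ^ n * (1 / 2) ^ (51 - n) * \<alpha> ^ k * B * (C * W ^ j) \<le> L ^ 51 * \<alpha> ^ 4 * B * E"
      using Lp[of n "51 - n"] that \<alpha> B1 L0 W1 WC[of j]
      by (intro mult_mono power_increasing) (auto simp: C)
    also have "\<dots> * 1 \<le> L ^ 51 * \<alpha> ^ 4 * B * E * Q"
      using Q1 L0 \<alpha> B1 E1 by (intro mult_left_mono) auto
    finally show ?thesis unfolding Y2 by (simp add: mult_ac)
  qed
  have Y40: "Y \<ge> 40"
  proof -
    have "40 \<le> (1 / 2) ^ 51 * C" by (simp add: C power_divide)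
    also have "\<dots> \<le> Y" using Ybig[of 0 0 0] B1
      by (intro order.trans[OF _ Ybig[of 0 0 0]]) (auto simp: C)
    finally show ?thesis .
  qed
  \<comment> \<open>As Y >= 40, rounding down loses at most half; this is the additional 1/2 in
    \<open>c2\<close>, \<open>c3\<close> and \<open>c4\<close>.\<close>
  define N where "N = nat \<lfloor>Y\<rfloor>"
  have NY: "real N \<le> Y" "Y / 2 \<le> real N" "N \<ge> 20" using Y40 unfolding N_def by linarith+
  define g where "g = nat \<lceil>1 + ln (real N)\<rceil>"
  have lnN: "ln (real N) \<ge> 0" using NY by simp
  have gG: "1 + ln (real N) \<le> real g" "real g \<le> 2 + ln (real N)" using lnN unfolding g_def by linarith+
  have gM: "real g \<le> 60 * L * W"
  proof -
    have "ln (real N) \<le> ln Y" using NY by simp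
    also have "ln Y = 51 * ln L + 4 * ln \<alpha> + ln B + ln Q + \<epsilon> * ln Q"
      unfolding Y2 E_def using L0 \<alpha> B1 Q1 by (simp add: ln_mult ln_realpow ln_powr)
    also have "\<dots> \<le> 55 * L + 2 * ln Q"
    proof -
      have "ln L \<le> L" using ln_le_minus_one[OF L0] by linarith
      moreover have "4 * ln \<alpha> + ln B \<le> 4 * L" using lns ln_two_ge_half unfolding Leq by argo
      moreover have "\<epsilon> * ln Q \<le> 1 * ln Q" using \<epsilon> lnQ by (intro mult_right_mono) auto
      ultimately show ?thesis by argo
    qed
    finally have "real g \<le> 2 + 55 * L + 2 * ln Q" using gG by linarith
    moreover have "1 / 2 * ln Q \<le> L * ln Q" using L lnQ by (intro mult_right_mono)
    moreover have "0 \<le> L * ln Q" using L0 lnQ by simp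
    moreover have "60 * L * W = 60 * L + 60 * (L * ln Q)" by (simp add: W_def algebra_simps)
    ultimately show ?thesis using L by argo
  qed
  define J where "J = nat \<lceil>2 * \<alpha>\<rceil> - 1"
  have "3 \<le> nat \<lceil>2 * \<alpha>\<rceil>" using \<alpha> by linarith
  then have J: "J \<ge> 2" "2 * \<alpha> \<le> real (J + 1)" "real J \<le> 2 * \<alpha>" using \<alpha> unfolding J_def by linarith+
  have gM': "real g ^ n \<le> (60 * L * W) ^ n" for n using gM by (intro power_mono) auto
  have LW0: "0 \<le> 60 * L * W" using L0 W1 by simp
  have c1: "10 ^ 8 * real J ^ 2 * real g ^ 13 \<le> real q"
  proof -
    have "10 ^ 8 * real J ^ 2 * real g ^ 13 \<le> 10 ^ 8 * (2 * \<alpha>) ^ 2 * (60 * L * W) ^ 13"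
      using J \<alpha> by (intro mult_mono power_mono gM') auto
    also have "\<dots> = (4 * 10 ^ 8 * 60 ^ 13) * (L ^ 13 * W ^ 13 * \<alpha>\<^sup>2)" unfolding power_mult_distrib by simp
    also have "\<dots> \<le> (C / 8) * (L ^ 13 * W ^ 13 * \<alpha>\<^sup>2)"
      using L0 W1 by (intro mult_right_mono) (auto simp: C)
    also have "\<dots> = (L ^ 13 * (1 / 2) ^ 3) * (\<alpha>\<^sup>2 * (C * W ^ 13))" by (simp add: power3_eq_cube)
    also have "\<dots> \<le> L ^ (13 + 3) * (\<alpha>\<^sup>2 * Q)"
      using WC[of 13] EQ L0 W1 by (intro mult_mono Lp mult_left_mono) (auto simp: C)
    finally show ?thesis by (simp add: qX)
  qed
  have c2: "10 ^ 8 * real J * real g ^ 13 * real q \<le> real N"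
  proof -
    have "10 ^ 8 * real J * real g ^ 13 * real q \<le> 10 ^ 8 * (2 * \<alpha>) * (60 * L * W) ^ 13 * real q"
      using J \<alpha> LW0 by (intro mult_mono gM') auto
    also have "\<dots> = (2 * 10 ^ 8 * 60 ^ 13) * (L ^ 13 * W ^ 13 * \<alpha> * real q)" unfolding power_mult_distrib by simp
    also have "\<dots> \<le> (C / 2 ^ 23) * (L ^ 13 * W ^ 13 * \<alpha> * real q)"
      using L0 W1 \<alpha> by (intro mult_right_mono) (auto simp: C)
    \<comment> \<open>22 factors 1/2 take L^13 to L^35, and the 23rd pays for N >= Y / 2.\<close>
    also have "\<dots> = ((L ^ 13 * (1 / 2) ^ 22) * \<alpha> ^ 1 * 1 * real q * (C * W ^ 13)) / 2" by (simp add: power_divide)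
    also have "\<dots> \<le> (L ^ (13 + 22) * \<alpha> ^ 2 * B * real q * E) / 2"
      using WC[of 13] L0 W1 \<alpha> B1 E1
      by (intro divide_right_mono mult_mono Lp power_increasing) (auto simp: C)
    also have "\<dots> = Y / 2" by (simp add: Y_def)
    finally show ?thesis using NY by linarith
  qed
  have c3: "10 ^ 24 * real J ^ 4 * real g ^ 39 \<le> real N"
  proof -
    have "10 ^ 24 * real J ^ 4 * real g ^ 39 \<le> 10 ^ 24 * (2 * \<alpha>) ^ 4 * (60 * L * W) ^ 39"
      using J \<alpha> by (intro mult_mono power_mono gM') auto
    also have "\<dots> = (16 * 10 ^ 24 * 60 ^ 39) * (L ^ 39 * W ^ 39 * \<alpha> ^ 4)" unfolding power_mult_distrib by simp
    also have "\<dots> \<le> (C / 2 ^ 13) * (L ^ 39 * W ^ 39 * \<alpha> ^ 4)"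
      using L0 W1 by (intro mult_right_mono) (auto simp: C)
    also have "\<dots> = (L ^ 39 * (1 / 2) ^ (51 - 39) * \<alpha> ^ 4 * 1 * (C * W ^ 39)) / 2" by (simp add: power_divide)
    also have "\<dots> \<le> (L ^ 39 * (1 / 2) ^ (51 - 39) * \<alpha> ^ 4 * B * (C * W ^ 39)) / 2"
      using B1 L0 W1 by (intro divide_right_mono mult_right_mono mult_left_mono) (auto simp: C)
    also have "\<dots> \<le> Y / 2" by (intro divide_right_mono Ybig) auto
    finally show ?thesis using NY by linarith
  qed
  have c4: "64 * real J * \<beta> * real g \<le> real N"
  proof -
    have "64 * real J * \<beta> * real g \<le> 64 * (2 * \<alpha>) * B * (60 * L * W)"
      using J \<alpha> \<beta> B1 by (intro mult_mono gM) auto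
    also have "\<dots> = (64 * 2 * 60) * (L * W * \<alpha> * B)" by simp
    also have "\<dots> \<le> (C / 2 ^ 51) * (L * W * \<alpha> * B)"
      using L0 W1 \<alpha> B1 by (intro mult_right_mono) (auto simp: C)
    also have "\<dots> = (L ^ 1 * (1 / 2) ^ (51 - 1) * \<alpha> ^ 1 * B * (C * W ^ 1)) / 2" by (simp add: power_divide)
    also have "\<dots> \<le> Y / 2" by (intro divide_right_mono Ybig) auto
    finally show ?thesis using NY by linarith
  qed
  obtain p where p: "prime p" "p \<le> N" "int p \<in> beatty \<alpha> \<beta>"
    using exists_beatty_prime[OF \<alpha> \<beta> J(1,2) sp q gG(1) c1 c2 c3 c4 NY(3)] by blast
  have "real p \<le> Y" using p(2) NY(1) by linarith
  then show ?thesis using p by (auto simp: Y_def E_def)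
qed

theorem theorem1:
  "\<exists>l :: real \<Rightarrow> nat. computable_at_pos_rationals l \<and>
     (\<forall>\<epsilon>>0. l \<epsilon> > 0 \<and>
       (\<forall>\<alpha> \<beta> :: real. \<alpha> > 1 \<and> \<alpha> \<notin> \<rat> \<and> \<beta> \<ge> 0 \<longrightarrow>
         (let B = max 1 \<beta>; L = ln (2 * \<alpha> * B) in
           (\<exists>!m. numerator_bracket \<alpha> (L ^ 16 * \<alpha>\<^sup>2) m) \<and>
           (\<exists>p. is_least_prime_in p (beatty \<alpha> \<beta>) \<and>
             (\<forall>m. numerator_bracket \<alpha> (L ^ 16 * \<alpha>\<^sup>2) m \<longrightarrow>
               real_of_int p \<le> L powr (35 - 16 * \<epsilon>) * \<alpha> powr (2 * (1 - \<epsilon>)) * B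
                 * real_of_int (conv_numerator \<alpha> (m + int (l \<epsilon>))) powr (1 + \<epsilon>))))))"
proof -
  have "prime_bound_constant \<ge> 1" by (simp add: prime_bound_constant_def)
  from powr_beats_ln_power[OF this] obtain K :: nat where K: "K \<ge> 1"
    "\<And>\<epsilon> Q. 0 < \<epsilon> \<Longrightarrow> \<epsilon> \<le> 1 \<Longrightarrow> Q > 0 \<Longrightarrow> real K / \<epsilon>\<^sup>2 \<le> ln Q \<Longrightarrow> prime_bound_constant * (1 + ln Q) ^ 39 \<le> Q powr \<epsilon>"
    by blast
  \<comment> \<open>With n the ceiling of 1 / \<epsilon>, 2 K n^2 doublings give ln Q >= K n^2, as
    ln 2 >= 1/2. A doubling takes two indices, and the final 1 leads from p_m to p_(m+1) >
    X.\<close>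
  define l where "l = (\<lambda>\<epsilon>::real. 2 * (2 * K * (nat \<lceil>1 / \<epsilon>\<rceil>)\<^sup>2) + 1)"
  have main: "(let B = max 1 \<beta>; L = ln (2 * \<alpha> * B) in
           (\<exists>!m. numerator_bracket \<alpha> (L ^ 16 * \<alpha>\<^sup>2) m) \<and>
           (\<exists>p. is_least_prime_in p (beatty \<alpha> \<beta>) \<and>
             (\<forall>m. numerator_bracket \<alpha> (L ^ 16 * \<alpha>\<^sup>2) m \<longrightarrow>
               real_of_int p \<le> L powr (35 - 16 * \<epsilon>) * \<alpha> powr (2 * (1 - \<epsilon>)) * B
                 * real_of_int (conv_numerator \<alpha> (m + int (l \<epsilon>))) powr (1 + \<epsilon>))))"
    if \<epsilon>: "\<epsilon> > 0" and \<alpha>: "\<alpha> > 1" "\<alpha> \<notin> \<rat>" and \<beta>: "\<beta> \<ge> 0" for \<epsilon> \<alpha> \<beta> :: real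
  proof -
    define B where "B = max 1 \<beta>"
    define L where "L = ln (2 * \<alpha> * B)"
    define X where "X = L ^ 16 * \<alpha>\<^sup>2"
    have B1: "B \<ge> 1" by (simp add: B_def)
    have "1 * 1 < \<alpha> * B" using \<alpha> B1 by (intro mult_less_le_imp_less) auto
    then have L0: "L > 0" unfolding L_def by (intro ln_gt_zero) linarith
    have X0: "X > 0" unfolding X_def using L0 \<alpha> by simp
    have ex1: "\<exists>!m. numerator_bracket \<alpha> X m" using ex1_numerator_bracket[OF \<alpha>] X0 by simp
    then obtain m where m: "numerator_bracket \<alpha> X m" by blast
    have muniq: "m' = m" if "numerator_bracket \<alpha> X m'" for m' using ex1 m that by blast
    define n where "n = nat \<lceil>1 / \<epsilon>\<rceil>"
    define i where "i = 2 * K * n\<^sup>2"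
    define k where "k = nat (m + 2)"
    have k: "X < real_of_int (shifted_numerator \<alpha> (Suc k))" "m \<ge> -2"
      using m numerator_bracket_iff[OF \<alpha>] by (auto simp: k_def)
    define P where "P = shifted_numerator \<alpha> (Suc (k + 2 * i))"
    have "l \<epsilon> = 2 * i + 1" by (simp only: l_def i_def n_def)
    then have "nat (m + int (l \<epsilon>) + 2) = Suc (k + 2 * i)" using k(2) unfolding k_def by linarith
    then have Pm: "conv_numerator \<alpha> (m + int (l \<epsilon>)) = P" by (simp only: conv_numerator_def P_def)
    have dbl: "2 ^ i * shifted_numerator \<alpha> (Suc k) \<le> P"
      using shifted_numerator_doubling[OF \<alpha>, of i "Suc k"] by (simp add: P_def)
    have n0: "1 / \<epsilon> \<le> real n" unfolding n_def by (rule real_nat_ceiling_ge)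
    moreover have "1 / \<epsilon> > 0" using \<epsilon> by simp
    ultimately have "real n > 0" by linarith
    then have n1: "1 / \<epsilon> \<le> real n" "n \<ge> 1" using n0 by simp_all
    have "1 * 1 * 1 \<le> 2 * K * n\<^sup>2" using K n1 by (intro mult_le_mono) auto
    then have i1: "i \<ge> 1" by (simp add: i_def)
    have P2: "P \<ge> 2"
    proof -
      have "(2::int) ^ 1 \<le> 2 ^ i" using i1 by (intro power_increasing) auto
      then have "2 * 1 \<le> 2 ^ i * shifted_numerator \<alpha> (Suc k)"
        using shifted_numerator_nonneg[OF \<alpha>, of k] by (intro mult_mono) auto
      then show ?thesis using dbl by linarith
    qed
    define q where "q = nat P"
    have q2: "q \<ge> 2" and qP: "real q = real_of_int P" using P2 by (auto simp: q_def)
    have sp: "spaced (1 / \<alpha>) q" unfolding q_def P_def by (rule spaced_shifted_numerator[OF \<alpha>])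
    define Q where "Q = real q / X"
    have Q2: "2 ^ i \<le> Q"
    proof -
      have "real_of_int (2 ^ i * shifted_numerator \<alpha> (Suc k)) \<le> real q" using dbl unfolding qP by (simp only: of_int_le_iff)
      then have "2 ^ i * real_of_int (shifted_numerator \<alpha> (Suc k)) \<le> real q" by simp
      moreover have "2 ^ i * X \<le> 2 ^ i * real_of_int (shifted_numerator \<alpha> (Suc k))" using k(1) by (intro mult_left_mono) auto
      ultimately have "2 ^ i * X \<le> real q" by linarith
      then show ?thesis using X0 by (simp add: Q_def field_simps)
    qed
    have Q1: "Q \<ge> 1" using Q2 one_le_power[of "2::real" i] by linarith
    \<comment> \<open>For \<epsilon> > 1 the bound with exponent 1 is stronger, because Q >=
      1.\<close>
    define \<delta> where "\<delta> = min \<epsilon> 1"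
    have \<delta>: "0 < \<delta>" "\<delta> \<le> 1" "\<delta> \<le> \<epsilon>" using \<epsilon> by (auto simp: \<delta>_def)
    have "real K / \<delta>\<^sup>2 \<le> ln Q"
    proof -
      have "1 / \<delta> \<le> real n" using n1 by (auto simp: \<delta>_def min_def)
      then have "(1 / \<delta>)\<^sup>2 \<le> (real n)\<^sup>2" using \<delta> by (intro power_mono) auto
      then have "real K * (1 / \<delta>)\<^sup>2 \<le> real K * (real n)\<^sup>2" by (intro mult_left_mono) auto
      also have "\<dots> = real i * (1 / 2)" by (simp add: i_def)
      also have "\<dots> \<le> real i * ln 2" using ln_two_ge_half by (intro mult_left_mono) auto
      also have "\<dots> = ln (2 ^ i)" by (simp add: ln_realpow)
      also have "\<dots> \<le> ln Q" using Q2 Q1 by simp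
      finally show ?thesis by (simp add: power_divide)
    qed
    then have big: "prime_bound_constant * (1 + ln Q) ^ 39 \<le> Q powr \<delta>" using K(2) \<delta> Q1 by simp
    have "\<exists>p. prime p \<and> int p \<in> beatty \<alpha> \<beta> \<and> real p \<le> L ^ 35 * \<alpha>\<^sup>2 * B * real q * Q powr \<delta>"
      using Q1 big unfolding B_def L_def X_def Q_def by (rule exists_beatty_prime_le[OF \<alpha>(1) \<beta> sp q2 \<delta>(1,2)])
    then obtain p where p: "prime p" "int p \<in> beatty \<alpha> \<beta>" "real p \<le> L ^ 35 * \<alpha>\<^sup>2 * B * real q * Q powr \<delta>"
      by blast
    obtain r where r: "is_least_prime_in r (beatty \<alpha> \<beta>)" "r \<le> int p" using least_prime_in_exists[OF p(1,2)] by blast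
    have "real_of_int r \<le> real p" using r(2) by linarith
    also have "\<dots> \<le> L ^ 35 * \<alpha>\<^sup>2 * B * real q * Q powr \<delta>" by (rule p(3))
    also have "\<dots> \<le> L ^ 35 * \<alpha>\<^sup>2 * B * real q * Q powr \<epsilon>"
      using L0 B1 Q1 \<delta> by (intro mult_left_mono powr_mono) auto
    \<comment> \<open>Dividing by X^\<epsilon> = L^(16 \<epsilon>) \<alpha>^(2 \<epsilon>) yields
      the exponents of the theorem.\<close>
    also have "\<dots> = L powr (35 - 16 * \<epsilon>) * \<alpha> powr (2 * (1 - \<epsilon>)) * B * real_of_int P powr (1 + \<epsilon>)"
    proof -
      have q0: "real q > 0" using q2 by simp
      have "X = L powr 16 * \<alpha> powr 2" using L0 \<alpha> by (simp add: X_def powr_numeral)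
      then have "X powr \<epsilon> = L powr (16 * \<epsilon>) * \<alpha> powr (2 * \<epsilon>)"
        by (simp only: powr_mult powr_powr)
      then have Qe: "Q powr \<epsilon> = real q powr \<epsilon> / (L powr (16 * \<epsilon>) * \<alpha> powr (2 * \<epsilon>))"
        using X0 q0 by (simp add: Q_def powr_divide)
      have "L powr (35 - 16 * \<epsilon>) = L ^ 35 / L powr (16 * \<epsilon>)"
        using L0 by (simp add: powr_diff powr_realpow)
      moreover have "\<alpha> powr (2 * (1 - \<epsilon>)) = \<alpha>\<^sup>2 / \<alpha> powr (2 * \<epsilon>)"
        using \<alpha> by (simp add: right_diff_distrib powr_diff powr_realpow)
      moreover have "real q powr (1 + \<epsilon>) = real q * real q powr \<epsilon>"
        using q0 by (simp add: powr_add)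
      ultimately show ?thesis unfolding qP[symmetric] Qe by simp
    qed
    finally have fin: "real_of_int r \<le> L powr (35 - 16 * \<epsilon>) * \<alpha> powr (2 * (1 - \<epsilon>)) * B * real_of_int (conv_numerator \<alpha> (m + int (l \<epsilon>))) powr (1 + \<epsilon>)"
      unfolding Pm .
    have "(\<exists>!m. numerator_bracket \<alpha> (L ^ 16 * \<alpha>\<^sup>2) m) \<and>
           (\<exists>p. is_least_prime_in p (beatty \<alpha> \<beta>) \<and>
             (\<forall>m. numerator_bracket \<alpha> (L ^ 16 * \<alpha>\<^sup>2) m \<longrightarrow>
               real_of_int p \<le> L powr (35 - 16 * \<epsilon>) * \<alpha> powr (2 * (1 - \<epsilon>)) * B
                 * real_of_int (conv_numerator \<alpha> (m + int (l \<epsilon>))) powr (1 + \<epsilon>)))"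
      unfolding X_def[symmetric]
    proof (intro conjI exI[of _ r] allI impI ex1 r(1))
      fix m' assume "numerator_bracket \<alpha> X m'"
      then have "m' = m" by (rule muniq)
      then show "real_of_int r \<le> L powr (35 - 16 * \<epsilon>) * \<alpha> powr (2 * (1 - \<epsilon>)) * B * real_of_int (conv_numerator \<alpha> (m' + int (l \<epsilon>))) powr (1 + \<epsilon>)"
        using fin by simp
    qed
    then show ?thesis unfolding Let_def L_def B_def .
  qed
  have comp: "computable_at_pos_rationals l"
    unfolding l_def by (rule computable_ceiling_inverse_square)
  show ?thesis
  proof (intro exI[of _ l] conjI allI impI comp)
    fix \<epsilon> :: real assume "\<epsilon> > 0"
    show "l \<epsilon> > 0" by (simp add: l_def)
  next
    fix \<epsilon> \<alpha> \<beta> :: real assume h: "\<epsilon> > 0" "\<alpha> > 1 \<and> \<alpha> \<notin> \<rat> \<and> \<beta> \<ge> 0"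
    show "(let B = max 1 \<beta>; L = ln (2 * \<alpha> * B) in
           (\<exists>!m. numerator_bracket \<alpha> (L ^ 16 * \<alpha>\<^sup>2) m) \<and>
           (\<exists>p. is_least_prime_in p (beatty \<alpha> \<beta>) \<and>
             (\<forall>m. numerator_bracket \<alpha> (L ^ 16 * \<alpha>\<^sup>2) m \<longrightarrow>
               real_of_int p \<le> L powr (35 - 16 * \<epsilon>) * \<alpha> powr (2 * (1 - \<epsilon>)) * B
                 * real_of_int (conv_numerator \<alpha> (m + int (l \<epsilon>))) powr (1 + \<epsilon>))))"
      by (rule main) (use h in simp_all)
  qed
qed

end
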